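(* There is a quantum algorithm that makes $\widetilde{O}(\sqrt{n})$ cut queries to an $n$-vertex simple graph $G$ and outputs the edge connectivity $\lambda(G)$ correctly with high probability. Similarly, there is a randomized algorithm making $\widetilde{O}(\sqrt{n})$ matrix-vector multiplication queries to the adjacency matrix of $G$ that outputs $\lambda(G)$ correctly with high probability.
   Context: A simple graph $G=(V,E)$ is undirected, unweighted, loopless, with at most one edge between any pair of vertices; $n=|V|$ and $A$ is its adjacency matrix. For $S\subseteq V$, $\mathrm{cut}_G(S)$ is the set of edges with exactly one endpoint in $S$; a cut query on $S$ returns $|\mathrm{cut}_G(S)|$ (a quantum algorithm may query this function in superposition, as a standard quantum oracle). A matrix-vector multiplication query specifies $x\in\{0,1\}^n$ and returns $Ax$. The edge connectivity is $\lambda(G)=\min_{\emptyset\neq S\subsetneq V}|\mathrm{cut}_G(S)|$. $\widetilde{O}$ hides polylogarithmic factors in $n$; "with high probability" means with probability $1-1/\mathrm{poly}(n)$. *)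

theory Defs
  imports
    "HOL-Probability.Probability_Mass_Function"
    "HOL-Library.Landau_Symbols"
    "HOL-Library.Log_Nat"
    "HOL-Library.Nat_Bijection"
    "Jordan_Normal_Form.Schur_Decomposition"
begin

text \<open>An edge of a simple graph is a two-element set of vertices.  The \<open>n\<close>-vertex graphs that
  serve as inputs of query algorithms have the vertex set \<open>{..<n}\<close>.\<close>

definition simple_graph :: "'v set \<Rightarrow> 'v set set \<Rightarrow> bool" where
  "simple_graph V E \<longleftrightarrow> finite V \<and> (\<forall>e\<in>E. e \<subseteq> V \<and> card e = 2)"

definition cut_edges :: "'v set set \<Rightarrow> 'v set \<Rightarrow> 'v set set" where
  "cut_edges E S = {e \<in> E. card (e \<inter> S) = 1}"

definition edge_connectivity :: "'v set \<Rightarrow> 'v set set \<Rightarrow> nat" where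
  "edge_connectivity V E = Min {card (cut_edges E S) | S. S \<noteq> {} \<and> S \<subset> V}"

definition adjacency_matrix :: "nat \<Rightarrow> nat set set \<Rightarrow> int mat" where
  "adjacency_matrix n E = mat n n (\<lambda>(i, j). if {i, j} \<in> E then 1 else 0)"

text \<open>The class of functions that are \<open>O(g(n) polylog n)\<close>.\<close>

definition soft_O :: "(nat \<Rightarrow> real) \<Rightarrow> (nat \<Rightarrow> real) set" where
  "soft_O g = (\<Union>k. O(\<lambda>n. g n * ln (real n) ^ k))"


section \<open>Quantum query algorithms\<close>

text \<open>The queried function is \<open>f\<close>, which assigns to each subset of \<open>{..<n}\<close> a number with at
  most \<open>m\<close> bits.  The state space has one basis vector for every triple of a subset \<open>S\<close> of
  \<open>{..<n}\<close> (query register), a number \<open>b < 2 ^ m\<close> (answer register) and a number \<open>k < w\<close>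
  (workspace).  Basis vectors are numbered by \<open>(set_encode S * 2 ^ m + b) * w + k\<close>.\<close>

definition state_dim :: "nat \<Rightarrow> nat \<Rightarrow> nat \<Rightarrow> nat" where
  "state_dim n m w = 2 ^ n * 2 ^ m * w"

definition basis_index :: "nat \<Rightarrow> nat \<Rightarrow> nat set \<Rightarrow> nat \<Rightarrow> nat \<Rightarrow> nat" where
  "basis_index m w S b k = (set_encode S * 2 ^ m + b) * w + k"

text \<open>The standard oracle: it sends the basis vector of \<open>(S, b, k)\<close> to that of
  \<open>(S, b XOR f S, k)\<close>.\<close>

definition quantum_oracle :: "nat \<Rightarrow> nat \<Rightarrow> nat \<Rightarrow> (nat set \<Rightarrow> nat) \<Rightarrow> complex mat" where
  "quantum_oracle n m w f =
     mat (state_dim n m w) (state_dim n m w)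
       (\<lambda>(i, j). let S = set_decode (j div (2 ^ m * w));
                    b = (j div w) mod 2 ^ m;
                    k = j mod w
                in if i = basis_index m w S (Bit_Operations.xor b (f S)) k then 1 else 0)"

definition unitary :: "nat \<Rightarrow> complex mat \<Rightarrow> bool" where
  "unitary d U \<longleftrightarrow> U \<in> carrier_mat d d \<and> mat_adjoint U * U = 1\<^sub>m d"

text \<open>An algorithm applies \<open>gate 0\<close>, oracle, \<open>gate 1\<close>, oracle, ..., oracle, \<open>gate T\<close> to the
  basis vector number 0, where \<open>T\<close> is the number of queries.  Then it measures in the
  basis of the state space and outputs \<open>result i\<close> if the measurement gives \<open>i\<close>.\<close>

record quantum_algorithm =
  num_queries :: nat
  workspace :: nat
  gate :: "nat \<Rightarrow> complex mat"
  result :: "nat \<Rightarrow> nat"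

definition valid_quantum_algorithm :: "nat \<Rightarrow> nat \<Rightarrow> quantum_algorithm \<Rightarrow> bool" where
  "valid_quantum_algorithm n m Q \<longleftrightarrow>
     workspace Q > 0 \<and> (\<forall>t \<le> num_queries Q. unitary (state_dim n m (workspace Q)) (gate Q t))"

primrec quantum_state ::
  "nat \<Rightarrow> nat \<Rightarrow> quantum_algorithm \<Rightarrow> (nat set \<Rightarrow> nat) \<Rightarrow> nat \<Rightarrow> complex Matrix.vec" where
  "quantum_state n m Q f 0 = gate Q 0 *\<^sub>v unit_vec (state_dim n m (workspace Q)) 0"
| "quantum_state n m Q f (Suc t) =
     gate Q (Suc t) *\<^sub>v (quantum_oracle n m (workspace Q) f *\<^sub>v quantum_state n m Q f t)"

definition quantum_output_prob ::
  "nat \<Rightarrow> nat \<Rightarrow> quantum_algorithm \<Rightarrow> (nat set \<Rightarrow> nat) \<Rightarrow> nat \<Rightarrow> real" where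
  "quantum_output_prob n m Q f v =
     (\<Sum>i | i < state_dim n m (workspace Q) \<and> result Q i = v.
        (cmod (vec_index (quantum_state n m Q f (num_queries Q)) i))\<^sup>2)"

text \<open>The cuts of an \<open>n\<close>-vertex simple graph have fewer than \<open>n * n\<close> edges (if \<open>n > 0\<close>), so
  this many bits suffice for the answer to a cut query.\<close>

definition cut_bits :: "nat \<Rightarrow> nat" where
  "cut_bits n = floorlog 2 (n * n)"


section \<open>Randomized query algorithms\<close>

text \<open>A deterministic algorithm is an adaptive decision tree; a randomized algorithm is a
  probability distribution on decision trees.\<close>

datatype ('q, 'a, 'r) decision_tree =
  Output 'r
| Query 'q "'a \<Rightarrow> ('q, 'a, 'r) decision_tree"

primrec admissible :: "'q set \<Rightarrow> ('q, 'a, 'r) decision_tree \<Rightarrow> bool" where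
  "admissible X (Output r) \<longleftrightarrow> True"
| "admissible X (Query x next) \<longleftrightarrow> x \<in> X \<and> (\<forall>a. admissible X (next a))"

primrec tree_output :: "('q \<Rightarrow> 'a) \<Rightarrow> ('q, 'a, 'r) decision_tree \<Rightarrow> 'r" where
  "tree_output f (Output r) = r"
| "tree_output f (Query x next) = tree_output f (next (f x))"

primrec tree_queries :: "('q \<Rightarrow> 'a) \<Rightarrow> ('q, 'a, 'r) decision_tree \<Rightarrow> nat" where
  "tree_queries f (Output r) = 0"
| "tree_queries f (Query x next) = Suc (tree_queries f (next (f x)))"

definition zero_one_vecs :: "nat \<Rightarrow> int Matrix.vec set" where
  "zero_one_vecs n = {x \<in> carrier_vec n. \<forall>i<n. vec_index x i \<in> {0, 1}}"

end

theory Submission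
  imports Defs
begin

text \<open>Both models can ask for the \<^emph>\<open>crossing numbers\<close> of a vertex set \<open>X\<close>: for every vertex, the number
  of edges of the cut of \<open>X\<close> at that vertex.  In the matrix-vector model they are read off \<open>A x\<close> and the
  degrees \<open>A 1\<close>.  In the quantum model, the sum of the crossing numbers over a set \<open>T\<close> is a combination
  of five cut values, so that the Bernstein-Vazirani algorithm finds all of them, one bit at a time.

  The cut algorithm uses crossing numbers only.  The neighbourhoods of the vertices of degree at most
  \<open>sqrt n\<close> are determined by the crossing numbers of about \<open>sqrt n\<close> random sets.  Every other vertex
  joins a random adjacent vertex of a random set of about \<open>sqrt n\<close> centres; it looks for this centre in one
  of \<open>log n\<close> rounds with independent candidates, and it settles in each round with probability \<open>1/2\<close>.
  A minimum cut \<open>S\<close> that is not a single vertex cuts at most half of the edges at each vertex, and the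
  fractions of cut edges at the vertices sum up to at most 2.  As a vertex settles across \<open>S\<close> in a
  given round with probability at most its fraction, Jensen's inequality gives a constant probability
  that no vertex ever does so.  The crossing numbers of the resulting clusters then determine all cuts that
  separate no cluster.  Single-vertex cuts are covered by the minimum degree, which is known in the
  matrix-vector model and found by Grover search in the quantum model.\<close>

section \<open>Quantum algorithms with phase queries\<close>

text \<open>The expected number of vertices that settle across a minimum cut is only bounded by 2,
  so a union bound is void, and independence is missing because all vertices look through the same
  candidates. The coin flips repair this: for fixed candidates they are independent over the
  vertices, and every vertex escapes a round with probability at least \<open>1/2\<close>, so the
  logarithm of the escape probability is bounded below and can be averaged over the candidates. The
  price is a success probability of about \<open>1/512\<close> per run. It suffices because errors
  are one-sided: with correct neighbourhoods a run evaluates true cuts only and never reports too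
  little, so repeated runs are combined by their minimum. The cut algorithm does not ask for
  degrees, which makes it the same in both models; low vertices are recognised by a small
  neighbourhood being consistent with the answers. Quantum subroutines are composed as
  distributions: a later stage is controlled by the label of an earlier one and measurement is
  deferred to the end, so the probability analysis is classical.\<close>

definition lin_op :: "'l set \<Rightarrow> ('l \<Rightarrow> 'l \<Rightarrow> complex) \<Rightarrow> ('l \<Rightarrow> complex) \<Rightarrow> 'l \<Rightarrow> complex" where
  "lin_op A u \<psi> i = (if i \<in> A then \<Sum>j\<in>A. u i j * \<psi> j else \<psi> i)"

definition isometric :: "'l set \<Rightarrow> ('l \<Rightarrow> 'l \<Rightarrow> complex) \<Rightarrow> bool" where
  "isometric A u \<longleftrightarrow> (\<forall>j\<in>A. \<forall>k\<in>A. (\<Sum>i\<in>A. cnj (u i j) * u i k) = of_bool (j = k))"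

text \<open>Gates are functions that act as the identity outside the label set, so the label set can
  be enlarged without changing the gate.\<close>

definition unitary_op :: "'l set \<Rightarrow> (('l \<Rightarrow> complex) \<Rightarrow> 'l \<Rightarrow> complex) \<Rightarrow> bool" where
  "unitary_op A F \<longleftrightarrow> (\<exists>u. isometric A u \<and> F = lin_op A u)"

lemma unitary_op_outside: "unitary_op A F \<Longrightarrow> i \<notin> A \<Longrightarrow> F \<psi> i = \<psi> i"
  unfolding unitary_op_def lin_op_def by auto

lemma unitary_op_scale: "unitary_op A F \<Longrightarrow> F (\<lambda>i. c * \<psi> i) = (\<lambda>i. c * F \<psi> i)"
  unfolding unitary_op_def lin_op_def by (auto simp: sum_distrib_left mult.left_commute intro!: sum.cong)

lemma unitary_op_comp:
  assumes "unitary_op A F" "unitary_op A G" "finite A"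
  shows "unitary_op A (\<lambda>\<psi>. F (G \<psi>))"
proof -
  obtain u v where u: "isometric A u" "F = lin_op A u" and v: "isometric A v" "G = lin_op A v"
    using assms unfolding unitary_op_def by blast
  define w where "w i j = (\<Sum>k\<in>A. u i k * v k j)" for i j
  have "F (G \<psi>) i = lin_op A w \<psi> i" for \<psi> i
  proof -
    have "(\<Sum>j\<in>A. u i j * (\<Sum>k\<in>A. v j k * \<psi> k)) = (\<Sum>k\<in>A. w i k * \<psi> k)"
      unfolding w_def by (simp add: sum_distrib_left sum_distrib_right mult.assoc) (rule sum.swap)
    then show ?thesis by (simp add: u v lin_op_def)
  qed
  then have "(\<lambda>\<psi>. F (G \<psi>)) = lin_op A w" by (intro ext) simp
  moreover have "isometric A w"
    unfolding isometric_def
  proof (intro ballI)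
    fix j k assume jk: "j \<in> A" "k \<in> A"
    have "(\<Sum>i\<in>A. cnj (w i j) * w i k)
        = (\<Sum>i\<in>A. \<Sum>a\<in>A. \<Sum>b\<in>A. (cnj (v a j) * v b k) * (cnj (u i a) * u i b))"
      unfolding w_def cnj_sum sum_product by (simp add: algebra_simps)
    also have "\<dots> = (\<Sum>a\<in>A. \<Sum>b\<in>A. \<Sum>i\<in>A. (cnj (v a j) * v b k) * (cnj (u i a) * u i b))"
      by (subst sum.swap, rule sum.cong[OF refl], rule sum.swap)
    also have "\<dots> = (\<Sum>a\<in>A. \<Sum>b\<in>A. (cnj (v a j) * v b k) * of_bool (a = b))"
      using u(1) unfolding isometric_def by (simp flip: sum_distrib_left)
    also have "\<dots> = (\<Sum>a\<in>A. cnj (v a j) * v a k)"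
      using assms(3) by (simp add: of_bool_def if_distrib sum.delta' cong: if_cong)
    also have "\<dots> = of_bool (j = k)" using v(1) jk unfolding isometric_def by blast
    finally show "(\<Sum>i\<in>A. cnj (w i j) * w i k) = of_bool (j = k)" .
  qed
  ultimately show ?thesis unfolding unitary_op_def by blast
qed

lemma unitary_op_norm:
  assumes "unitary_op A F" "finite A"
  shows "(\<Sum>i\<in>A. (cmod (F \<psi> i))\<^sup>2) = (\<Sum>i\<in>A. (cmod (\<psi> i))\<^sup>2)"
proof -
  obtain u where u: "isometric A u" "F = lin_op A u" using assms unfolding unitary_op_def by blast
  have "complex_of_real (\<Sum>i\<in>A. (cmod (F \<psi> i))\<^sup>2) = (\<Sum>i\<in>A. cnj (F \<psi> i) * F \<psi> i)"
    by (simp add: complex_norm_square mult.commute del: of_real_power)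
  also have "\<dots> = (\<Sum>i\<in>A. \<Sum>a\<in>A. \<Sum>b\<in>A. (cnj (\<psi> a) * \<psi> b) * (cnj (u i a) * u i b))"
  proof (rule sum.cong[OF refl])
    fix i assume "i \<in> A"
    then have "F \<psi> i = (\<Sum>b\<in>A. u i b * \<psi> b)" by (simp add: u lin_op_def)
    then show "cnj (F \<psi> i) * F \<psi> i = (\<Sum>a\<in>A. \<Sum>b\<in>A. (cnj (\<psi> a) * \<psi> b) * (cnj (u i a) * u i b))"
      by (simp only: cnj_sum sum_product) (simp add: algebra_simps)
  qed
  also have "\<dots> = (\<Sum>a\<in>A. \<Sum>b\<in>A. \<Sum>i\<in>A. (cnj (\<psi> a) * \<psi> b) * (cnj (u i a) * u i b))"
    by (subst sum.swap, rule sum.cong[OF refl], rule sum.swap)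
  also have "\<dots> = (\<Sum>a\<in>A. \<Sum>b\<in>A. (cnj (\<psi> a) * \<psi> b) * of_bool (a = b))"
    using u(1) unfolding isometric_def by (simp flip: sum_distrib_left)
  also have "\<dots> = (\<Sum>a\<in>A. cnj (\<psi> a) * \<psi> a)"
    using assms(2) by (simp add: of_bool_def if_distrib sum.delta' cong: if_cong)
  also have "\<dots> = complex_of_real (\<Sum>i\<in>A. (cmod (\<psi> i))\<^sup>2)"
    by (simp add: complex_norm_square mult.commute del: of_real_power)
  finally show ?thesis using of_real_eq_iff by blast
qed

lemma unitary_op_mono:
  assumes "unitary_op A F" "A \<subseteq> B" "finite B"
  shows "unitary_op B F"
proof -
  obtain u where u: "isometric A u" "F = lin_op A u" using assms unfolding unitary_op_def by blast
  define w where "w i j = (if i \<in> A \<and> j \<in> A then u i j else of_bool (i = j))" for i j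
  have inA: "(\<Sum>i\<in>B. h i) = (\<Sum>i\<in>A. h i)" if "\<And>i. i \<in> B - A \<Longrightarrow> h i = 0" for h :: "_ \<Rightarrow> complex"
    using assms(2,3) that by (intro sum.mono_neutral_right) auto
  have "F \<psi> i = lin_op B w \<psi> i" for \<psi> i
  proof (cases "i \<in> A")
    case True
    then have "(\<Sum>j\<in>B. w i j * \<psi> j) = (\<Sum>j\<in>A. u i j * \<psi> j)"
      by (subst inA) (auto simp: w_def intro!: sum.cong)
    then show ?thesis using True assms(2) u(2) by (auto simp: lin_op_def)
  next
    case False
    then have "(\<Sum>j\<in>B. w i j * \<psi> j) = (\<Sum>j\<in>B. if i = j then \<psi> j else 0)"
      by (intro sum.cong) (auto simp: w_def)
    then show ?thesis using False assms(3) u(2) by (auto simp: lin_op_def)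
  qed
  then have "F = lin_op B w" by (intro ext) simp
  moreover have "isometric B w"
    unfolding isometric_def
  proof (intro ballI)
    fix j k assume jk: "j \<in> B" "k \<in> B"
    show "(\<Sum>i\<in>B. cnj (w i j) * w i k) = of_bool (j = k)"
    proof (cases "j \<in> A \<and> k \<in> A")
      case True
      then have "(\<Sum>i\<in>B. cnj (w i j) * w i k) = (\<Sum>i\<in>A. cnj (u i j) * u i k)"
        by (subst inA) (auto simp: w_def intro!: sum.cong)
      then show ?thesis using True u(1) unfolding isometric_def by simp
    next
      case False
      have "cnj (w i j) * w i k = (if i = j then of_bool (j = k) else 0)" for i
        using False by (cases "i \<in> A"; cases "j \<in> A"; cases "k \<in> A") (auto simp: w_def)
      then show ?thesis using jk assms(3) by simp
    qed
  qed
  ultimately show ?thesis unfolding unitary_op_def by blast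
qed

lemma cnj_of_bool [simp]: "cnj (of_bool P) = of_bool P"
  by (cases P) simp_all

lemma unitary_op_perm:
  assumes "bij_betw \<sigma> A A" "finite A"
  shows "unitary_op A (\<lambda>\<psi> i. if i \<in> A then \<psi> (\<sigma> i) else \<psi> i)"
proof -
  let ?u = "\<lambda>i j. of_bool (j = \<sigma> i) :: complex"
  have mem: "\<sigma> i \<in> A" if "i \<in> A" for i using assms(1) that by (auto simp: bij_betw_def)
  have "isometric A ?u"
    unfolding isometric_def
  proof (intro ballI)
    fix j k assume "j \<in> A" "k \<in> A"
    have "(\<Sum>i\<in>A. cnj (?u i j) * ?u i k) = (\<Sum>i\<in>A. of_bool (j = i) * of_bool (k = i))"
      using sum.reindex_bij_betw[OF assms(1), of "\<lambda>i. of_bool (j = i) * of_bool (k = i) :: complex"]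
      by simp
    also have "\<dots> = (\<Sum>i\<in>A. if i = j then of_bool (j = k) else 0)" by (intro sum.cong) auto
    finally show "(\<Sum>i\<in>A. cnj (?u i j) * ?u i k) = of_bool (j = k)"
      using \<open>j \<in> A\<close> assms(2) by simp
  qed
  moreover have "(\<lambda>\<psi> i. if i \<in> A then \<psi> (\<sigma> i) else \<psi> i) = lin_op A ?u"
  proof (intro ext)
    fix \<psi> :: "_ \<Rightarrow> complex" and i
    have "(\<Sum>j\<in>A. ?u i j * \<psi> j) = (\<Sum>j\<in>A. if j = \<sigma> i then \<psi> j else 0)"
      by (intro sum.cong) auto
    then show "(if i \<in> A then \<psi> (\<sigma> i) else \<psi> i) = lin_op A ?u \<psi> i"
      using mem assms(2) by (auto simp: lin_op_def)
  qed
  ultimately show ?thesis unfolding unitary_op_def by blast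
qed

lemma unitary_op_diag:
  assumes "\<And>i. i \<in> A \<Longrightarrow> cmod (g i) = 1" "finite A"
  shows "unitary_op A (\<lambda>\<psi> i. if i \<in> A then g i * \<psi> i else \<psi> i)"
proof -
  let ?u = "\<lambda>i j. if i = j then g i else 0"
  have "isometric A ?u"
    unfolding isometric_def
  proof (intro ballI)
    fix j k assume "j \<in> A" "k \<in> A"
    have "(\<Sum>i\<in>A. cnj (?u i j) * ?u i k) = (\<Sum>i\<in>A. if i = j then (if j = k then cnj (g j) * g j else 0) else 0)"
      by (intro sum.cong) auto
    also have "cnj (g j) * g j = 1"
      using assms(1)[OF \<open>j \<in> A\<close>] complex_norm_square[of "g j"] by (simp add: mult.commute)
    finally show "(\<Sum>i\<in>A. cnj (?u i j) * ?u i k) = of_bool (j = k)"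
      using \<open>j \<in> A\<close> assms(2) by simp
  qed
  moreover have "(\<lambda>\<psi> i. if i \<in> A then g i * \<psi> i else \<psi> i) = lin_op A ?u"
  proof (intro ext)
    fix \<psi> :: "_ \<Rightarrow> complex" and i
    have "(\<Sum>j\<in>A. ?u i j * \<psi> j) = (\<Sum>j\<in>A. if i = j then g j * \<psi> j else 0)"
      by (intro sum.cong) auto
    then show "(if i \<in> A then g i * \<psi> i else \<psi> i) = lin_op A ?u \<psi> i"
      using assms(2) by (auto simp: lin_op_def)
  qed
  ultimately show ?thesis unfolding unitary_op_def by blast
qed

lemma unitary_op_id: "finite A \<Longrightarrow> unitary_op A (\<lambda>\<psi>. \<psi>)"
  using unitary_op_diag[of A "\<lambda>_. 1"] by (simp cong: if_cong)

text \<open>The matrix is \<open>I - 2 s s^T\<close>. It prepares initial states as a Householder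
  reflection and serves as Grover's diffusion step up to sign.\<close>

lemma unitary_op_reflection:
  fixes s :: "'l \<Rightarrow> real"
  assumes "(\<Sum>i\<in>A. (s i)\<^sup>2) = 1" "finite A"
  shows "unitary_op A (\<lambda>\<psi> i. if i \<in> A then \<psi> i - 2 * complex_of_real (s i) * (\<Sum>j\<in>A. complex_of_real (s j) * \<psi> j) else \<psi> i)"
proof -
  let ?u = "\<lambda>i j. of_bool (i = j) - 2 * complex_of_real (s i) * s j"
  have norm: "(\<Sum>i\<in>A. complex_of_real (s i) * s i) = 1"
    using arg_cong[OF assms(1), of complex_of_real] by (simp add: power2_eq_square)
  have "isometric A ?u"
    unfolding isometric_def
  proof (intro ballI)
    fix j k assume jk: "j \<in> A" "k \<in> A"
    have "(\<Sum>i\<in>A. cnj (?u i j) * ?u i k)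
       = (\<Sum>i\<in>A. of_bool (i = j) * of_bool (j = k) - of_bool (i = j) * (2 * complex_of_real (s j) * s k)
          - of_bool (i = k) * (2 * complex_of_real (s j) * s k)
          + (4 * complex_of_real (s j) * s k) * (complex_of_real (s i) * s i))"
      by (intro sum.cong) (auto simp: algebra_simps)
    also have "\<dots> = of_bool (j = k)"
      using jk assms(2) norm
      by (simp add: sum.distrib sum_subtractf flip: sum_distrib_left sum_distrib_right)
    finally show "(\<Sum>i\<in>A. cnj (?u i j) * ?u i k) = of_bool (j = k)" .
  qed
  moreover have "(\<lambda>\<psi> i. if i \<in> A then \<psi> i - 2 * complex_of_real (s i) * (\<Sum>j\<in>A. complex_of_real (s j) * \<psi> j) else \<psi> i) = lin_op A ?u"
  proof (intro ext)
    fix \<psi> :: "_ \<Rightarrow> complex" and i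
    have "(\<Sum>j\<in>A. ?u i j * \<psi> j) = (\<Sum>j\<in>A. (if i = j then \<psi> j else 0) - 2 * complex_of_real (s i) * (complex_of_real (s j) * \<psi> j))"
      by (intro sum.cong) (auto simp: algebra_simps)
    then show "(if i \<in> A then \<psi> i - 2 * complex_of_real (s i) * (\<Sum>j\<in>A. complex_of_real (s j) * \<psi> j) else \<psi> i) = lin_op A ?u \<psi> i"
      using assms(2) by (auto simp: lin_op_def sum_subtractf simp flip: sum_distrib_left)
  qed
  ultimately show ?thesis unfolding unitary_op_def by blast
qed

text \<open>Gates on the first component \<open>b\<close> of a label \<open>e b c\<close>, controlled by the second one.\<close>

lemma unitary_op_controlled:
  assumes F: "\<And>c. c \<in> C \<Longrightarrow> unitary_op B (F c)" and fin: "finite B" "finite C"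
    and inj: "inj_on (\<lambda>(b, c). e b c) (B \<times> C)"
  obtains G where "unitary_op ((\<lambda>(b, c). e b c) ` (B \<times> C)) G"
    and "\<And>\<psi> b c. b \<in> B \<Longrightarrow> c \<in> C \<Longrightarrow> G \<psi> (e b c) = F c (\<lambda>b'. \<psi> (e b' c)) b"
proof -
  have "\<exists>u. \<forall>c\<in>C. isometric B (u c) \<and> F c = lin_op B (u c)"
    using F unfolding unitary_op_def by (intro bchoice) auto
  then obtain u where u: "\<And>c. c \<in> C \<Longrightarrow> isometric B (u c)" "\<And>c. c \<in> C \<Longrightarrow> F c = lin_op B (u c)" by blast
  define A where "A = (\<lambda>(b, c). e b c) ` (B \<times> C)"
  define d where "d = the_inv_into (B \<times> C) (\<lambda>(b, c). e b c)"
  have d: "d (e b c) = (b, c)" if "b \<in> B" "c \<in> C" for b c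
    using the_inv_into_f_f[OF inj, of "(b, c)"] that by (simp add: d_def)
  define w where "w i j = (if snd (d i) = snd (d j) then u (snd (d i)) (fst (d i)) (fst (d j)) else 0)" for i j
  have sumA: "(\<Sum>i\<in>A. h i) = (\<Sum>b\<in>B. \<Sum>c\<in>C. h (e b c))" for h :: "_ \<Rightarrow> complex"
    unfolding A_def by (subst sum.reindex[OF inj]) (simp add: sum.cartesian_product case_prod_unfold)
  have "isometric A w"
    unfolding isometric_def
  proof (intro ballI)
    fix j k assume "j \<in> A" "k \<in> A"
    then obtain b c b' c' where bc: "j = e b c" "k = e b' c'" "b \<in> B" "b' \<in> B" "c \<in> C" "c' \<in> C"
      unfolding A_def by auto
    have "(\<Sum>i\<in>A. cnj (w i j) * w i k)
        = (\<Sum>a\<in>B. \<Sum>x\<in>C. if x = c then (if c = c' then cnj (u c a b) * u c a b' else 0) else 0)"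
      unfolding sumA using bc by (intro sum.cong refl) (auto simp: w_def d)
    also have "\<dots> = (if c = c' then \<Sum>a\<in>B. cnj (u c a b) * u c a b' else 0)"
      using fin bc by simp
    also have "\<dots> = of_bool (c = c' \<and> b = b')" using u(1)[OF bc(5)] bc(3,4) unfolding isometric_def by (cases "c = c'") simp_all
    also have "\<dots> = of_bool (j = k)" using inj_onD[OF inj, of "(b, c)" "(b', c')"] bc by auto
    finally show "(\<Sum>i\<in>A. cnj (w i j) * w i k) = of_bool (j = k)" .
  qed
  moreover have "lin_op A w \<psi> (e b c) = F c (\<lambda>b'. \<psi> (e b' c)) b" if "b \<in> B" "c \<in> C" for \<psi> b c
  proof -
    have "(\<Sum>j\<in>A. w (e b c) j * \<psi> j) = (\<Sum>b'\<in>B. \<Sum>x\<in>C. if x = c then u c b b' * \<psi> (e b' c) else 0)"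
      unfolding sumA using that by (intro sum.cong refl) (auto simp: w_def d)
    moreover have "e b c \<in> A" using that by (auto simp: A_def)
    ultimately show ?thesis using that fin u(2)[of c] by (simp add: lin_op_def)
  qed
  ultimately show thesis using that[of "lin_op A w"] unfolding unitary_op_def A_def by blast
qed

text \<open>The set queried at time \<open>t\<close> is \<open>\<pi> t l\<close>, a function of the
  basis label \<open>l\<close>, and \<open>g t l\<close> turns the answer into a phase. Query and
  answer registers appear only in the final simulation.\<close>

primrec phase_state :: "(nat \<Rightarrow> (nat \<Rightarrow> complex) \<Rightarrow> nat \<Rightarrow> complex) \<Rightarrow> (nat \<Rightarrow> nat \<Rightarrow> nat set) \<Rightarrow>
    (nat \<Rightarrow> nat \<Rightarrow> nat \<Rightarrow> complex) \<Rightarrow> (nat set \<Rightarrow> nat) \<Rightarrow> nat \<Rightarrow> nat \<Rightarrow> complex" where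
  "phase_state F \<pi> g f 0 = F 0 (\<lambda>l. of_bool (l = 0))"
| "phase_state F \<pi> g f (Suc t) = F (Suc t) (\<lambda>l. g t l (f (\<pi> t l)) * phase_state F \<pi> g f t l)"

lemma phase_state_cong:
  "(\<And>s. s \<le> t \<Longrightarrow> F s = F' s) \<Longrightarrow> (\<And>s. s < t \<Longrightarrow> \<pi> s = \<pi>' s) \<Longrightarrow> (\<And>s. s < t \<Longrightarrow> g s = g' s) \<Longrightarrow>
   phase_state F \<pi> g f t = phase_state F' \<pi>' g' f t"
  by (induction t) auto

text \<open>A phase query multiplies the amplitude of the label \<open>l\<close> by a number of modulus 1 that depends
  on the answer to the query \<open>\<pi> l\<close>; it is worth two queries to the standard oracle.\<close>

definition phase_reachable ::
  "nat \<Rightarrow> nat set \<Rightarrow> nat \<Rightarrow> ((nat set \<Rightarrow> nat) \<Rightarrow> nat \<Rightarrow> complex) \<Rightarrow> bool" where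
  "phase_reachable n A t \<Psi> \<longleftrightarrow> finite A \<and> 0 \<in> A \<and>
     (\<exists>F \<pi> g. (\<forall>s. unitary_op A (F s)) \<and> (\<forall>s l. \<pi> s l \<subseteq> {..<n}) \<and> (\<forall>s l b. cmod (g s l b) = 1)
       \<and> (\<forall>f. \<Psi> f = phase_state F \<pi> g f t))"

lemma phase_reachable_init: "finite A \<Longrightarrow> 0 \<in> A \<Longrightarrow> phase_reachable n A 0 (\<lambda>f l. of_bool (l = 0))"
  unfolding phase_reachable_def
  by (intro conjI exI[of _ "\<lambda>_ \<psi>. \<psi>"] exI[of _ "\<lambda>_ _. {}"] exI[of _ "\<lambda>_ _ _. 1"])
     (auto simp: unitary_op_id)

lemma phase_reachable_gate:
  assumes "phase_reachable n A t \<Psi>" "unitary_op A G"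
  shows "phase_reachable n A t (\<lambda>f. G (\<Psi> f))"
proof -
  obtain F \<pi> g where *: "finite A" "0 \<in> A" "\<And>s. unitary_op A (F s)" "\<And>s l. \<pi> s l \<subseteq> {..<n}"
    "\<And>s l b. cmod (g s l b) = 1" "\<And>f. \<Psi> f = phase_state F \<pi> g f t"
    using assms(1) unfolding phase_reachable_def by blast
  define F' where "F' = F(t := \<lambda>\<psi>. G (F t \<psi>))"
  have "G (phase_state F \<pi> g f t) = phase_state F' \<pi> g f t" for f
  proof (cases t)
    case (Suc s)
    have "phase_state F' \<pi> g f s = phase_state F \<pi> g f s"
      by (rule phase_state_cong) (auto simp: F'_def Suc)
    then show ?thesis by (simp add: Suc F'_def)
  qed (simp add: F'_def)
  moreover have "unitary_op A (F' s)" for s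
    using * assms(2) by (auto simp: F'_def intro: unitary_op_comp)
  ultimately show ?thesis using * unfolding phase_reachable_def by metis
qed

lemma phase_reachable_query:
  assumes "phase_reachable n A t \<Psi>" "\<And>l. p l \<subseteq> {..<n}" "\<And>l b. cmod (h l b) = 1"
  shows "phase_reachable n A (Suc t) (\<lambda>f l. h l (f (p l)) * \<Psi> f l)"
proof -
  obtain F \<pi> g where *: "finite A" "0 \<in> A" "\<And>s. unitary_op A (F s)" "\<And>s l. \<pi> s l \<subseteq> {..<n}"
    "\<And>s l b. cmod (g s l b) = 1" "\<And>f. \<Psi> f = phase_state F \<pi> g f t"
    using assms(1) unfolding phase_reachable_def by blast
  define F' where "F' = F(Suc t := \<lambda>\<psi>. \<psi>)"
  define \<pi>' where "\<pi>' = \<pi>(t := p)"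
  define g' where "g' = g(t := h)"
  have "phase_state F' \<pi>' g' f t = phase_state F \<pi> g f t" for f
    by (rule phase_state_cong) (auto simp: F'_def \<pi>'_def g'_def)
  then have "(\<lambda>l. h l (f (p l)) * \<Psi> f l) = phase_state F' \<pi>' g' f (Suc t)" for f
    by (simp add: * F'_def \<pi>'_def g'_def)
  moreover have "unitary_op A (F' s)" for s using * by (auto simp: F'_def unitary_op_id)
  moreover have "\<pi>' s l \<subseteq> {..<n}" "cmod (g' s l b) = 1" for s l b
    using assms(2)[of l] assms(3) * by (auto simp: \<pi>'_def g'_def)
  ultimately show ?thesis
    unfolding phase_reachable_def using *(1,2)
    by (intro conjI exI[of _ F'] exI[of _ \<pi>'] exI[of _ g']) auto
qed

lemma phase_reachable_mono:
  "phase_reachable n A t \<Psi> \<Longrightarrow> A \<subseteq> B \<Longrightarrow> finite B \<Longrightarrow> phase_reachable n B t \<Psi>"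
  unfolding phase_reachable_def by (metis unitary_op_mono subsetD)

lemma phase_state_outside:
  assumes "\<And>s. unitary_op A (F s)" "0 \<in> A" "l \<notin> A"
  shows "phase_state F \<pi> g f t l = 0"
proof -
  have "l \<noteq> 0" using assms by metis
  then show ?thesis by (induction t) (auto simp: unitary_op_outside[OF assms(1,3)])
qed

lemma phase_reachable_outside: "phase_reachable n A t \<Psi> \<Longrightarrow> l \<notin> A \<Longrightarrow> \<Psi> f l = 0"
  unfolding phase_reachable_def by (metis phase_state_outside)

lemma phase_reachable_norm:
  assumes "phase_reachable n A t \<Psi>"
  shows "(\<Sum>l\<in>A. (cmod (\<Psi> f l))\<^sup>2) = 1"
proof -
  obtain F \<pi> g where *: "finite A" "0 \<in> A" "\<And>s. unitary_op A (F s)" 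
    "\<And>s l b. cmod (g s l b) = 1" "\<And>f. \<Psi> f = phase_state F \<pi> g f t"
    using assms(1) unfolding phase_reachable_def by blast
  have "(\<Sum>l\<in>A. (cmod (phase_state F \<pi> g f t l))\<^sup>2) = 1"
  proof (induction t)
    case 0
    have "(\<Sum>l\<in>A. (cmod (of_bool (l = 0)))\<^sup>2) = (\<Sum>l\<in>A. if l = 0 then 1 else 0 :: real)"
      by (intro sum.cong) auto
    then show ?case using * by (simp add: unitary_op_norm)
  next
    case (Suc t)
    then show ?case using * by (simp add: unitary_op_norm norm_mult)
  qed
  then show ?thesis using * by simp
qed

text \<open>An idle register with labels \<open>B\<close> is adjoined in state 0. The pair code
  sends \<open>(0, 0)\<close> to 0, so the joint computation starts at the prescribed label.\<close>

lemma phase_reachable_lift: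
  assumes "phase_reachable n A t \<Psi>" "finite B" "0 \<in> B"
  shows "phase_reachable n (prod_encode ` (A \<times> B)) t
    (\<lambda>f l. \<Psi> f (fst (prod_decode l)) * of_bool (snd (prod_decode l) = 0))"
proof -
  obtain F \<pi> g where *: "finite A" "0 \<in> A" "\<And>s. unitary_op A (F s)" "\<And>s l. \<pi> s l \<subseteq> {..<n}"
    "\<And>s l b. cmod (g s l b) = 1" "\<And>f. \<Psi> f = phase_state F \<pi> g f t"
    using assms(1) unfolding phase_reachable_def by blast
  let ?A = "prod_encode ` (A \<times> B)"
  let ?S = "\<lambda>t f l. phase_state F \<pi> g f t (fst (prod_decode l)) * of_bool (snd (prod_decode l) = 0)"
  have inj: "inj_on (\<lambda>(b, c). prod_encode (b, c)) (A \<times> B)"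
    using inj_prod_encode[of "A \<times> B"] by simp
  have gate: "\<exists>G. unitary_op ?A G \<and> (\<forall>\<psi>. (\<forall>l. l \<notin> A \<longrightarrow> \<psi> l = 0) \<longrightarrow>
      G (\<lambda>l. \<psi> (fst (prod_decode l)) * of_bool (snd (prod_decode l) = 0))
      = (\<lambda>l. F s \<psi> (fst (prod_decode l)) * of_bool (snd (prod_decode l) = 0)))" for s
  proof -
    obtain G where G: "unitary_op ?A G"
      "\<And>\<psi> b c. b \<in> A \<Longrightarrow> c \<in> B \<Longrightarrow> G \<psi> (prod_encode (b, c)) = F s (\<lambda>b'. \<psi> (prod_encode (b', c))) b"
      using unitary_op_controlled[OF *(3)[of s] *(1) assms(2) inj] by (auto simp: case_prod_eta)
    show ?thesis
    proof (intro exI[of _ G] conjI allI impI ext)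
      fix \<psi> l assume \<psi>: "\<forall>l. l \<notin> A \<longrightarrow> \<psi> l = (0 :: complex)"
      obtain b c where l: "l = prod_encode (b, c)" by (metis prod_decode_inverse surj_pair)
      show "G (\<lambda>l. \<psi> (fst (prod_decode l)) * of_bool (snd (prod_decode l) = 0)) l
        = F s \<psi> (fst (prod_decode l)) * of_bool (snd (prod_decode l) = 0)"
      proof (cases "b \<in> A \<and> c \<in> B")
        case True
        then show ?thesis
          using unitary_op_scale[OF *(3)[of s], of "of_bool (c = 0)" \<psi>]
          by (simp add: l G(2) mult.commute)
      next
        case False
        then have nin: "l \<notin> ?A" using l by (auto simp: inj_image_mem_iff[OF inj_prod_encode])
        have "F s \<psi> b * of_bool (c = 0) = \<psi> b * of_bool (c = 0)"
        proof (cases "b \<in> A")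
          case True
          then have "c \<noteq> 0" using False assms(3) by metis
          then show ?thesis by simp
        qed (simp add: unitary_op_outside[OF *(3)[of s]])
        then show ?thesis unfolding unitary_op_outside[OF G(1) nin]
          by (simp only: l prod_encode_inverse fst_conv snd_conv)
      qed
    qed (use G in auto)
  qed
  have "0 \<in> ?A" using *(2) assms(3)
    by (auto intro!: image_eqI[of _ _ "(0, 0)"] simp: prod_encode_def)
  then have fin: "finite ?A" "0 \<in> ?A" using *(1) assms(2) by auto
  have init: "(\<lambda>l. of_bool (l = 0)) = (\<lambda>l. of_bool (fst (prod_decode l) = 0) * of_bool (snd (prod_decode l) = 0) :: complex)"
  proof (rule ext)
    fix l show "of_bool (l = 0) = (of_bool (fst (prod_decode l) = 0) * of_bool (snd (prod_decode l) = 0) :: complex)"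
    proof (cases "prod_decode l")
      case (Pair b c)
      then have l: "l = prod_encode (b, c)" by (metis prod_decode_inverse)
      have "prod_encode (0, 0) = 0" by (simp add: prod_encode_def)
      then have "l = 0 \<longleftrightarrow> b = 0 \<and> c = 0" unfolding l by (metis prod.inject prod_encode_eq)
      then show ?thesis by (simp add: Pair)
    qed
  qed
  have "phase_reachable n ?A t (?S t)"
  proof (induction t)
    case 0
    obtain G where G: "unitary_op ?A G" "\<And>\<psi>. (\<forall>l. l \<notin> A \<longrightarrow> \<psi> l = 0) \<Longrightarrow>
      G (\<lambda>l. \<psi> (fst (prod_decode l)) * of_bool (snd (prod_decode l) = 0))
      = (\<lambda>l. F 0 \<psi> (fst (prod_decode l)) * of_bool (snd (prod_decode l) = 0))" using gate by blast
    have "G (\<lambda>l. of_bool (l = 0)) = ?S 0 f" for f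
    proof -
      have "\<forall>l. l \<notin> A \<longrightarrow> of_bool (l = 0) = (0 :: complex)" using *(2) by (auto simp: of_bool_def)
      from G(2)[OF this] show ?thesis by (subst init) simp
    qed
    then show ?case using phase_reachable_gate[OF phase_reachable_init[OF fin, of n] G(1)] by simp
  next
    case (Suc t)
    obtain G where G: "unitary_op ?A G" "\<And>\<psi>. (\<forall>l. l \<notin> A \<longrightarrow> \<psi> l = 0) \<Longrightarrow>
      G (\<lambda>l. \<psi> (fst (prod_decode l)) * of_bool (snd (prod_decode l) = 0))
      = (\<lambda>l. F (Suc t) \<psi> (fst (prod_decode l)) * of_bool (snd (prod_decode l) = 0))" using gate by blast
    have "G (\<lambda>l. g t (fst (prod_decode l)) (f (\<pi> t (fst (prod_decode l)))) * ?S t f l) = ?S (Suc t) f" for f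
      using G(2)[of "\<lambda>l. g t l (f (\<pi> t l)) * phase_state F \<pi> g f t l"] phase_state_outside[OF *(3,2)]
      by (simp add: mult.assoc)
    then show ?case
      using phase_reachable_gate[OF phase_reachable_query[OF Suc, of "\<lambda>l. \<pi> t (fst (prod_decode l))"
            "\<lambda>l. g t (fst (prod_decode l))"] G(1)] *(4,5)
      by simp
  qed
  then show ?thesis by (simp add: *(6))
qed

text \<open>Deferred measurement: no gate of the second computation changes the first component,
  which thus records the outcome. Gates, queries and phases of the second computation are all
  controlled by that record.\<close>

lemma phase_reachable_sequence:
  fixes out :: "nat \<Rightarrow> 'a"
  assumes 1: "phase_reachable n A t \<Psi>" and 2: "\<And>a. phase_reachable n B t' (\<Phi> a)"
  shows "phase_reachable n (prod_encode ` (A \<times> B)) (t + t')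
    (\<lambda>f l. \<Psi> f (fst (prod_decode l)) * \<Phi> (out (fst (prod_decode l))) f (snd (prod_decode l)))"
proof -
  have "\<exists>F \<pi> g. (\<forall>s. unitary_op B (F s)) \<and> (\<forall>s l. \<pi> s l \<subseteq> {..<n}) \<and> (\<forall>s l b. cmod (g s l b) = 1)
       \<and> (\<forall>f. \<Phi> a f = phase_state F \<pi> g f t')" for a
    using 2[of a] unfolding phase_reachable_def by blast
  then obtain F \<pi> g where *: "\<And>a s. unitary_op B (F a s)" "\<And>a s l. \<pi> a s l \<subseteq> {..<n}"
     "\<And>a s l b. cmod (g a s l b) = 1" "\<And>a f. \<Phi> a f = phase_state (F a) (\<pi> a) (g a) f t'"
    by metis
  have fin: "finite A" "finite B" "0 \<in> B" using 1 2 unfolding phase_reachable_def by auto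
  let ?A = "prod_encode ` (A \<times> B)"
  let ?S = "\<lambda>s f l. \<Psi> f (fst (prod_decode l)) *
     phase_state (F (out (fst (prod_decode l)))) (\<pi> (out (fst (prod_decode l)))) (g (out (fst (prod_decode l)))) f s (snd (prod_decode l))"
  \<comment> \<open>The controlled gate acts on the first argument of \<open>e\<close>, while here
    the second component of the pair is the target, hence the swapped coding.\<close>
  have eq: "(\<lambda>(b, c). prod_encode (c, b)) ` (B \<times> A) = ?A" by force
  have inj: "inj_on (\<lambda>(b, c). prod_encode (c, b)) (B \<times> A)"
    by (auto simp: inj_on_def)
  have gate: "\<exists>G. unitary_op ?A G \<and> (\<forall>\<psi> (\<phi> :: 'a \<Rightarrow> nat \<Rightarrow> complex). (\<forall>l. l \<notin> A \<longrightarrow> \<psi> l = 0) \<longrightarrow> (\<forall>a l. l \<notin> B \<longrightarrow> \<phi> a l = 0) \<longrightarrow>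
      G (\<lambda>l. \<psi> (fst (prod_decode l)) * \<phi> (out (fst (prod_decode l))) (snd (prod_decode l)))
      = (\<lambda>l. \<psi> (fst (prod_decode l)) * F (out (fst (prod_decode l))) s (\<phi> (out (fst (prod_decode l)))) (snd (prod_decode l))))" for s
  proof -
    obtain G where G: "unitary_op ?A G"
      "\<And>\<psi> b c. b \<in> B \<Longrightarrow> c \<in> A \<Longrightarrow> G \<psi> (prod_encode (c, b)) = F (out c) s (\<lambda>b'. \<psi> (prod_encode (c, b'))) b"
      using unitary_op_controlled[where F = "\<lambda>c. F (out c) s" and e = "\<lambda>b c. prod_encode (c, b)",
          OF *(1) fin(2,1) inj] unfolding eq by blast
    show ?thesis
    proof (intro exI[of _ G] conjI allI impI ext)
      fix \<psi> l and \<phi> :: "'a \<Rightarrow> nat \<Rightarrow> complex" assume \<psi>: "\<forall>l. l \<notin> A \<longrightarrow> \<psi> l = (0 :: complex)" "\<forall>a l. l \<notin> B \<longrightarrow> \<phi> a l = (0 :: complex)"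
      obtain c b where l: "l = prod_encode (c, b)" by (metis prod_decode_inverse surj_pair)
      show "G (\<lambda>l. \<psi> (fst (prod_decode l)) * \<phi> (out (fst (prod_decode l))) (snd (prod_decode l))) l
        = \<psi> (fst (prod_decode l)) * F (out (fst (prod_decode l))) s (\<phi> (out (fst (prod_decode l)))) (snd (prod_decode l))"
      proof (cases "b \<in> B \<and> c \<in> A")
        case True
        then show ?thesis
          using unitary_op_scale[OF *(1)[of "out c" s], of "\<psi> c" "\<phi> (out c)"]
          by (simp add: l G(2))
      next
        case False
        then have nin: "l \<notin> ?A" using l by (auto simp: inj_image_mem_iff[OF inj_prod_encode])
        have "\<psi> c * F (out c) s (\<phi> (out c)) b = \<psi> c * \<phi> (out c) b"
          using False \<psi> unitary_op_outside[OF *(1)[of "out c" s], of b "\<phi> (out c)"] by auto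
        then show ?thesis unfolding unitary_op_outside[OF G(1) nin]
          by (simp only: l prod_encode_inverse fst_conv snd_conv)
      qed
    qed (use G in auto)
  qed
  have \<Psi>0: "\<forall>l. l \<notin> A \<longrightarrow> \<Psi> f l = 0" for f using phase_reachable_outside[OF 1] by blast
  have "phase_reachable n ?A (t + s) (?S s)" for s
  proof (induction s)
    case 0
    obtain G where G: "unitary_op ?A G" "\<And>\<psi> (\<phi> :: 'a \<Rightarrow> nat \<Rightarrow> complex). (\<forall>l. l \<notin> A \<longrightarrow> \<psi> l = 0) \<Longrightarrow> (\<forall>a l. l \<notin> B \<longrightarrow> \<phi> a l = 0) \<Longrightarrow>
      G (\<lambda>l. \<psi> (fst (prod_decode l)) * \<phi> (out (fst (prod_decode l))) (snd (prod_decode l)))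
      = (\<lambda>l. \<psi> (fst (prod_decode l)) * F (out (fst (prod_decode l))) 0 (\<phi> (out (fst (prod_decode l)))) (snd (prod_decode l)))"
      using gate[of 0] by blast
    have "G (\<lambda>l. \<Psi> f (fst (prod_decode l)) * of_bool (snd (prod_decode l) = 0)) = ?S 0 f" for f
    proof -
      have "\<forall>(a :: 'a) l. l \<notin> B \<longrightarrow> of_bool (l = 0) = (0 :: complex)" using fin(3) by (auto simp: of_bool_def)
      from G(2)[OF \<Psi>0 this] show ?thesis by simp
    qed
    then show ?case using phase_reachable_gate[OF phase_reachable_lift[OF 1 fin(2,3)] G(1)] by simp
  next
    case (Suc s)
    obtain G where G: "unitary_op ?A G" "\<And>\<psi> (\<phi> :: 'a \<Rightarrow> nat \<Rightarrow> complex). (\<forall>l. l \<notin> A \<longrightarrow> \<psi> l = 0) \<Longrightarrow> (\<forall>a l. l \<notin> B \<longrightarrow> \<phi> a l = 0) \<Longrightarrow>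
      G (\<lambda>l. \<psi> (fst (prod_decode l)) * \<phi> (out (fst (prod_decode l))) (snd (prod_decode l)))
      = (\<lambda>l. \<psi> (fst (prod_decode l)) * F (out (fst (prod_decode l))) (Suc s) (\<phi> (out (fst (prod_decode l)))) (snd (prod_decode l)))"
      using gate[of "Suc s"] by blast
    let ?p = "\<lambda>l. \<pi> (out (fst (prod_decode l))) s (snd (prod_decode l))"
    let ?h = "\<lambda>l. g (out (fst (prod_decode l))) s (snd (prod_decode l))"
    have "G (\<lambda>l. ?h l (f (?p l)) * ?S s f l) = ?S (Suc s) f" for f
      using G(2)[OF \<Psi>0, of "\<lambda>a l. g a s l (f (\<pi> a s l)) * phase_state (F a) (\<pi> a) (g a) f s l" f]
        phase_state_outside[OF *(1) fin(3)]
      by (simp add: mult.left_commute)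
    then show ?case
      using phase_reachable_gate[OF phase_reachable_query[OF Suc, of ?p ?h] G(1)] *(2,3)
      by simp
  qed
  then show ?thesis by (simp add: *(4))
qed

section \<open>Distributions sampled by quantum algorithms\<close>

text \<open>A single computation serves all functions in \<open>\<F>\<close>. The set
  \<open>\<F>\<close> acts as a promise: narrowing it to the functions compatible with an earlier
  outcome expresses that later stages know this outcome.\<close>

definition q_samples :: "nat \<Rightarrow> (nat set \<Rightarrow> nat) set \<Rightarrow> nat \<Rightarrow> ((nat set \<Rightarrow> nat) \<Rightarrow> 'a pmf) \<Rightarrow> bool" where
  "q_samples n \<F> t D \<longleftrightarrow> (\<exists>A \<Psi> out. phase_reachable n A t \<Psi> \<and>
     (\<forall>f\<in>\<F>. \<forall>v. pmf (D f) v = (\<Sum>l | l \<in> A \<and> out l = v. (cmod (\<Psi> f l))\<^sup>2)))"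

lemma q_samplesI:
  assumes "phase_reachable n A t \<Psi>"
    and "\<And>f v. f \<in> \<F> \<Longrightarrow> pmf (D f) v = (\<Sum>l | l \<in> A \<and> out l = v. (cmod (\<Psi> f l))\<^sup>2)"
  shows "q_samples n \<F> t D"
  using assms unfolding q_samples_def by blast

lemma q_samples_cong: "q_samples n \<F> t D \<Longrightarrow> (\<And>f. f \<in> \<G> \<Longrightarrow> f \<in> \<F> \<and> D f = D' f) \<Longrightarrow> q_samples n \<G> t D'"
  unfolding q_samples_def by metis

text \<open>Padding uses queries to the empty set with phase 1.\<close>

lemma q_samples_mono:
  assumes "q_samples n \<F> t D" "t \<le> t'"
  shows "q_samples n \<F> t' D"
  using assms(2,1)
proof (induction t' rule: dec_induct)
  case (step m)
  then obtain A \<Psi> out where *: "phase_reachable n A m \<Psi>"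
     "\<And>f v. f \<in> \<F> \<Longrightarrow> pmf (D f) v = (\<Sum>l | l \<in> A \<and> out l = v. (cmod (\<Psi> f l))\<^sup>2)"
    unfolding q_samples_def by auto
  then show ?case
    using phase_reachable_query[OF *(1), of "\<lambda>_. {}" "\<lambda>_ _. 1"] by (intro q_samplesI[where out = out]) auto
qed

lemma q_samples_return: "q_samples n \<F> t (\<lambda>f. return_pmf a)"
proof -
  have "q_samples n \<F> 0 (\<lambda>f. return_pmf a)"
  proof (rule q_samplesI[OF phase_reachable_init[of "{0}"]])
    fix f v
    have "{l. l \<in> {0} \<and> a = v} = (if a = v then {0} else {})" by auto
    then show "pmf (return_pmf a) v = (\<Sum>l | l \<in> {0} \<and> (\<lambda>_. a) l = v. (cmod (of_bool (l = 0)))\<^sup>2)"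
      by (auto simp: indicator_def)
  qed auto
  then show ?thesis using q_samples_mono by blast
qed

text \<open>Squared amplitudes multiply along the two registers, which is the law of the composed
  distribution. The continuation after \<open>a\<close> has to be right only for those functions
  that can produce \<open>a\<close>.\<close>

lemma q_samples_bind:
  fixes D2 :: "'a \<Rightarrow> (nat set \<Rightarrow> nat) \<Rightarrow> 'b pmf"
  assumes D1: "q_samples n \<F> t D1"
    and D2: "\<And>a. q_samples n {f \<in> \<F>. a \<in> set_pmf (D1 f)} t' (D2 a)"
  shows "q_samples n \<F> (t + t') (\<lambda>f. bind_pmf (D1 f) (\<lambda>a. D2 a f))"
proof -
  obtain A \<Psi> out where 1: "phase_reachable n A t \<Psi>"
     "\<And>f v. f \<in> \<F> \<Longrightarrow> pmf (D1 f) v = (\<Sum>l | l \<in> A \<and> out l = v. (cmod (\<Psi> f l))\<^sup>2)"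
    using D1 unfolding q_samples_def by blast
  define P where "P a B \<Phi> out2 \<longleftrightarrow> phase_reachable n B t' \<Phi> \<and> (\<forall>f\<in>{f \<in> \<F>. a \<in> set_pmf (D1 f)}. \<forall>v.
        pmf (D2 a f) v = (\<Sum>l | l \<in> B \<and> out2 l = v. (cmod (\<Phi> f l))\<^sup>2))" for a B \<Phi> and out2 :: "nat \<Rightarrow> 'b"
  have "\<exists>B \<Phi> out2. P a B \<Phi> out2" for a using D2[of a] unfolding q_samples_def P_def .
  then obtain B \<Phi> out2 where "\<And>a. P a (B a) (\<Phi> a) (out2 a)" by metis
  then have 2: "\<And>a. phase_reachable n (B a) t' (\<Phi> a)"
     "\<And>a f v. f \<in> \<F> \<Longrightarrow> a \<in> set_pmf (D1 f) \<Longrightarrow>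
        pmf (D2 a f) v = (\<Sum>l | l \<in> B a \<and> out2 a l = v. (cmod (\<Phi> a f l))\<^sup>2)"
    unfolding P_def by simp_all
  have finA: "finite A" and finB: "finite (B a)" for a
    using 1(1) 2(1)[of a] unfolding phase_reachable_def by auto
  define C where "C = (\<Union>a\<in>out ` A. B a)"
  have finC: "finite C" using finA finB by (auto simp: C_def)
  \<comment> \<open>All continuations are to use the same label set, so the irrelevant ones are replaced.\<close>
  obtain a0 where a0: "a0 \<in> out ` A" using 1(1) unfolding phase_reachable_def by blast
  define r where "r a = (if a \<in> out ` A then a else a0)" for a
  have "phase_reachable n C t' (\<Phi> (r a))" for a
    using a0 finC by (intro phase_reachable_mono[OF 2(1)[of "r a"]]) (auto simp: C_def r_def)
  from phase_reachable_sequence[OF 1(1), where \<Phi> = "\<lambda>a. \<Phi> (r a)", OF this, of out]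
  have reach: "phase_reachable n (prod_encode ` (A \<times> C)) (t + t')
    (\<lambda>f l. \<Psi> f (fst (prod_decode l)) * \<Phi> (r (out (fst (prod_decode l)))) f (snd (prod_decode l)))" .
  show ?thesis
  proof (rule q_samplesI[OF reach, where out = "\<lambda>l. out2 (out (fst (prod_decode l))) (snd (prod_decode l))"])
    fix f v assume f: "f \<in> \<F>"
    have supp: "a \<in> out ` A" if "a \<in> set_pmf (D1 f)" for a
    proof (rule ccontr)
      assume "a \<notin> out ` A"
      then have eq: "{l. l \<in> A \<and> out l = a} = {}" by auto
      have "pmf (D1 f) a = 0" unfolding 1(2)[OF f] by (simp only: eq sum.empty)
      then show False using that by (simp add: set_pmf_iff)
    qed
    \<comment> \<open>Where the amplitude vanishes both sides are 0; elsewhere \<open>out l\<close>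
      is a possible outcome, so the promise for the continuation holds.\<close>
    have inner: "(cmod (\<Psi> f l))\<^sup>2 * pmf (D2 (out l) f) v
       = (\<Sum>j | j \<in> C \<and> out2 (out l) j = v. (cmod (\<Psi> f l * \<Phi> (r (out l)) f j))\<^sup>2)" if l: "l \<in> A" for l
    proof (cases "\<Psi> f l = 0")
      case False
      have "0 < (cmod (\<Psi> f l))\<^sup>2" using False by simp
      also have "\<dots> \<le> pmf (D1 f) (out l)"
        unfolding 1(2)[OF f] using finA l by (intro member_le_sum) auto
      finally have "out l \<in> set_pmf (D1 f)" by (simp add: set_pmf_iff)
      then have "pmf (D2 (out l) f) v = (\<Sum>j | j \<in> B (out l) \<and> out2 (out l) j = v. (cmod (\<Phi> (out l) f j))\<^sup>2)"
        using 2(2)[OF f] by blast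
      also have "\<dots> = (\<Sum>j | j \<in> C \<and> out2 (out l) j = v. (cmod (\<Phi> (out l) f j))\<^sup>2)"
      proof (rule sum.mono_neutral_left)
        show "finite {j. j \<in> C \<and> out2 (out l) j = v}" using finC by simp
        show "{j. j \<in> B (out l) \<and> out2 (out l) j = v} \<subseteq> {j. j \<in> C \<and> out2 (out l) j = v}"
          using l by (auto simp: C_def)
      qed (use phase_reachable_outside[OF 2(1)] in auto)
      finally show ?thesis using l by (simp add: r_def norm_mult power_mult_distrib sum_distrib_left)
    qed simp
    have "pmf (bind_pmf (D1 f) (\<lambda>a. D2 a f)) v = (\<Sum>a\<in>out ` A. pmf (D2 a f) v * pmf (D1 f) a)"
      unfolding pmf_bind using supp finA
      by (subst integral_measure_pmf_real[of "out ` A"]) (auto simp: set_pmf_iff)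
    also have "\<dots> = (\<Sum>a\<in>out ` A. \<Sum>l | l \<in> A \<and> out l = a. (cmod (\<Psi> f l))\<^sup>2 * pmf (D2 (out l) f) v)"
      by (simp add: 1(2)[OF f] sum_distrib_left mult.commute)
    also have "\<dots> = (\<Sum>l\<in>A. (cmod (\<Psi> f l))\<^sup>2 * pmf (D2 (out l) f) v)"
      using finA by (intro sum.group) auto
    also have "\<dots> = (\<Sum>l\<in>A. \<Sum>j | j \<in> C \<and> out2 (out l) j = v. (cmod (\<Psi> f l * \<Phi> (r (out l)) f j))\<^sup>2)"
      by (intro sum.cong refl inner)
    also have "\<dots> = (\<Sum>(l, j)\<in>Sigma A (\<lambda>l. {j \<in> C. out2 (out l) j = v}). (cmod (\<Psi> f l * \<Phi> (r (out l)) f j))\<^sup>2)"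
      using finA finC by (subst sum.Sigma) auto
    also have "\<dots> = (\<Sum>l | l \<in> prod_encode ` (A \<times> C) \<and> out2 (out (fst (prod_decode l))) (snd (prod_decode l)) = v.
        (cmod (\<Psi> f (fst (prod_decode l)) * \<Phi> (r (out (fst (prod_decode l)))) f (snd (prod_decode l))))\<^sup>2)"
      by (rule sum.reindex_bij_witness[of _ prod_decode prod_encode]) auto
    finally show "pmf (bind_pmf (D1 f) (\<lambda>a. D2 a f)) v = \<dots>" .
  qed
qed

lemma q_samples_map:
  assumes "q_samples n \<F> t D"
  shows "q_samples n \<F> t (\<lambda>f. map_pmf h (D f))"
proof -
  have "q_samples n \<F> (t + 0) (\<lambda>f. bind_pmf (D f) (\<lambda>a. return_pmf (h a)))"
    by (intro q_samples_bind assms q_samples_return)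
  then show ?thesis by (simp add: map_pmf_def)
qed

lemma unitary_op_of_unit_vector:
  fixes u :: "'l \<Rightarrow> real"
  assumes "finite A" "z \<in> A" "(\<Sum>i\<in>A. (u i)\<^sup>2) = 1"
  obtains F where "unitary_op A F" "\<And>i. i \<in> A \<Longrightarrow> F (\<lambda>i. of_bool (i = z)) i = u i"
proof (cases "\<forall>i\<in>A. u i = of_bool (i = z)")
  case True
  then show thesis using that[OF unitary_op_id[OF assms(1)]] by simp
next
  case False
  \<comment> \<open>The Householder reflection that swaps the two unit vectors.\<close>
  define d where "d i = of_bool (i = z) - u i" for i
  define W where "W = (\<Sum>i\<in>A. (d i)\<^sup>2)"
  have "W \<noteq> 0"
  proof
    assume "W = 0"
    then have "\<forall>i\<in>A. d i = 0" using assms(1) by (simp add: W_def sum_nonneg_eq_0_iff)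
    then have "\<forall>i\<in>A. u i = of_bool (i = z)" by (simp add: d_def)
    then show False using False by blast
  qed
  then have "W > 0" using sum_nonneg[of A "\<lambda>i. (d i)\<^sup>2"] unfolding W_def by fastforce
  \<comment> \<open>Both vectors have norm 1, so the squared distance is \<open>2 - 2 * u z\<close>;
    with this normalisation the reflection subtracts exactly \<open>d\<close> from the basis
    vector.\<close>
  have "W = (\<Sum>i\<in>A. (if i = z then 1 - 2 * u i else 0) + (u i)\<^sup>2)"
    unfolding W_def d_def by (intro sum.cong) (auto simp: power2_eq_square algebra_simps)
  then have W: "W = 2 * d z" using assms by (simp add: sum.distrib d_def)
  define s where "s i = d i / sqrt W" for i
  have "(\<Sum>i\<in>A. (s i)\<^sup>2) = 1"
    using \<open>W > 0\<close> by (simp add: s_def power_divide W_def flip: sum_divide_distrib)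
  note refl = unitary_op_reflection[OF this assms(1)]
  show thesis
  proof (rule that[OF refl])
    fix i assume i: "i \<in> A"
    have "(\<Sum>j\<in>A. complex_of_real (s j) * of_bool (j = z)) = (\<Sum>j\<in>A. if j = z then complex_of_real (s j) else 0)"
      by (intro sum.cong) auto
    then have "(\<Sum>j\<in>A. complex_of_real (s j) * of_bool (j = z)) = s z" using assms by simp
    moreover have "2 * s i * s z = d i"
      using \<open>W > 0\<close> by (simp add: s_def W power2_eq_square[symmetric] real_sqrt_mult[symmetric] field_simps)
    then have "2 * complex_of_real (s i) * complex_of_real (s z) = complex_of_real (d i)"
      by (metis of_real_mult of_real_numeral)
    ultimately show "(if i \<in> A then of_bool (i = z) - 2 * complex_of_real (s i) * (\<Sum>j\<in>A. complex_of_real (s j) * of_bool (j = z)) else of_bool (i = z)) = complex_of_real (u i)"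
      using i by (simp add: d_def)
  qed
qed

text \<open>Coin flips cost no query: the start label is rotated to the amplitudes
  \<open>sqrt (pmf p x)\<close>.\<close>

lemma q_samples_pmf:
  assumes "finite (set_pmf p)"
  shows "q_samples n \<F> t (\<lambda>f. p)"
proof -
  obtain e :: "_ \<Rightarrow> nat" and N where e: "e ` set_pmf p = {i. i < N}" "inj_on e (set_pmf p)"
    using finite_imp_inj_to_nat_seg[OF assms] by blast
  define d where "d = the_inv_into (set_pmf p) e"
  have d: "d (e x) = x" if "x \<in> set_pmf p" for x using the_inv_into_f_f[OF e(2) that] by (simp add: d_def)
  have N: "N \<noteq> 0" using e(1) set_pmf_not_empty[of p] by auto
  have sumN: "(\<Sum>i<N. h i) = (\<Sum>x\<in>set_pmf p. h (e x))" for h :: "nat \<Rightarrow> real"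
    using e by (simp add: sum.reindex lessThan_def flip: e(1))
  have "(\<Sum>i<N. (sqrt (pmf p (d i)))\<^sup>2) = 1"
    unfolding sumN using sum_pmf_eq_1[OF assms subset_refl] by (simp add: d cong: sum.cong_simp)
  then obtain F where F: "unitary_op {..<N} F"
      "\<And>i. i \<in> {..<N} \<Longrightarrow> F (\<lambda>i. of_bool (i = 0)) i = sqrt (pmf p (d i))"
    using unitary_op_of_unit_vector[of "{..<N}" 0 "\<lambda>i. sqrt (pmf p (d i))"] N by auto
  have "q_samples n \<F> 0 (\<lambda>f. p)"
  proof (rule q_samplesI[OF phase_reachable_gate[OF phase_reachable_init F(1)], where out = d])
    fix f :: "nat set \<Rightarrow> nat" and v
    have "(\<Sum>l | l \<in> {..<N} \<and> d l = v. (cmod (F (\<lambda>l. of_bool (l = 0)) l))\<^sup>2)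
       = (\<Sum>l | l \<in> {..<N} \<and> d l = v. pmf p (d l))"
      by (intro sum.cong) (auto simp: F(2))
    also have "\<dots> = (\<Sum>l<N. if d l = v then pmf p (d l) else 0)"
      by (subst sum.inter_filter) (auto simp: lessThan_def)
    also have "\<dots> = (\<Sum>x\<in>set_pmf p. if x = v then pmf p x else 0)"
      unfolding sumN by (intro sum.cong) (auto simp: d)
    also have "\<dots> = pmf p v" using assms by (auto simp: set_pmf_iff)
    finally show "pmf p v = (\<Sum>l | l \<in> {..<N} \<and> d l = v. (cmod (F (\<lambda>l. of_bool (l = 0)) l))\<^sup>2)" by simp
  qed (use N in auto)
  then show ?thesis using q_samples_mono by blast
qed

section \<open>Simulation of phase queries by the standard oracle\<close>

lemma unitary_op_matrix:
  assumes "unitary_op {..<d} F"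
  obtains M where "unitary d M" "\<And>\<psi>. M *\<^sub>v Matrix.vec d \<psi> = Matrix.vec d (F \<psi>)"
proof -
  obtain u where u: "isometric {..<d} u" "F = lin_op {..<d} u" using assms unfolding unitary_op_def by blast
  define M where "M = mat d d (\<lambda>(i, j). u i j)"
  have "mat_adjoint M * M = 1\<^sub>m d"
  proof (rule eq_matI)
    fix i j assume "i < dim_row (1\<^sub>m d :: complex mat)" "j < dim_col (1\<^sub>m d :: complex mat)"
    then have ij: "i < d" "j < d" by auto
    then have "(mat_adjoint M * M) $$ (i, j) = (\<Sum>k<d. cnj (u k i) * u k j)"
      by (simp add: mat_adjoint_def M_def scalar_prod_def conjugate_complex_def lessThan_atLeast0)
    also have "\<dots> = of_bool (i = j)" using u(1) ij unfolding isometric_def by simp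
    finally show "(mat_adjoint M * M) $$ (i, j) = 1\<^sub>m d $$ (i, j)" using ij by simp
  qed (auto simp: mat_adjoint_def M_def)
  moreover have "M *\<^sub>v Matrix.vec d \<psi> = Matrix.vec d (F \<psi>)" for \<psi>
    by (rule eq_vecI) (auto simp: M_def u(2) lin_op_def scalar_prod_def lessThan_atLeast0)
  ultimately show thesis using that[of M] unfolding unitary_def by (simp add: M_def)
qed

lemma unitary_op_cong:
  assumes "unitary_op A F" "i \<in> A" "\<And>i. i \<in> A \<Longrightarrow> \<psi> i = \<psi>' i"
  shows "F \<psi> i = F \<psi>' i"
  using assms unfolding unitary_op_def by (auto simp: lin_op_def)

lemma unitary_op_if: "unitary_op A F \<Longrightarrow> F (\<lambda>k. if P then \<psi> k else 0) = (\<lambda>k. if P then F \<psi> k else 0)"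
  unfolding unitary_op_def lin_op_def by auto

lemma xor_less_power_nat: "(a :: nat) < 2 ^ n \<Longrightarrow> b < 2 ^ n \<Longrightarrow> Bit_Operations.xor a b < 2 ^ n"
  by (metis take_bit_nat_eq_self_iff take_bit_xor)

lemma xor_cancel_nat [simp]: "Bit_Operations.xor (Bit_Operations.xor a b) b = (a :: nat)"
  by (simp add: xor.assoc)

lemma xor_eq_iff_nat: "Bit_Operations.xor a b = (c :: nat) \<longleftrightarrow> a = Bit_Operations.xor c b"
  by (metis xor_cancel_nat)

lemma set_encode_less: "S \<subseteq> {..<n} \<Longrightarrow> set_encode S < 2 ^ n"
proof -
  assume S: "S \<subseteq> {..<n}"
  then have "set_encode S \<le> (\<Sum>i<n. 2 ^ i)"
    unfolding set_encode_def by (intro sum_mono2) auto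
  also have "\<dots> < (2 :: nat) ^ n" by (simp add: sum_power2 lessThan_atLeast0)
  finally show ?thesis .
qed

lemma set_decode_subset: "s < 2 ^ n \<Longrightarrow> set_decode s \<subseteq> {..<n}"
proof
  fix x assume s: "s < 2 ^ n" and "x \<in> set_decode s"
  then have "s div 2 ^ x \<noteq> 0" by (auto simp: set_decode_def intro!: Nat.gr0I)
  then have "2 ^ x \<le> s" by (metis div_less not_le)
  then have "(2 :: nat) ^ x < 2 ^ n" using s by (rule le_less_trans)
  then show "x \<in> {..<n}" by simp
qed

locale registers =
  fixes n m w :: nat
  assumes w: "w > 0"
begin

abbreviation "sdim \<equiv> state_dim n m w"

text \<open>Agrees with \<open>basis_index\<close> once the query register holds
  \<open>set_encode S\<close> as the number \<open>s\<close>.\<close>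

definition ix :: "nat \<Rightarrow> nat \<Rightarrow> nat \<Rightarrow> nat" where "ix s b k = (s * 2 ^ m + b) * w + k"

definition "reg_s i = i div (2 ^ m * w)"
definition "reg_b i = (i div w) mod 2 ^ m"
definition "reg_k i = i mod w"

lemma ix_less: "s < 2 ^ n \<Longrightarrow> b < 2 ^ m \<Longrightarrow> k < w \<Longrightarrow> ix s b k < sdim"
proof -
  assume "s < 2 ^ n" "b < 2 ^ m" "k < w"
  have aux: "x * y + z < x' * y" if "x < x'" "z < y" for x y z x' :: nat
  proof -
    have "x * y + z < Suc x * y" using that by simp
    also have "\<dots> \<le> x' * y" using that by (intro mult_right_mono) auto
    finally show ?thesis .
  qed
  show ?thesis unfolding ix_def state_dim_def by (intro aux) fact+
qed

lemma reg_ix [simp]: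
  assumes "b < 2 ^ m" "k < w"
  shows "reg_s (ix s b k) = s" "reg_b (ix s b k) = b" "reg_k (ix s b k) = k"
proof -
  have "ix s b k div w = s * 2 ^ m + b" using assms w by (simp add: ix_def)
  then show "reg_b (ix s b k) = b" "reg_s (ix s b k) = s"
    using assms by (simp_all add: reg_b_def reg_s_def mult.commute[of "2 ^ m"] div_mult2_eq)
  show "reg_k (ix s b k) = k" using assms by (simp add: ix_def reg_k_def)
qed

lemma ix_reg: "ix (reg_s i) (reg_b i) (reg_k i) = i"
  by (simp add: ix_def reg_s_def reg_b_def reg_k_def mult.commute[of "2 ^ m"] div_mult2_eq div_mult_mod_eq)

lemma reg_less:
  assumes "i < sdim"
  shows "reg_s i < 2 ^ n" "reg_b i < 2 ^ m" "reg_k i < w"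
proof -
  show "reg_b i < 2 ^ m" "reg_k i < w" using w by (auto simp: reg_b_def reg_k_def)
  have "i < 2 ^ n * (2 ^ m * w)" using assms by (simp add: state_dim_def mult.assoc)
  then show "reg_s i < 2 ^ n" unfolding reg_s_def by (simp add: less_mult_imp_div_less)
qed

lemma dim_image: "(\<lambda>(k, c). ix (fst c) (snd c) k) ` ({..<w} \<times> ({..<2 ^ n} \<times> {..<2 ^ m})) = {..<sdim}"
proof (intro equalityI subsetI)
  fix i assume "i \<in> {..<sdim}"
  then have "(reg_k i, (reg_s i, reg_b i)) \<in> {..<w} \<times> ({..<2 ^ n} \<times> {..<2 ^ m})" using reg_less by auto
  then show "i \<in> (\<lambda>(k, c). ix (fst c) (snd c) k) ` ({..<w} \<times> ({..<2 ^ n} \<times> {..<2 ^ m}))"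
    by (rule rev_image_eqI) (simp add: ix_reg)
qed (auto intro: ix_less)

definition state :: "(nat \<Rightarrow> nat \<Rightarrow> nat \<Rightarrow> complex) \<Rightarrow> complex Matrix.vec" where
  "state \<phi> = Matrix.vec sdim (\<lambda>i. \<phi> (reg_s i) (reg_b i) (reg_k i))"

text \<open>Only indices below \<open>sdim\<close> are compared, since register values of larger
  indices carry no meaning for the state vector.\<close>

definition realizable :: "((nat \<Rightarrow> nat \<Rightarrow> nat \<Rightarrow> complex) \<Rightarrow> nat \<Rightarrow> nat \<Rightarrow> nat \<Rightarrow> complex) \<Rightarrow> bool" where
  "realizable T \<longleftrightarrow> (\<exists>G. unitary_op {..<sdim} G \<and>
     (\<forall>\<phi>. \<forall>i<sdim. G (\<lambda>i. \<phi> (reg_s i) (reg_b i) (reg_k i)) i = T \<phi> (reg_s i) (reg_b i) (reg_k i)))"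

lemma realizable_comp:
  assumes "realizable T" "realizable T'"
  shows "realizable (\<lambda>\<phi>. T (T' \<phi>))"
proof -
  obtain G where G: "unitary_op {..<sdim} G"
    "\<And>\<phi> i. i < sdim \<Longrightarrow> G (\<lambda>i. \<phi> (reg_s i) (reg_b i) (reg_k i)) i = T \<phi> (reg_s i) (reg_b i) (reg_k i)"
    using assms(1) unfolding realizable_def by blast
  obtain G' where G': "unitary_op {..<sdim} G'"
    "\<And>\<phi> i. i < sdim \<Longrightarrow> G' (\<lambda>i. \<phi> (reg_s i) (reg_b i) (reg_k i)) i = T' \<phi> (reg_s i) (reg_b i) (reg_k i)"
    using assms(2) unfolding realizable_def by blast
  have "G (G' (\<lambda>i. \<phi> (reg_s i) (reg_b i) (reg_k i))) i = T (T' \<phi>) (reg_s i) (reg_b i) (reg_k i)"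
    if "i < sdim" for \<phi> i
    using unitary_op_cong[OF G(1), where \<psi> = "G' (\<lambda>i. \<phi> (reg_s i) (reg_b i) (reg_k i))"
        and \<psi>' = "\<lambda>i. T' \<phi> (reg_s i) (reg_b i) (reg_k i)" and i = i] G(2)[OF that, of "T' \<phi>"] G'(2)[of _ \<phi>] that
    by simp
  then show ?thesis unfolding realizable_def
    using unitary_op_comp[OF G(1) G'(1) finite_lessThan] by blast
qed

lemma realizable_matrix:
  assumes "realizable T"
  shows "\<exists>M. unitary sdim M \<and> (\<forall>\<phi>. M *\<^sub>v state \<phi> = state (T \<phi>))"
proof -
  obtain G where G: "unitary_op {..<sdim} G"
    "\<And>\<phi> i. i < sdim \<Longrightarrow> G (\<lambda>i. \<phi> (reg_s i) (reg_b i) (reg_k i)) i = T \<phi> (reg_s i) (reg_b i) (reg_k i)"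
    using assms unfolding realizable_def by blast
  obtain M where "unitary sdim M" "\<And>\<psi>. M *\<^sub>v Matrix.vec sdim \<psi> = Matrix.vec sdim (G \<psi>)"
    using unitary_op_matrix[OF G(1)] by blast
  then show ?thesis using G(2) unfolding state_def by (intro exI[of _ M]) (auto intro!: eq_vecI)
qed

lemma realizable_workspace:
  assumes "unitary_op {..<w} F"
  shows "realizable (\<lambda>\<phi> s b. F (\<phi> s b))"
proof -
  have inj: "inj_on (\<lambda>(k, c). ix (fst c) (snd c) k) ({..<w} \<times> ({..<2 ^ n} \<times> {..<2 ^ m}))"
  proof (intro inj_onI, clarsimp)
    fix k s b k' s' b'
    assume "k < w" "b < 2 ^ m" "k' < w" "b' < 2 ^ m" "ix s b k = ix s' b' k'"
    then show "k = k' \<and> s = s' \<and> b = b'" using reg_ix[of b k s] reg_ix[of b' k' s'] by metis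
  qed
  obtain G where G: "unitary_op {..<sdim} G" "\<And>\<psi> k c. k \<in> {..<w} \<Longrightarrow> c \<in> {..<2 ^ n} \<times> {..<2 ^ m} \<Longrightarrow>
      G \<psi> (ix (fst c) (snd c) k) = F (\<lambda>k'. \<psi> (ix (fst c) (snd c) k')) k"
    using unitary_op_controlled[where F = "\<lambda>_. F" and e = "\<lambda>k c. ix (fst c) (snd c) k", OF assms _ _ inj]
    unfolding dim_image by auto
  have "G (\<lambda>i. \<phi> (reg_s i) (reg_b i) (reg_k i)) i = F (\<phi> (reg_s i) (reg_b i)) (reg_k i)" if i: "i < sdim" for \<phi> i
  proof -
    note r = reg_less[OF i]
    have "G (\<lambda>i. \<phi> (reg_s i) (reg_b i) (reg_k i)) i
        = F (\<lambda>k'. \<phi> (reg_s (ix (reg_s i) (reg_b i) k')) (reg_b (ix (reg_s i) (reg_b i) k')) (reg_k (ix (reg_s i) (reg_b i) k'))) (reg_k i)"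
      using G(2)[of "reg_k i" "(reg_s i, reg_b i)" "\<lambda>i. \<phi> (reg_s i) (reg_b i) (reg_k i)"] r
      by (simp add: ix_reg)
    also have "\<dots> = F (\<phi> (reg_s i) (reg_b i)) (reg_k i)"
      using r by (intro unitary_op_cong[OF assms]) auto
    finally show ?thesis .
  qed
  then show ?thesis unfolding realizable_def using G(1) by blast
qed

lemma realizable_xor:
  assumes "\<And>k. c k < 2 ^ n"
  shows "realizable (\<lambda>\<phi> s b k. \<phi> (Bit_Operations.xor s (c k)) b k)"
proof -
  define \<sigma> where "\<sigma> i = ix (Bit_Operations.xor (reg_s i) (c (reg_k i))) (reg_b i) (reg_k i)" for i
  have \<sigma>: "\<sigma> i < sdim" "\<sigma> (\<sigma> i) = i" if "i < sdim" for i
    using reg_less[OF that] assms by (auto simp: \<sigma>_def ix_reg intro!: ix_less xor_less_power_nat)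
  have "bij_betw \<sigma> {..<sdim} {..<sdim}"
    by (rule bij_betw_byWitness[of _ \<sigma>]) (use \<sigma> in auto)
  note G = unitary_op_perm[OF this finite_lessThan]
  show ?thesis unfolding realizable_def
    by (intro exI[of _ "\<lambda>\<psi> i. if i \<in> {..<sdim} then \<psi> (\<sigma> i) else \<psi> i"] conjI G)
      (use reg_less in \<open>auto simp: \<sigma>_def\<close>)
qed

lemma realizable_phase: "(\<And>b k. cmod (g k b) = 1) \<Longrightarrow> realizable (\<lambda>\<phi> s b k. g k b * \<phi> s b k)"
  unfolding realizable_def
  by (rule exI, rule conjI, rule unitary_op_diag[of "{..<sdim}" "\<lambda>i. g (reg_k i) (reg_b i)"]) auto

text \<open>XOR with the answer is an involution on the basis vectors, so moving vectors forward
  equals pulling amplitudes back along the same map.\<close>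

lemma oracle_state:
  assumes "\<And>S. S \<subseteq> {..<n} \<Longrightarrow> f S < 2 ^ m"
  shows "quantum_oracle n m w f *\<^sub>v state \<phi>
       = state (\<lambda>s b k. \<phi> s (Bit_Operations.xor b (f (set_decode s))) k)"
proof (rule eq_vecI)
  define \<sigma> where "\<sigma> i = ix (reg_s i) (Bit_Operations.xor (reg_b i) (f (set_decode (reg_s i)))) (reg_k i)" for i
  fix i assume "i < dim_vec (state (\<lambda>s b k. \<phi> s (Bit_Operations.xor b (f (set_decode s))) k))"
  then have i: "i < sdim" by (simp add: state_def)
  have lt: "Bit_Operations.xor (reg_b i) (f (set_decode (reg_s i))) < 2 ^ m" if "i < sdim" for i
    using reg_less[OF that] assms set_decode_subset by (auto intro!: xor_less_power_nat)
  have \<sigma>: "\<sigma> i < sdim" "\<sigma> (\<sigma> i) = i" if "i < sdim" for i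
    using reg_less[OF that] lt[OF that] by (auto simp: \<sigma>_def ix_reg intro!: ix_less)
  have "(quantum_oracle n m w f *\<^sub>v state \<phi>) $ i
      = (\<Sum>j<sdim. (if i = \<sigma> j then 1 else 0) * \<phi> (reg_s j) (reg_b j) (reg_k j))"
    using i by (simp add: quantum_oracle_def state_def scalar_prod_def lessThan_atLeast0 Let_def \<sigma>_def
        basis_index_def ix_def reg_s_def reg_b_def reg_k_def)
  also have "\<dots> = (\<Sum>j<sdim. if j = \<sigma> i then \<phi> (reg_s j) (reg_b j) (reg_k j) else 0)"
  proof (rule sum.cong[OF refl])
    fix j assume "j \<in> {..<sdim}"
    then have "i = \<sigma> j \<longleftrightarrow> j = \<sigma> i" using \<sigma>(2)[of j] \<sigma>(2)[OF i] by auto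
    then show "(if i = \<sigma> j then 1 else 0) * \<phi> (reg_s j) (reg_b j) (reg_k j)
        = (if j = \<sigma> i then \<phi> (reg_s j) (reg_b j) (reg_k j) else 0)" by simp
  qed
  also have "\<dots> = \<phi> (reg_s (\<sigma> i)) (reg_b (\<sigma> i)) (reg_k (\<sigma> i))" using \<sigma>(1)[OF i] by simp
  also have "\<dots> = \<phi> (reg_s i) (Bit_Operations.xor (reg_b i) (f (set_decode (reg_s i)))) (reg_k i)"
    using reg_less[OF i] lt[OF i] by (simp add: \<sigma>_def)
  finally show "(quantum_oracle n m w f *\<^sub>v state \<phi>) $ i
      = state (\<lambda>s b k. \<phi> s (Bit_Operations.xor b (f (set_decode s))) k) $ i" using i by (simp add: state_def)
qed (simp add: quantum_oracle_def state_def)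

end

text \<open>The phase query for the label \<open>k\<close> loads its query into the query register, calls the oracle, multiplies by
  the phase, and calls the oracle again to clear the answer register.\<close>

theorem quantum_algorithm_of_samples:
  fixes D :: "(nat set \<Rightarrow> nat) \<Rightarrow> nat pmf"
  assumes D: "q_samples n \<F> t D" and bits: "\<And>f S. f \<in> \<F> \<Longrightarrow> S \<subseteq> {..<n} \<Longrightarrow> f S < 2 ^ m"
  obtains Q where "valid_quantum_algorithm n m Q" "num_queries Q = 2 * t"
    "\<And>f v. f \<in> \<F> \<Longrightarrow> quantum_output_prob n m Q f v = pmf (D f) v"
proof -
  obtain A \<Psi> out where A: "phase_reachable n A t \<Psi>"
     "\<And>f v. f \<in> \<F> \<Longrightarrow> pmf (D f) v = (\<Sum>l | l \<in> A \<and> out l = v. (cmod (\<Psi> f l))\<^sup>2)"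
    using D unfolding q_samples_def by blast
  define w where "w = Suc (Max A)"
  have Aw: "A \<subseteq> {..<w}" and finA: "finite A" using A(1) unfolding phase_reachable_def by (auto simp: w_def less_Suc_eq_le)
  interpret registers n m w by unfold_locales (simp add: w_def)
  obtain F \<pi> g where *: "\<And>s. unitary_op {..<w} (F s)" "\<And>s l. \<pi> s l \<subseteq> {..<n}"
    "\<And>s l b. cmod (g s l b) = 1" "\<And>f. \<Psi> f = phase_state F \<pi> g f t"
    using phase_reachable_mono[OF A(1) Aw finite_lessThan] unfolding phase_reachable_def by blast
  define c where "c s k = set_encode (\<pi> s k)" for s k
  have c: "c s k < 2 ^ n" for s k using *(2) by (simp add: c_def set_encode_less)
  have dec: "set_decode (c s k) = \<pi> s k" for s k
    using *(2)[of s k] finite_subset[of "\<pi> s k" "{..<n}"] by (simp add: c_def)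
  define load where "load s \<phi> = (\<lambda>r b k. \<phi> (Bit_Operations.xor r (c s k)) b k)"
    for s and \<phi> :: "nat \<Rightarrow> nat \<Rightarrow> nat \<Rightarrow> complex"
  define work where "work s \<phi> = (\<lambda>r b. F s (\<phi> r b))" for s and \<phi> :: "nat \<Rightarrow> nat \<Rightarrow> nat \<Rightarrow> complex"
  define kick where "kick s \<phi> = (\<lambda>r b k. g s k b * \<phi> r b k)" for s and \<phi> :: "nat \<Rightarrow> nat \<Rightarrow> nat \<Rightarrow> complex"
  \<comment> \<open>Odd gates sit between the two oracle calls of a phase query and apply the phase.
    Even gates unload the previous query, apply the gate \<open>F\<close> and load the next
    query.\<close>
  define T where "T i = (if odd i then kick (i div 2) else if i = 0 then (\<lambda>\<phi>. load 0 (work 0 \<phi>))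
     else (\<lambda>\<phi>. load (i div 2) (work (i div 2) (load (i div 2 - 1) \<phi>))))" for i
  have load: "realizable (load s)" and work: "realizable (work s)" and kick: "realizable (kick s)" for s
    unfolding load_def work_def kick_def using c *
    by (auto intro: realizable_xor realizable_workspace realizable_phase)
  have "realizable (T i)" for i
    using kick realizable_comp[OF load work] realizable_comp[OF load realizable_comp[OF work load]]
    by (simp add: T_def)
  then have "\<exists>M. unitary sdim M \<and> (\<forall>\<phi>. M *\<^sub>v state \<phi> = state (T i \<phi>))" for i
    by (rule realizable_matrix)
  then obtain M where M: "\<And>i. unitary sdim (M i)" "\<And>i \<phi>. M i *\<^sub>v state \<phi> = state (T i \<phi>)"
    by metis
  define Q where "Q = \<lparr>num_queries = 2 * t, workspace = w, gate = M, result = (\<lambda>i. out (reg_k i))\<rparr>"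
  let ?\<phi> = "\<lambda>f s r b k. if r = c s k \<and> b = 0 then phase_state F \<pi> g f s k else 0"
  have init: "unit_vec sdim 0 = state (\<lambda>r b k. if r = 0 \<and> b = 0 then of_bool (k = 0) else 0)"
  proof (rule eq_vecI)
    fix i assume "i < dim_vec (state (\<lambda>r b k. if r = 0 \<and> b = 0 then of_bool (k = 0) else 0))"
    then have "i < sdim" by (simp add: state_def)
    moreover have "i = 0 \<longleftrightarrow> reg_s i = 0 \<and> reg_b i = 0 \<and> reg_k i = 0"
      using ix_reg[of i] by (auto simp: reg_s_def reg_b_def reg_k_def ix_def)
    ultimately show "unit_vec sdim 0 $ i = state (\<lambda>r b k. if r = 0 \<and> b = 0 then of_bool (k = 0) else 0) $ i"
      by (auto simp: state_def)
  qed (simp add: state_def)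
  have work_load: "load s (work s (\<lambda>r b k. if r = 0 \<and> b = 0 then \<psi> k else 0))
     = (\<lambda>r b k. if r = c s k \<and> b = 0 then F s \<psi> k else 0)" for s \<psi>
    unfolding load_def work_def unitary_op_if[OF *(1)] by (auto simp: xor_eq_iff_nat fun_eq_iff)
  have inv: "quantum_state n m Q f (2 * s) = state (?\<phi> f s)" if f: "f \<in> \<F>" for f s
  proof (induction s)
    case 0
    have "T 0 (\<lambda>r b k. if r = 0 \<and> b = 0 then of_bool (k = 0) else 0) = ?\<phi> f 0"
      by (simp add: T_def work_load cong: if_cong)
    then show ?case by (simp add: Q_def init M(2))
  next
    case (Suc s)
    have query: "quantum_oracle n m w f *\<^sub>v state \<phi>
       = state (\<lambda>r b k. \<phi> r (Bit_Operations.xor b (f (set_decode r))) k)" for \<phi>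
      using bits[OF f] by (rule oracle_state)
    let ?h = "\<lambda>k. f (\<pi> s k)"
    have 1: "(\<lambda>r b k. ?\<phi> f s r (Bit_Operations.xor b (f (set_decode r))) k)
       = (\<lambda>r b k. if r = c s k \<and> b = ?h k then phase_state F \<pi> g f s k else 0)"
      by (auto simp: xor_eq_iff_nat dec fun_eq_iff)
    have 2: "T (Suc (2 * s)) (\<lambda>r b k. if r = c s k \<and> b = ?h k then phase_state F \<pi> g f s k else 0)
       = (\<lambda>r b k. if r = c s k \<and> b = ?h k then g s k (?h k) * phase_state F \<pi> g f s k else 0)"
      by (auto simp: T_def kick_def fun_eq_iff)
    have 3: "(\<lambda>r b k. if r = c s k \<and> Bit_Operations.xor b (f (set_decode r)) = ?h k
          then g s k (?h k) * phase_state F \<pi> g f s k else 0)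
       = (\<lambda>r b k. if r = c s k \<and> b = 0 then g s k (?h k) * phase_state F \<pi> g f s k else 0)"
      by (auto simp: xor_eq_iff_nat dec fun_eq_iff)
    have 4: "load s (\<lambda>r b k. if r = c s k \<and> b = 0 then g s k (?h k) * phase_state F \<pi> g f s k else 0)
       = (\<lambda>r b k. if r = 0 \<and> b = 0 then g s k (?h k) * phase_state F \<pi> g f s k else 0)"
      by (auto simp: load_def xor_eq_iff_nat fun_eq_iff)
    have 5: "T (Suc (Suc (2 * s))) (\<lambda>r b k. if r = c s k \<and> b = 0 then g s k (?h k) * phase_state F \<pi> g f s k else 0)
       = ?\<phi> f (Suc s)"
      by (simp add: T_def 4 work_load cong: if_cong)
    have "quantum_state n m Q f (2 * Suc s) = M (Suc (Suc (2 * s))) *\<^sub>v (quantum_oracle n m w f *\<^sub>v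
        (M (Suc (2 * s)) *\<^sub>v (quantum_oracle n m w f *\<^sub>v quantum_state n m Q f (2 * s))))"
      by (simp add: Q_def)
    also have "\<dots> = state (?\<phi> f (Suc s))"
      by (simp only: Suc query 1 M(2) 2 3 5)
    finally show ?case .
  qed
  have prob: "quantum_output_prob n m Q f v = pmf (D f) v" if f: "f \<in> \<F>" for f v
  proof -
    have "quantum_output_prob n m Q f v
       = (\<Sum>i | i < sdim \<and> out (reg_k i) = v. (cmod (?\<phi> f t (reg_s i) (reg_b i) (reg_k i)))\<^sup>2)"
      unfolding quantum_output_prob_def using inv[OF f, of t] by (auto simp: Q_def state_def intro!: sum.cong)
    \<comment> \<open>The last gate also loads a query that is never asked, so the nonzero
      amplitudes lie at \<open>ix (c t k) 0 k\<close> rather than at a cleared query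
      register.\<close>
    also have "\<dots> = (\<Sum>i\<in>(\<lambda>k. ix (c t k) 0 k) ` {k. k < w \<and> out k = v}. (cmod (?\<phi> f t (reg_s i) (reg_b i) (reg_k i)))\<^sup>2)"
    proof (rule sum.mono_neutral_right)
      show "(\<lambda>k. ix (c t k) 0 k) ` {k. k < w \<and> out k = v} \<subseteq> {i. i < sdim \<and> out (reg_k i) = v}"
        using c by (auto intro!: ix_less)
      show "\<forall>i\<in>{i. i < sdim \<and> out (reg_k i) = v} - (\<lambda>k. ix (c t k) 0 k) ` {k. k < w \<and> out k = v}.
          (cmod (?\<phi> f t (reg_s i) (reg_b i) (reg_k i)))\<^sup>2 = 0"
      proof
        fix i assume i: "i \<in> {i. i < sdim \<and> out (reg_k i) = v} - (\<lambda>k. ix (c t k) 0 k) ` {k. k < w \<and> out k = v}"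
        have "\<not> (reg_s i = c t (reg_k i) \<and> reg_b i = 0)"
        proof
          assume "reg_s i = c t (reg_k i) \<and> reg_b i = 0"
          then have "i = ix (c t (reg_k i)) 0 (reg_k i)" using ix_reg[of i] by simp
          then show False using i reg_less(3)[of i] by blast
        qed
        then show "(cmod (?\<phi> f t (reg_s i) (reg_b i) (reg_k i)))\<^sup>2 = 0" by auto
      qed
    qed simp
    also have "\<dots> = (\<Sum>k | k < w \<and> out k = v. (cmod (phase_state F \<pi> g f t k))\<^sup>2)"
    proof (subst sum.reindex)
      show "inj_on (\<lambda>k. ix (c t k) 0 k) {k. k < w \<and> out k = v}"
        by (rule inj_on_inverseI[of _ reg_k]) simp
    qed (auto intro!: sum.cong)
    also have "\<dots> = (\<Sum>l | l \<in> A \<and> out l = v. (cmod (\<Psi> f l))\<^sup>2)"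
    proof (rule sum.mono_neutral_cong_right)
      show "{l. l \<in> A \<and> out l = v} \<subseteq> {k. k < w \<and> out k = v}" using Aw by auto
    qed (use phase_reachable_outside[OF A(1)] *(4) in auto)
    finally show ?thesis using A(2)[OF f] by simp
  qed
  show thesis
    using that[of Q] prob M(1) by (auto simp: valid_quantum_algorithm_def Q_def w_def)
qed

section \<open>Crossing numbers\<close>

definition crossing :: "'v set set \<Rightarrow> 'v set \<Rightarrow> 'v \<Rightarrow> nat" where
  "crossing E X v = card {e \<in> cut_edges E X. v \<in> e}"

definition nbhd :: "'v set set \<Rightarrow> 'v \<Rightarrow> 'v set" where
  "nbhd E v = {u. {u, v} \<in> E}"

lemma simple_graph_finite: "simple_graph V E \<Longrightarrow> finite E"
  unfolding simple_graph_def by (meson PowI finite_Pow_iff finite_subset subsetI)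

lemma simple_graph_edgeE:
  assumes "simple_graph V E" "e \<in> E"
  obtains u v where "e = {u, v}" "u \<noteq> v" "u \<in> V" "v \<in> V"
  using assms unfolding simple_graph_def by (metis card_2_iff insert_subset)

lemma nbhd_subset: "simple_graph V E \<Longrightarrow> nbhd E v \<subseteq> V - {v}"
  unfolding nbhd_def simple_graph_def by fastforce

lemma finite_nbhd: "simple_graph V E \<Longrightarrow> finite (nbhd E v)"
  by (meson finite_Diff finite_subset nbhd_subset simple_graph_def)

lemma nbhd_sym: "u \<in> nbhd E v \<longleftrightarrow> v \<in> nbhd E u"
  unfolding nbhd_def by (simp add: insert_commute)

lemma card_pair_Int: "u \<noteq> v \<Longrightarrow> card ({u, v} \<inter> S) = of_bool (u \<in> S) + of_bool (v \<in> S)"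
  by (auto simp: Int_insert_left)

lemma card_cut_edges: "finite E \<Longrightarrow> card (cut_edges E S) = (\<Sum>e\<in>E. of_bool (card (e \<inter> S) = 1))"
  unfolding cut_edges_def by (subst sum_of_bool_eq) (auto simp: Collect_conj_eq intro: arg_cong[where f = card])

lemma finite_cut_edges: "finite E \<Longrightarrow> finite (cut_edges E S)"
  unfolding cut_edges_def by simp

lemma sum_crossing:
  assumes "finite E" "finite T"
  shows "(\<Sum>v\<in>T. crossing E X v) = (\<Sum>e\<in>cut_edges E X. card (e \<inter> T))"
proof -
  have "crossing E X v = (\<Sum>e\<in>cut_edges E X. of_bool (v \<in> e))" for v
    unfolding crossing_def using finite_cut_edges[OF assms(1)]
    by (subst sum_of_bool_eq) (auto simp: Collect_conj_eq intro: arg_cong[where f = card])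
  moreover have "card (e \<inter> T) = (\<Sum>v\<in>T. of_bool (v \<in> e))" for e
    using assms(2) by (subst sum_of_bool_eq) (auto simp: Int_commute)
  ultimately show ?thesis by (simp add: sum.swap[of _ T])
qed

lemma crossing_eq_card_nbhd:
  assumes "simple_graph V E"
  shows "crossing E X v = card {u \<in> nbhd E v. (u \<in> X) \<noteq> (v \<in> X)}"
  unfolding crossing_def
proof (rule sym, rule bij_betw_same_card[of "\<lambda>u. {u, v}"], rule bij_betwI')
  fix u w assume "u \<in> {u \<in> nbhd E v. (u \<in> X) \<noteq> (v \<in> X)}" "w \<in> {u \<in> nbhd E v. (u \<in> X) \<noteq> (v \<in> X)}"
  then show "({u, v} = {w, v}) = (u = w)" by (auto simp: doubleton_eq_iff)
next
  fix u assume "u \<in> {u \<in> nbhd E v. (u \<in> X) \<noteq> (v \<in> X)}"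
  then show "{u, v} \<in> {e \<in> cut_edges E X. v \<in> e}"
    using card_pair_Int[of u v X] by (auto simp: cut_edges_def nbhd_def)
next
  fix e assume e: "e \<in> {e \<in> cut_edges E X. v \<in> e}"
  then have "e \<in> E" by (simp add: cut_edges_def)
  then obtain a b where ab: "e = {a, b}" "a \<noteq> b" using assms by (meson simple_graph_edgeE)
  then obtain u where u: "e = {u, v}" "u \<noteq> v" using e by auto
  have "card ({u, v} \<inter> X) = 1" using e u by (simp add: cut_edges_def)
  then have "(u \<in> X) \<noteq> (v \<in> X)" using card_pair_Int[OF u(2), of X] by (cases "u \<in> X"; cases "v \<in> X") simp_all
  then show "\<exists>u\<in>{u \<in> nbhd E v. (u \<in> X) \<noteq> (v \<in> X)}. e = {u, v}"
    using u \<open>e \<in> E\<close> by (auto simp: nbhd_def)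
qed

text \<open>Checked edge by edge: only the edges of the cut of \<open>X\<close> contribute.\<close>

lemma sum_crossing_eq_cuts:
  assumes "simple_graph V E" "finite T"
  shows "2 * (\<Sum>v\<in>T. crossing E X v) + card (cut_edges E (X \<union> T)) + card (cut_edges E (X - T))
       = 2 * card (cut_edges E X) + card (cut_edges E (T - X)) + card (cut_edges E (T \<inter> X))"
proof -
  note fin = simple_graph_finite[OF assms(1)]
  have "(\<Sum>e\<in>cut_edges E X. card (e \<inter> T)) = (\<Sum>e\<in>E. of_bool (card (e \<inter> X) = 1) * card (e \<inter> T))"
    unfolding cut_edges_def using fin by (intro sum.mono_neutral_cong_left) auto
  moreover have "(\<Sum>e\<in>E. 2 * (of_bool (card (e \<inter> X) = 1) * card (e \<inter> T)) + of_bool (card (e \<inter> (X \<union> T)) = 1)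
        + of_bool (card (e \<inter> (X - T)) = 1))
      = (\<Sum>e\<in>E. 2 * of_bool (card (e \<inter> X) = 1) + of_bool (card (e \<inter> (T - X)) = 1)
        + (of_bool (card (e \<inter> (T \<inter> X)) = 1) :: nat))" (is "sum ?f E = sum ?g E")
  proof (rule sum.cong[OF refl])
    fix e assume "e \<in> E"
    then obtain u v where "e = {u, v}" "u \<noteq> v" using assms(1) by (meson simple_graph_edgeE)
    then show "?f e = ?g e"
      by (cases "u \<in> X"; cases "v \<in> X"; cases "u \<in> T"; cases "v \<in> T") (simp_all add: card_pair_Int)
  qed
  ultimately show ?thesis
    by (simp add: sum_crossing[OF fin assms(2)] card_cut_edges[OF fin] sum.distrib flip: sum_distrib_left)
qed

lemma sum_crossing_all:
  assumes "simple_graph V E"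
  shows "(\<Sum>v\<in>V. crossing E X v) = 2 * card (cut_edges E X)"
proof -
  have "card (e \<inter> V) = 2" if "e \<in> cut_edges E X" for e
    using that assms by (auto simp: cut_edges_def simple_graph_def Int_absorb2)
  then show ?thesis
    using assms simple_graph_finite[OF assms] by (subst sum_crossing) (auto simp: simple_graph_def)
qed

lemma card_cut_edges_outside:
  assumes "simple_graph V E" "S \<subseteq> V"
  shows "card (cut_edges E S) = (\<Sum>w\<in>V - S. crossing E S w)"
proof -
  have "card (e \<inter> (V - S)) = 1" if "e \<in> cut_edges E S" for e
  proof -
    have "e \<in> E" "card (e \<inter> S) = 1" using that by (auto simp: cut_edges_def)
    moreover obtain u v where "e = {u, v}" "u \<noteq> v" "u \<in> V" "v \<in> V"
      using \<open>e \<in> E\<close> assms(1) by (meson simple_graph_edgeE)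
    ultimately show ?thesis by (auto simp: card_pair_Int simp del: One_nat_def split: if_splits)
  qed
  then show ?thesis
    using assms simple_graph_finite[OF assms(1)] by (subst sum_crossing) (auto simp: simple_graph_def)
qed

lemma crossing_self: "crossing E {v} v = card (cut_edges E {v})" if "simple_graph V E"
proof -
  have "v \<in> e" if "e \<in> cut_edges E {v}" for e
    using that by (auto simp: cut_edges_def Int_insert_right split: if_splits)
  then show ?thesis unfolding crossing_def by (metis (mono_tags, lifting) Collect_cong Collect_mem_eq)
qed

lemma card_nbhd: "simple_graph V E \<Longrightarrow> card (nbhd E v) = card (cut_edges E {v})"
  using nbhd_subset[of V E v] crossing_eq_card_nbhd[of V E "{v}" v]
  by (fastforce simp: crossing_self[symmetric] intro: arg_cong[where f = card])

lemma crossing_le_card_nbhd: "simple_graph V E \<Longrightarrow> crossing E X v \<le> card (nbhd E v)"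
  by (subst crossing_eq_card_nbhd) (auto intro!: card_mono finite_nbhd)

lemma crossing_less: "simple_graph V E \<Longrightarrow> v \<in> V \<Longrightarrow> crossing E X v < card V"
proof -
  assume G: "simple_graph V E" and v: "v \<in> V"
  then have "finite V" by (simp add: simple_graph_def)
  then have "card (nbhd E v) \<le> card (V - {v})" using nbhd_subset[OF G] by (intro card_mono) auto
  then show ?thesis
    using crossing_le_card_nbhd[OF G, of X v] card_Diff1_less[OF \<open>finite V\<close> v] by linarith
qed

lemma crossing_outside: "simple_graph V E \<Longrightarrow> v \<notin> V \<Longrightarrow> crossing E X v = 0"
  unfolding crossing_def cut_edges_def simple_graph_def by (auto simp: card_eq_0_iff)

lemma crossing_singleton: "simple_graph V E \<Longrightarrow> u \<noteq> v \<Longrightarrow> crossing E {u} v = of_bool (u \<in> nbhd E v)"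
proof -
  assume "simple_graph V E" "u \<noteq> v"
  moreover have "{w \<in> nbhd E v. (w \<in> {u}) \<noteq> (v \<in> {u})} = (if u \<in> nbhd E v then {u} else {})"
    using \<open>u \<noteq> v\<close> by auto
  ultimately show ?thesis by (simp add: crossing_eq_card_nbhd)
qed

lemma edge_connectivity_le:
  assumes "finite V" "S \<noteq> {}" "S \<subset> V"
  shows "edge_connectivity V E \<le> card (cut_edges E S)"
  unfolding edge_connectivity_def using assms
  by (intro Min_le) (auto intro: finite_subset[of _ "(\<lambda>S. card (cut_edges E S)) ` Pow V"])

lemma edge_connectivity_attained:
  assumes "finite V" "card V \<ge> 2"
  obtains S where "S \<noteq> {}" "S \<subset> V" "card (cut_edges E S) = edge_connectivity V E"
proof -
  obtain v where "v \<in> V" using assms by fastforce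
  moreover have "{v} \<noteq> V" using assms(2) by auto
  ultimately have "{card (cut_edges E S) | S. S \<noteq> {} \<and> S \<subset> V} \<noteq> {}" by blast
  moreover have "finite {card (cut_edges E S) | S. S \<noteq> {} \<and> S \<subset> V}"
    using assms(1) by (auto intro: finite_subset[of _ "(\<lambda>S. card (cut_edges E S)) ` Pow V"])
  ultimately have "edge_connectivity V E \<in> {card (cut_edges E S) | S. S \<noteq> {} \<and> S \<subset> V}"
    unfolding edge_connectivity_def by (intro Min_in)
  then obtain S where "S \<noteq> {}" "S \<subset> V" "edge_connectivity V E = card (cut_edges E S)" by blast
  then show thesis using that[of S] by simp
qed

lemma edge_connectivity_le_card_nbhd:
  assumes "simple_graph V E" "v \<in> V" "card V \<ge> 2"
  shows "edge_connectivity V E \<le> card (nbhd E v)"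
proof -
  have "{v} \<subset> V" using assms by (auto simp: card_le_Suc0_iff_eq)
  then show ?thesis
    using edge_connectivity_le[of V "{v}" E] assms card_nbhd[OF assms(1), of v] by (simp add: simple_graph_def)
qed

text \<open>Moving \<open>v\<close> to the other side changes the cut by its degree minus twice its
  crossing number, which is nonnegative by minimality. The move leaves a proper nonempty set, for
  otherwise the cut would isolate \<open>v\<close> alone, although its degree exceeds the edge
  connectivity.\<close>

lemma minimum_cut_crossing:
  assumes G: "simple_graph V E" "card V \<ge> 2"
    and S: "S \<noteq> {}" "S \<subset> V" "card (cut_edges E S) = edge_connectivity V E"
    and nontrivial: "\<And>v. v \<in> V \<Longrightarrow> edge_connectivity V E < card (nbhd E v)"
    and v: "v \<in> V"
  shows "2 * crossing E S v \<le> card (nbhd E v)"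
proof -
  have fin: "finite V" using G by (simp add: simple_graph_def)
  have id: "2 * crossing E S v + card (cut_edges E (S \<union> {v})) + card (cut_edges E (S - {v}))
       = 2 * card (cut_edges E S) + card (cut_edges E ({v} - S)) + card (cut_edges E ({v} \<inter> S))"
    using sum_crossing_eq_cuts[OF G(1), of "{v}" S] by simp
  have empty: "card (cut_edges E {}) = 0" by (simp add: cut_edges_def)
  show ?thesis
  proof (cases "v \<in> S")
    case True
    have "S \<noteq> {v}" using S(3) nontrivial[OF v] card_nbhd[OF G(1), of v] by auto
    then have "edge_connectivity V E \<le> card (cut_edges E (S - {v}))"
      using S True fin by (intro edge_connectivity_le) auto
    then show ?thesis using id True S(3) empty
      by (simp add: insert_absorb card_nbhd[OF G(1)] Int_absorb2)
  next
    case False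
    have "insert v S \<noteq> V"
    proof
      assume "insert v S = V"
      then have "V - S = {v}" using False by auto
      then have "card (cut_edges E S) = crossing E S v"
        using card_cut_edges_outside[OF G(1), of S] S(2) by auto
      also have "{u \<in> nbhd E v. (u \<in> S) \<noteq> (v \<in> S)} = nbhd E v"
        using nbhd_subset[OF G(1), of v] \<open>insert v S = V\<close> False by auto
      then have "crossing E S v = card (nbhd E v)" by (simp add: crossing_eq_card_nbhd[OF G(1)])
      finally show False using nontrivial[OF v] S(3) by simp
    qed
    then have "edge_connectivity V E \<le> card (cut_edges E (insert v S))"
      using S v fin by (intro edge_connectivity_le) auto
    moreover have "{v} - S = {v}" using False by auto
    ultimately show ?thesis using id False S(3) empty by (simp add: card_nbhd[OF G(1)])
  qed
qed

text \<open>The fibres of \<open>\<rho>\<close> over \<open>S\<close> partition \<open>S\<close>, so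
  the edges from an outside vertex \<open>w\<close> into \<open>S\<close> are sorted by the fibre of
  their other end. The image \<open>\<rho> v\<close> is only an index and need not lie in its own
  fibre.\<close>

lemma card_cut_edges_parts:
  assumes G: "simple_graph V E" and S: "S \<subseteq> V" and resp: "\<And>v. v \<in> V \<Longrightarrow> \<rho> v \<in> S \<longleftrightarrow> v \<in> S"
  shows "card (cut_edges E S) = (\<Sum>w\<in>V - S. \<Sum>r\<in>S. crossing E {v \<in> V. \<rho> v = r} w)"
  unfolding card_cut_edges_outside[OF G S]
proof (rule sum.cong[OF refl])
  fix w assume w: "w \<in> V - S"
  have fin: "finite S" using G S by (auto simp: simple_graph_def intro: finite_subset)
  have nb: "nbhd E w \<subseteq> V" using nbhd_subset[OF G] by auto
  have "crossing E {v \<in> V. \<rho> v = r} w = card {u \<in> nbhd E w. \<rho> u = r}" if "r \<in> S" for r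
  proof -
    have "\<rho> w \<noteq> r" using w that resp[of w] by auto
    then have "{u \<in> nbhd E w. (u \<in> {v \<in> V. \<rho> v = r}) \<noteq> (w \<in> {v \<in> V. \<rho> v = r})} = {u \<in> nbhd E w. \<rho> u = r}"
      using nb by auto
    then show ?thesis by (simp add: crossing_eq_card_nbhd[OF G])
  qed
  then have "(\<Sum>r\<in>S. crossing E {v \<in> V. \<rho> v = r} w) = (\<Sum>r\<in>S. card {u \<in> nbhd E w. \<rho> u = r})"
    by simp
  also have "\<dots> = card (\<Union>r\<in>S. {u \<in> nbhd E w. \<rho> u = r})"
    using fin finite_nbhd[OF G] by (intro card_UN_disjoint[symmetric]) auto
  also have "(\<Union>r\<in>S. {u \<in> nbhd E w. \<rho> u = r}) = {u \<in> nbhd E w. (u \<in> S) \<noteq> (w \<in> S)}"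
    using w resp nb by auto
  finally show "crossing E S w = (\<Sum>r\<in>S. crossing E {v \<in> V. \<rho> v = r} w)"
    by (simp add: crossing_eq_card_nbhd[OF G])
qed

section \<open>Crossing numbers from cut queries\<close>

lemma prod_sign_eq: "finite I \<Longrightarrow> (\<Prod>v\<in>I. if v \<in> J then -1 else (1 :: complex)) = (-1) ^ card (I \<inter> J)"
  by (simp add: prod.If_cases)

text \<open>Orthogonality of the characters of the group of subsets under symmetric difference: the
  sum factors over the vertices, and a vertex in exactly one of \<open>J\<close> and
  \<open>K\<close> contributes \<open>1 - 1 = 0\<close>.\<close>

lemma sum_signs_Pow:
  assumes "finite V" "J \<subseteq> V" "K \<subseteq> V"
  shows "(\<Sum>I\<in>Pow V. (-1) ^ card (I \<inter> J) * (-1) ^ card (I \<inter> K)) = (if J = K then 2 ^ card V else (0 :: complex))"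
proof -
  define e where "e v = (if v \<in> J then -1 else 1) * (if v \<in> K then -1 else (1 :: complex))" for v
  have "(\<Sum>I\<in>Pow V. (-1) ^ card (I \<inter> J) * (-1) ^ card (I \<inter> K)) = (\<Sum>I\<in>Pow V. (\<Prod>v\<in>I. e v) * (\<Prod>v\<in>V - I. 1))"
    using assms(1) by (intro sum.cong refl) (auto simp: e_def prod.distrib prod_sign_eq finite_subset)
  also have "\<dots> = (\<Prod>v\<in>V. e v + 1)"
    using assms(1) by (simp add: prod_add del: prod.neutral_const)
  also have "\<dots> = (if J = K then 2 ^ card V else 0)"
  proof (cases "J = K")
    case True
    then have "e v + 1 = 2" for v by (simp add: e_def)
    then show ?thesis using True by simp
  next
    case False
    then obtain v where v: "v \<in> V" "(v \<in> J) \<noteq> (v \<in> K)" using assms by blast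
    then have "e v + 1 = 0" by (auto simp: e_def)
    with v(1) show ?thesis using False assms(1) by (auto simp: prod_zero_iff)
  qed
  finally show ?thesis .
qed

section \<open>Hadamard transform and hidden sets\<close>

lemma bij_betw_set_decode: "bij_betw set_decode {..<2 ^ n} (Pow {..<n})"
proof (rule bij_betw_byWitness[of _ set_encode])
  show "\<forall>S\<in>Pow {..<n}. set_decode (set_encode S) = S"
    using finite_subset[OF _ finite_lessThan] by (metis PowD set_encode_inverse)
qed (auto simp: set_encode_less dest: set_decode_subset[THEN subsetD])

text \<open>The Hadamard transform of \<open>n\<close> qubits; the label \<open>l\<close> stands for the set \<open>set_decode l\<close>.\<close>

definition hadamard :: "nat \<Rightarrow> (nat \<Rightarrow> complex) \<Rightarrow> nat \<Rightarrow> complex" where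
  "hadamard n = lin_op {..<2 ^ n} (\<lambda>i j. (-1) ^ card (set_decode i \<inter> set_decode j) / sqrt (2 ^ n))"

lemma sqrt_power_square: "complex_of_real (sqrt (2 ^ n)) * complex_of_real (sqrt (2 ^ n)) = 2 ^ n"
  by (simp flip: of_real_mult)

lemma sum_set_decode:
  "(\<Sum>i<2 ^ n. h (set_decode i)) = (\<Sum>I\<in>Pow {..<n}. h I)" for h :: "nat set \<Rightarrow> 'a :: comm_monoid_add"
  by (rule sum.reindex_bij_betw[OF bij_betw_set_decode])

lemma unitary_op_hadamard: "unitary_op {..<2 ^ n} (hadamard n)"
proof -
  let ?u = "\<lambda>i j. (-1) ^ card (set_decode i \<inter> set_decode j) / complex_of_real (sqrt (2 ^ n))"
  have "isometric {..<2 ^ n} ?u"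
    unfolding isometric_def
  proof (intro ballI)
    fix j k :: nat assume jk: "j \<in> {..<2 ^ n}" "k \<in> {..<2 ^ n}"
    have "(\<Sum>i<2 ^ n. cnj (?u i j) * ?u i k)
        = (\<Sum>i<2 ^ n. (-1) ^ card (set_decode i \<inter> set_decode j) * (-1) ^ card (set_decode i \<inter> set_decode k)) / 2 ^ n"
      by (simp add: sqrt_power_square sum_divide_distrib)
    also have "\<dots> = of_bool (set_decode j = set_decode k)"
      using jk set_decode_subset
      by (subst sum_set_decode) (simp add: sum_signs_Pow)
    also have "\<dots> = of_bool (j = k)" by (auto dest: arg_cong[where f = set_encode])
    finally show "(\<Sum>i<2 ^ n. cnj (?u i j) * ?u i k) = of_bool (j = k)" .
  qed
  then show ?thesis unfolding unitary_op_def by (intro exI[of _ ?u]) (simp add: hadamard_def)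
qed

lemma hadamard_apply: "i < 2 ^ n \<Longrightarrow>
    hadamard n \<psi> i = (\<Sum>j<2 ^ n. (-1) ^ card (set_decode i \<inter> set_decode j) / complex_of_real (sqrt (2 ^ n)) * \<psi> j)"
  by (simp add: hadamard_def lin_op_def)

lemma phase_reachable_queries:
  assumes "phase_reachable n A t \<Psi>"
    and "\<And>p h l. (p, h) \<in> set qs \<Longrightarrow> p l \<subseteq> {..<n}" "\<And>p h l b. (p, h) \<in> set qs \<Longrightarrow> cmod (h l b) = 1"
  shows "phase_reachable n A (t + length qs) (\<lambda>f l. (\<Prod>(p, h)\<leftarrow>qs. h l (f (p l))) * \<Psi> f l)"
  using assms(2,3)
proof (induction qs)
  case Nil
  then show ?case using assms(1) by simp
next
  case (Cons q qs)
  obtain p h where q: "q = (p, h)" by force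
  have "phase_reachable n A (t + length qs) (\<lambda>f l. (\<Prod>(p, h)\<leftarrow>qs. h l (f (p l))) * \<Psi> f l)"
    using Cons by (meson list.set_intros(2))
  from phase_reachable_query[OF this, of p h] Cons.prems[of p h] show ?case
    by (simp add: q mult.assoc)
qed

text \<open>Bernstein and Vazirani: a hidden set is read off a sign pattern.\<close>

lemma q_samples_hidden_set:
  fixes qs :: "((nat set \<Rightarrow> nat set) \<times> (nat set \<Rightarrow> nat \<Rightarrow> complex)) list"
  assumes p: "\<And>p h T. (p, h) \<in> set qs \<Longrightarrow> T \<subseteq> {..<n} \<Longrightarrow> p T \<subseteq> {..<n}"
    and h: "\<And>p h T b. (p, h) \<in> set qs \<Longrightarrow> cmod (h T b) = 1"
    and W: "\<And>f. f \<in> \<F> \<Longrightarrow> W f \<subseteq> {..<n}"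
    and sign: "\<And>f T. f \<in> \<F> \<Longrightarrow> T \<subseteq> {..<n} \<Longrightarrow>
       (\<Prod>(p, h)\<leftarrow>qs. h T (f (p T))) = (-1) ^ card (T \<inter> W f)"
  shows "q_samples n \<F> (length qs) (\<lambda>f. return_pmf (W f))"
proof -
  \<comment> \<open>Labels from \<open>2 ^ n\<close> on do not code subsets of
    \<open>{..<n}\<close>; the intersection keeps their queries legal.\<close>
  define qs' where "qs' = map (\<lambda>(p, h). (\<lambda>l. p (set_decode l \<inter> {..<n}), \<lambda>l. h (set_decode l))) qs"
  define \<Psi> where "\<Psi> = (\<lambda>f. hadamard n (\<lambda>l. (\<Prod>(p, h)\<leftarrow>qs'. h l (f (p l))) * hadamard n (\<lambda>l. of_bool (l = 0)) l))"
  have init: "phase_reachable n {..<2 ^ n} 0 (\<lambda>f. hadamard n (\<lambda>l. of_bool (l = 0)))"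
    by (rule phase_reachable_gate[OF phase_reachable_init unitary_op_hadamard]) auto
  have subset: "p' l \<subseteq> {..<n}" if q: "(p', h') \<in> set qs'" for p' h' l
  proof -
    obtain p0 h0 where "(p0, h0) \<in> set qs" "p' = (\<lambda>l. p0 (set_decode l \<inter> {..<n}))"
      using q by (auto simp: qs'_def)
    then show ?thesis using p[of p0 h0 "set_decode l \<inter> {..<n}"] by simp
  qed
  have "phase_reachable n {..<2 ^ n} (0 + length qs')
     (\<lambda>f l. (\<Prod>(p, h)\<leftarrow>qs'. h l (f (p l))) * hadamard n (\<lambda>l. of_bool (l = 0)) l)"
    by (rule phase_reachable_queries[OF init]) (use subset h in \<open>auto simp: qs'_def\<close>)
  then have "phase_reachable n {..<2 ^ n} (0 + length qs') \<Psi>"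
    unfolding \<Psi>_def by (rule phase_reachable_gate[OF _ unitary_op_hadamard])
  then have reach: "phase_reachable n {..<2 ^ n} (length qs) \<Psi>" by (simp add: qs'_def)
  have uniform: "hadamard n (\<lambda>l. of_bool (l = 0)) l = 1 / complex_of_real (sqrt (2 ^ n))" if "l < 2 ^ n" for l
  proof -
    have "hadamard n (\<lambda>l. of_bool (l = 0)) l = (\<Sum>j<(2 :: nat) ^ n. if j = 0 then 1 / complex_of_real (sqrt (2 ^ n)) else 0)"
      unfolding hadamard_apply[OF that] by (rule sum.cong[OF refl]) auto
    then show ?thesis by simp
  qed
  have amp: "\<Psi> f i = of_bool (set_decode i = W f)" if f: "f \<in> \<F>" and i: "i < 2 ^ n" for f i
  proof -
    have "\<Psi> f i = (\<Sum>j<2 ^ n. (-1) ^ card (set_decode j \<inter> set_decode i) * (-1) ^ card (set_decode j \<inter> W f) / 2 ^ n)"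
    proof -
      have prod: "(\<Prod>(p, h)\<leftarrow>qs'. h j (f (p j))) = (-1) ^ card (set_decode j \<inter> W f)" if "j < 2 ^ n" for j
        using sign[OF f set_decode_subset[OF that]] set_decode_subset[OF that]
        by (simp add: qs'_def comp_def case_prod_unfold Int_absorb2)
      show ?thesis
        unfolding \<Psi>_def hadamard_apply[OF i]
      proof (rule sum.cong[OF refl])
        fix j assume "j \<in> {..<(2 :: nat) ^ n}"
        then have j: "j < 2 ^ n" by simp
        show "(-1) ^ card (set_decode i \<inter> set_decode j) / complex_of_real (sqrt (2 ^ n))
            * ((\<Prod>(p, h)\<leftarrow>qs'. h j (f (p j))) * hadamard n (\<lambda>l. of_bool (l = 0)) j)
          = (-1) ^ card (set_decode j \<inter> set_decode i) * (-1) ^ card (set_decode j \<inter> W f) / 2 ^ n"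
          unfolding prod[OF j] uniform[OF j] by (simp add: sqrt_power_square Int_commute)
      qed
    qed
    also have "\<dots> = (\<Sum>I\<in>Pow {..<n}. (-1) ^ card (I \<inter> set_decode i) * (-1) ^ card (I \<inter> W f)) / 2 ^ n"
      by (subst sum_set_decode[symmetric]) (simp add: sum_divide_distrib)
    also have "\<dots> = of_bool (set_decode i = W f)"
      using W[OF f] set_decode_subset[OF i] by (simp add: sum_signs_Pow)
    finally show ?thesis .
  qed
  show ?thesis
  proof (rule q_samplesI[OF reach, where out = set_decode])
    fix f v assume f: "f \<in> \<F>"
    have "(\<Sum>l | l \<in> {..<2 ^ n} \<and> set_decode l = v. (cmod (\<Psi> f l))\<^sup>2)
       = (\<Sum>l<2 ^ n. if set_decode l = v then (if set_decode l = W f then 1 else 0) else 0)"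
      by (subst sum.inter_filter[symmetric]) (auto simp: amp[OF f] intro!: sum.cong)
    also have "\<dots> = (\<Sum>I\<in>Pow {..<n}. if I = v then (if I = W f then 1 else 0) else (0 :: real))"
      by (rule sum_set_decode)
    also have "\<dots> = pmf (return_pmf (W f)) v" using W[OF f] by (auto simp: indicator_def)
    finally show "pmf (return_pmf (W f)) v = (\<Sum>l | l \<in> {..<2 ^ n} \<and> set_decode l = v. (cmod (\<Psi> f l))\<^sup>2)" by simp
  qed
qed

text \<open>The case \<open>T = {v}\<close> of the identity for sums of crossing numbers, solved for the crossing number.\<close>

definition cut_crossing :: "('v set \<Rightarrow> nat) \<Rightarrow> 'v set \<Rightarrow> 'v \<Rightarrow> nat" where
  "cut_crossing f X v = (2 * f X + f ({v} - X) + f ({v} \<inter> X) - (f (X \<union> {v}) + f (X - {v}))) div 2"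

definition cut_functions :: "nat \<Rightarrow> (nat set \<Rightarrow> nat) set" where
  "cut_functions n = {\<lambda>S. card (cut_edges E S) | E. simple_graph {..<n} E}"

lemma cut_crossing_eq: "simple_graph V E \<Longrightarrow> cut_crossing (\<lambda>S. card (cut_edges E S)) X = crossing E X"
proof
  fix v assume G: "simple_graph V E"
  let ?f = "\<lambda>S. card (cut_edges E S)"
  have "2 * ?f X + ?f ({v} - X) + ?f ({v} \<inter> X) - (?f (X \<union> {v}) + ?f (X - {v})) = 2 * crossing E X v"
    using sum_crossing_eq_cuts[OF G, of "{v}" X] by simp
  then show "cut_crossing ?f X v = crossing E X v" by (simp only: cut_crossing_def)
qed

lemma cut_functionsE:
  assumes "f \<in> cut_functions n"
  obtains E where "simple_graph {..<n} E" "f = (\<lambda>S. card (cut_edges E S))" "\<And>X. cut_crossing f X = crossing E X"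
  using assms unfolding cut_functions_def by (auto simp: cut_crossing_eq)

lemma sum_cut_crossing:
  assumes "f \<in> cut_functions n" "T \<subseteq> {..<n}"
  shows "2 * (\<Sum>v\<in>T. cut_crossing f X v) + f (X \<union> T) + f (X - T) = 2 * f X + f (T - X) + f (T \<inter> X)"
  using assms(1)
proof (rule cut_functionsE)
  fix E assume *: "simple_graph {..<n} E" "f = (\<lambda>S. card (cut_edges E S))" "\<And>X. cut_crossing f X = crossing E X"
  show ?thesis
    unfolding *(3) using sum_crossing_eq_cuts[OF *(1), of T X] finite_subset[OF assms(2)] by (simp add: *(2))
qed

lemma cut_crossing_less: "f \<in> cut_functions n \<Longrightarrow> v < n \<Longrightarrow> cut_crossing f X v < n"
  by (erule cut_functionsE) (metis card_lessThan crossing_less lessThan_iff)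

lemma cut_crossing_outside: "f \<in> cut_functions n \<Longrightarrow> \<not> v < n \<Longrightarrow> cut_crossing f X v = 0"
  by (erule cut_functionsE) (metis crossing_outside lessThan_iff)

section \<open>Crossing numbers bit by bit\<close>

lemma cis_pi_nat: "cis (pi * real k) = (-1) ^ k"
proof -
  have "cis (pi * real k) = cis (real k * pi)" by (simp only: mult.commute)
  also have "\<dots> = cis pi ^ k" by (rule Complex.DeMoivre[symmetric])
  finally show ?thesis by simp
qed

text \<open>The five cuts of the identity for sums of crossing numbers enter the phase with weights
  that are multiples of \<open>\<theta> = pi / 2 ^ (j + 1)\<close> and add up to
  \<open>pi / 2 ^ j\<close> times the sum over \<open>T\<close>. After subtraction of the known
  lower bits \<open>w\<close> only multiples of \<open>pi\<close> remain, and their parity is that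
  of the number of vertices of \<open>T\<close> with bit \<open>j\<close> set.\<close>

lemma q_samples_crossing_bit:
  assumes X: "X \<subseteq> {..<n}" and \<F>: "\<F> \<subseteq> cut_functions n"
    and w: "\<And>f v. f \<in> \<F> \<Longrightarrow> w v = cut_crossing f X v mod 2 ^ j"
  shows "q_samples n \<F> 5 (\<lambda>f. return_pmf {v \<in> {..<n}. odd (cut_crossing f X v div 2 ^ j)})"
proof -
  define \<theta> where "\<theta> = pi / 2 ^ Suc j"
  define qs where "qs =
    [(\<lambda>T. X, \<lambda>T b. cis (2 * \<theta> * b - 2 * \<theta> * (\<Sum>v\<in>T. w v))), (\<lambda>T. T - X, \<lambda>T b. cis (\<theta> * b)),
     (\<lambda>T. T \<inter> X, \<lambda>T b. cis (\<theta> * b)), (\<lambda>T. X \<union> T, \<lambda>T b. cis (- \<theta> * b)),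
     (\<lambda>T. X - T, \<lambda>T (b :: nat). cis (- \<theta> * b))]"
  have "q_samples n \<F> (length qs) (\<lambda>f. return_pmf {v \<in> {..<n}. odd (cut_crossing f X v div 2 ^ j)})"
  proof (rule q_samples_hidden_set)
    fix f T assume f: "f \<in> \<F>" and T: "T \<subseteq> {..<n}"
    then have "finite T" by (auto intro: finite_subset)
    let ?c = "\<lambda>v. cut_crossing f X v div 2 ^ j"
    have "real (2 * (\<Sum>v\<in>T. cut_crossing f X v) + f (X \<union> T) + f (X - T)) = real (2 * f X + f (T - X) + f (T \<inter> X))"
      using sum_cut_crossing[of f n T X] f T \<F> by (metis subsetD)
    then have id: "2 * (\<Sum>v\<in>T. real (cut_crossing f X v)) = 2 * real (f X) + f (T - X) + f (T \<inter> X) - f (X \<union> T) - f (X - T)"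
      by simp
    have split: "real (cut_crossing f X v) - real (w v) = 2 ^ j * real (?c v)" for v
      using w[OF f] of_nat_mult[of "2 ^ j" "?c v", where ?'a = real]
      by (metis add_diff_cancel_right' div_mult_mod_eq mult.commute of_nat_add of_nat_power of_nat_numeral)
    have "(\<Prod>(p, h)\<leftarrow>qs. h T (f (p T)))
        = cis (\<theta> * (2 * real (f X) + f (T - X) + f (T \<inter> X) - f (X \<union> T) - f (X - T)) - 2 * \<theta> * (\<Sum>v\<in>T. w v))"
      by (simp add: qs_def cis_mult algebra_simps)
    also have "\<dots> = cis (2 * \<theta> * (\<Sum>v\<in>T. real (cut_crossing f X v) - real (w v)))"
      unfolding id[symmetric] by (simp add: algebra_simps sum_subtractf)
    also have "\<dots> = cis (pi * real (\<Sum>v\<in>T. ?c v))"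
      by (simp add: split \<theta>_def flip: sum_distrib_left)
    also have "\<dots> = (\<Prod>v\<in>T. (-1) ^ ?c v)" by (simp only: cis_pi_nat power_sum)
    also have "\<dots> = (\<Prod>v\<in>T. if v \<in> {v \<in> {..<n}. odd (?c v)} then -1 else 1)"
      using T by (intro prod.cong) auto
    also have "\<dots> = (-1) ^ card (T \<inter> {v \<in> {..<n}. odd (?c v)})"
      by (rule prod_sign_eq[OF \<open>finite T\<close>])
    finally show "(\<Prod>(p, h)\<leftarrow>qs. h T (f (p T))) = (-1) ^ card (T \<inter> {v \<in> {..<n}. odd (?c v)})" .
  qed (use X in \<open>auto simp: qs_def\<close>)
  moreover have "length qs = 5" by (simp add: qs_def)
  ultimately show ?thesis by (simp only:)
qed

text \<open>Bits are found from the lowest upwards; the promise of \<open>q_samples_bind\<close>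
  provides the lower bits as a common function \<open>w\<close>.\<close>

lemma q_samples_crossing_mod:
  assumes X: "X \<subseteq> {..<n}"
  shows "q_samples n (cut_functions n) (5 * j) (\<lambda>f. return_pmf (\<lambda>v. cut_crossing f X v mod 2 ^ j))"
proof (induction j)
  case 0
  then show ?case using q_samples_return[of n _ 0 "\<lambda>_. 0"] by simp
next
  case (Suc j)
  have "q_samples n (cut_functions n) (5 * j + 5) (\<lambda>f. bind_pmf (return_pmf (\<lambda>v. cut_crossing f X v mod 2 ^ j))
     (\<lambda>w. map_pmf (\<lambda>B v. w v + 2 ^ j * of_bool (v \<in> B)) (return_pmf {v \<in> {..<n}. odd (cut_crossing f X v div 2 ^ j)})))"
    by (intro q_samples_bind Suc q_samples_map q_samples_crossing_bit X) auto
  then show ?case unfolding mult_Suc_right add.commute[of 5]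
  proof (rule q_samples_cong, intro conjI)
    fix f assume f: "f \<in> cut_functions n"
    have "cut_crossing f X v mod 2 ^ j + 2 ^ j * of_bool (v < n \<and> odd (cut_crossing f X v div 2 ^ j))
       = cut_crossing f X v mod 2 ^ Suc j" for v
      using cut_crossing_outside[OF f, of v X] mod_mult2_eq[of "cut_crossing f X v" "2 ^ j" 2]
      by (cases "v < n") (auto simp: odd_iff_mod_2_eq_one mult.commute)
    then show "bind_pmf (return_pmf (\<lambda>v. cut_crossing f X v mod 2 ^ j))
     (\<lambda>w. map_pmf (\<lambda>B v. w v + 2 ^ j * of_bool (v \<in> B)) (return_pmf {v \<in> {..<n}. odd (cut_crossing f X v div 2 ^ j)}))
     = return_pmf (\<lambda>v. cut_crossing f X v mod 2 ^ Suc j)" by (simp add: bind_return_pmf)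
  qed
qed

lemma q_samples_crossing:
  assumes X: "X \<subseteq> {..<n}" and j: "n \<le> 2 ^ j"
  shows "q_samples n (cut_functions n) (5 * j) (\<lambda>f. return_pmf (cut_crossing f X))"
proof (rule q_samples_cong[OF q_samples_crossing_mod[OF X]], intro conjI)
  fix f assume f: "f \<in> cut_functions n"
  have "cut_crossing f X v mod 2 ^ j = cut_crossing f X v" for v
    using cut_crossing_less[OF f, of v X] cut_crossing_outside[OF f, of v X] j by (cases "v < n") auto
  then show "return_pmf (\<lambda>v. cut_crossing f X v mod 2 ^ j) = return_pmf (cut_crossing f X)" by simp
qed

section \<open>Decision trees over crossing numbers as quantum algorithms\<close>

primrec query_bounded :: "('q, 'a, 'r) decision_tree \<Rightarrow> nat \<Rightarrow> bool" where
  "query_bounded (Output r) k \<longleftrightarrow> True"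
| "query_bounded (Query x nx) k \<longleftrightarrow> k > 0 \<and> (\<forall>a. query_bounded (nx a) (k - 1))"

text \<open>The depth is bounded over all answers, and not just the actual ones, because a quantum
  algorithm has a fixed number of queries. Each level of the tree costs \<open>5 * j\<close> phase
  queries.\<close>

lemma q_samples_tree:
  assumes "admissible (Pow {..<n}) t" "query_bounded t k" "n \<le> 2 ^ j"
  shows "q_samples n (cut_functions n) (5 * j * k) (\<lambda>f. return_pmf (tree_output (cut_crossing f) t))"
  using assms(1,2)
proof (induction t arbitrary: k)
  case (Output r)
  then show ?case by (simp add: q_samples_return)
next
  case (Query x nx)
  obtain k' where k: "k = Suc k'" using Query.prems by (cases k) auto
  have "q_samples n (cut_functions n) (5 * j + 5 * j * k') (\<lambda>f. bind_pmf (return_pmf (cut_crossing f x))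
     (\<lambda>a. return_pmf (tree_output (cut_crossing f) (nx a))))"
  proof (rule q_samples_bind)
    fix a
    have "q_samples n (cut_functions n) (5 * j * k') (\<lambda>f. return_pmf (tree_output (cut_crossing f) (nx a)))"
      using Query.prems by (intro Query.IH) (auto simp: k)
    then show "q_samples n {f \<in> cut_functions n. a \<in> set_pmf (return_pmf (cut_crossing f x))} (5 * j * k')
       (\<lambda>f. return_pmf (tree_output (cut_crossing f) (nx a)))"
      by (rule q_samples_cong) auto
  qed (use Query.prems assms(3) in \<open>auto intro: q_samples_crossing\<close>)
  then show ?case by (simp add: bind_return_pmf k)
qed

lemma q_samples_random_tree:
  assumes "\<And>t. t \<in> set_pmf D \<Longrightarrow> admissible (Pow {..<n}) t \<and> query_bounded t k" "n \<le> 2 ^ j"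
    and "finite (set_pmf D)"
  shows "q_samples n (cut_functions n) (5 * j * k) (\<lambda>f. map_pmf (tree_output (cut_crossing f)) D)"
proof -
  have "q_samples n (cut_functions n) (0 + 5 * j * k)
     (\<lambda>f. bind_pmf D (\<lambda>t. return_pmf (tree_output (cut_crossing f) t)))"
  proof (rule q_samples_bind[OF q_samples_pmf[OF assms(3)]])
    fix t
    show "q_samples n {f \<in> cut_functions n. t \<in> set_pmf D} (5 * j * k) (\<lambda>f. return_pmf (tree_output (cut_crossing f) t))"
    proof (cases "t \<in> set_pmf D")
      case True
      then show ?thesis using q_samples_tree[of n t k j] assms by simp
    next
      case False
      show ?thesis
        by (rule q_samples_cong[OF q_samples_return[of n "{}"]]) (use False in auto)
    qed
  qed
  then show ?thesis by (simp add: map_pmf_def)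
qed

lemma q_samples_finite:
  assumes "q_samples n \<F> t D" "f \<in> \<F>"
  shows "finite (set_pmf (D f))"
proof -
  obtain A \<Psi> out where 1: "phase_reachable n A t \<Psi>"
     "\<And>f v. f \<in> \<F> \<Longrightarrow> pmf (D f) v = (\<Sum>l | l \<in> A \<and> out l = v. (cmod (\<Psi> f l))\<^sup>2)"
    using assms(1) unfolding q_samples_def by blast
  have "a \<in> out ` A" if "a \<in> set_pmf (D f)" for a
  proof (rule ccontr)
    assume "a \<notin> out ` A"
    then have eq: "{l. l \<in> A \<and> out l = a} = {}" by auto
    have "pmf (D f) a = 0" unfolding 1(2)[OF assms(2)] by (simp only: eq sum.empty)
    then show False using that by (simp add: set_pmf_iff)
  qed
  moreover have "finite A" using 1(1) unfolding phase_reachable_def by blast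
  ultimately show ?thesis by (meson finite_imageI finite_subset subsetI)
qed

text \<open>Supplies a distribution for a state whose outcome law is known only through its
  amplitudes, as in Grover search.\<close>

lemma q_samples_measure:
  assumes "phase_reachable n A t \<Psi>"
  obtains D where "q_samples n \<F> t D" "\<And>f l. pmf (D f) l = (cmod (\<Psi> f l))\<^sup>2"
proof -
  define D where "D f = embed_pmf (\<lambda>l. (cmod (\<Psi> f l))\<^sup>2)" for f
  have fin: "finite A" using assms unfolding phase_reachable_def by blast
  have D: "pmf (D f) l = (cmod (\<Psi> f l))\<^sup>2" for f l
    unfolding D_def
  proof (rule pmf_embed_pmf)
    have "(\<integral>\<^sup>+l. ennreal ((cmod (\<Psi> f l))\<^sup>2) \<partial>count_space UNIV) = (\<Sum>l\<in>A. ennreal ((cmod (\<Psi> f l))\<^sup>2))"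
      using fin phase_reachable_outside[OF assms] by (intro nn_integral_count_space') auto
    also have "\<dots> = ennreal (\<Sum>l\<in>A. (cmod (\<Psi> f l))\<^sup>2)" by (simp add: sum_ennreal)
    finally show "(\<integral>\<^sup>+l. ennreal ((cmod (\<Psi> f l))\<^sup>2) \<partial>count_space UNIV) = 1"
      by (simp add: phase_reachable_norm[OF assms])
  qed simp
  have "q_samples n \<F> t D"
  proof (rule q_samplesI[OF assms, where out = "\<lambda>l. l"])
    fix f v
    have "(\<Sum>l | l \<in> A \<and> l = v. (cmod (\<Psi> f l))\<^sup>2) = (\<Sum>l\<in>A. if l = v then (cmod (\<Psi> f l))\<^sup>2 else 0)"
      by (rule sum.inter_filter[OF fin])
    then show "pmf (D f) v = (\<Sum>l | l \<in> A \<and> l = v. (cmod (\<Psi> f l))\<^sup>2)"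
      using fin phase_reachable_outside[OF assms, of v f] by (simp add: D)
  qed
  then show thesis using that D by blast
qed

section \<open>Minimum degree by Grover search\<close>

text \<open>With \<open>sin \<phi> = sqrt (t / n)\<close>, where \<open>t\<close> vertices are marked, \<open>j\<close> iterations of Grover's search
  lead to the amplitudes \<open>sin ((2 j + 1) \<phi>) / sqrt t\<close> and \<open>cos ((2 j + 1) \<phi>) / sqrt (n - t)\<close> on the
  marked and unmarked vertices, up to a common sign.\<close>

definition marked :: "nat \<Rightarrow> (nat set \<Rightarrow> nat) \<Rightarrow> nat \<Rightarrow> nat set" where
  "marked n f b = {v. v < n \<and> f {v} < b}"

definition grover_angle :: "nat \<Rightarrow> (nat set \<Rightarrow> nat) \<Rightarrow> nat \<Rightarrow> real" where
  "grover_angle n f b = arcsin (sqrt (real (card (marked n f b)) / real n))"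

lemma card_marked_le: "card (marked n f b) \<le> n"
  using card_mono[of "{..<n}" "marked n f b"] by (auto simp: marked_def)

lemma grover_angle:
  assumes "n > 0"
  shows "sin (grover_angle n f b) = sqrt (real (card (marked n f b)) / real n)"
    and "(sin (grover_angle n f b))\<^sup>2 = real (card (marked n f b)) / real n"
    and "(cos (grover_angle n f b))\<^sup>2 = real (n - card (marked n f b)) / real n"
    and "cos (grover_angle n f b) \<ge> 0"
proof -
  let ?x = "sqrt (real (card (marked n f b)) / real n)"
  have x: "0 \<le> ?x" "?x \<le> 1" using assms card_marked_le[of n f b] by (auto simp: divide_le_eq)
  show s: "sin (grover_angle n f b) = ?x" using x unfolding grover_angle_def by (intro sin_arcsin) linarith+
  show s2: "(sin (grover_angle n f b))\<^sup>2 = real (card (marked n f b)) / real n" unfolding s by simp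
  show "(cos (grover_angle n f b))\<^sup>2 = real (n - card (marked n f b)) / real n"
    using assms card_marked_le[of n f b] unfolding cos_squared_eq s2 by (simp add: field_simps of_nat_diff)
  show "cos (grover_angle n f b) \<ge> 0"
    using x arcsin_lbound[of ?x] arcsin_ubound[of ?x] unfolding grover_angle_def by (intro cos_ge_zero) linarith+
qed

text \<open>Amplitudes stay constant on the marked and on the unmarked vertices, and each iteration
  rotates this plane by twice the Grover angle. The reflection is the negative of the usual
  diffusion, whence the sign. If one of the two classes is empty, the quotient of its branch divides
  by zero, but that branch is never taken.\<close>

lemma grover_states:
  assumes "n > 0"
  shows "\<exists>\<Psi>. phase_reachable n {..<n} j \<Psi> \<and> (\<forall>f v. v < n \<longrightarrow>
     \<Psi> f v = (-1) ^ j * complex_of_real (if f {v} < b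
        then sin ((2 * real j + 1) * grover_angle n f b) / (sqrt (real n) * sin (grover_angle n f b))
        else cos ((2 * real j + 1) * grover_angle n f b) / (sqrt (real n) * cos (grover_angle n f b))))"
proof (induction j)
  case 0
  have "(\<Sum>i<n. (1 / sqrt (real n))\<^sup>2) = 1" using assms by (simp add: power_divide)
  then obtain F where F: "unitary_op {..<n} F" "\<And>i. i \<in> {..<n} \<Longrightarrow> F (\<lambda>i. of_bool (i = 0)) i = 1 / sqrt (real n)"
    using unitary_op_of_unit_vector[of "{..<n}" 0 "\<lambda>_. 1 / sqrt (real n)"] assms by auto
  show ?case
  proof (intro exI conjI allI impI)
    show "phase_reachable n {..<n} 0 (\<lambda>f. F (\<lambda>l. of_bool (l = 0)))"
      using assms by (intro phase_reachable_gate[OF phase_reachable_init F(1)]) auto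
    fix f :: "nat set \<Rightarrow> nat" and v assume v: "v < n"
    have 1: "sin (grover_angle n f b) \<noteq> 0" if "f {v} < b"
    proof -
      have "v \<in> marked n f b" using v that by (simp add: marked_def)
      then have "card (marked n f b) > 0" by (auto simp: card_gt_0_iff marked_def)
      then show ?thesis unfolding grover_angle(1)[OF assms] using assms by simp
    qed
    have 2: "cos (grover_angle n f b) \<noteq> 0" if "\<not> f {v} < b"
    proof -
      have "marked n f b \<subset> {..<n}" using v that by (auto simp: marked_def)
      then have "card (marked n f b) < n" using psubset_card_mono[of "{..<n}"] by simp
      then have "(cos (grover_angle n f b))\<^sup>2 \<noteq> 0" unfolding grover_angle(3)[OF assms] using assms by simp
      then show ?thesis by simp
    qed
    show "F (\<lambda>l. of_bool (l = 0)) v = (-1) ^ 0 * complex_of_real (if f {v} < b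
        then sin ((2 * real 0 + 1) * grover_angle n f b) / (sqrt (real n) * sin (grover_angle n f b))
        else cos ((2 * real 0 + 1) * grover_angle n f b) / (sqrt (real n) * cos (grover_angle n f b)))"
      using 1 2 v by (simp add: F(2))
  qed
next
  case (Suc j)
  let ?a = "\<lambda>f. sin ((2 * real j + 1) * grover_angle n f b) / (sqrt (real n) * sin (grover_angle n f b))"
  let ?c = "\<lambda>f. cos ((2 * real j + 1) * grover_angle n f b) / (sqrt (real n) * cos (grover_angle n f b))"
  obtain \<Psi> where \<Psi>: "phase_reachable n {..<n} j \<Psi>"
    "\<And>f v. v < n \<Longrightarrow> \<Psi> f v = (-1) ^ j * complex_of_real (if f {v} < b then ?a f else ?c f)"
    using Suc by blast
  have "(\<Sum>i<n. (1 / sqrt (real n))\<^sup>2) = 1" using assms by (simp add: power_divide)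
  note reflection = unitary_op_reflection[OF this finite_lessThan]
  have reach: "phase_reachable n {..<n} (Suc j)
    (\<lambda>f l. (if f (if l < n then {l} else {}) < b then -1 else 1) * \<Psi> f l)"
    by (rule phase_reachable_query[OF \<Psi>(1), of "\<lambda>l. if l < n then {l} else {}" "\<lambda>l x. if x < b then -1 else 1"]) auto
  have reach': "phase_reachable n {..<n} (Suc j)
    (\<lambda>f l. if l \<in> {..<n} then (if f (if l < n then {l} else {}) < b then -1 else 1) * \<Psi> f l
        - 2 * complex_of_real (1 / sqrt (real n)) * (\<Sum>l<n. complex_of_real (1 / sqrt (real n)) * ((if f (if l < n then {l} else {}) < b then -1 else 1) * \<Psi> f l))
        else (if f (if l < n then {l} else {}) < b then -1 else 1) * \<Psi> f l)"
    by (rule phase_reachable_gate[OF reach reflection])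
  show ?case
  proof (intro exI conjI, rule reach', intro allI impI)
    fix f :: "nat set \<Rightarrow> nat" and v assume v: "v < n"
    define \<phi> where "\<phi> = grover_angle n f b"
    define x where "x = (2 * real j + 1) * \<phi>"
    define r where "r = sqrt (real n)"
    have r: "r > 0" "r * r = real n" using assms by (auto simp: r_def)
    define a where "a = sin x / (r * sin \<phi>)"
    define c where "c = cos x / (r * cos \<phi>)"
    have t: "real (card (marked n f b)) = r * r * (sin \<phi>)\<^sup>2" "real (n - card (marked n f b)) = r * r * (cos \<phi>)\<^sup>2"
      using grover_angle[OF assms, of f b] assms by (simp_all add: \<phi>_def r)
    have "(\<Sum>l<n. (if f {l} < b then - a else c)) = (\<Sum>l\<in>marked n f b. - a) + (\<Sum>l\<in>{..<n} - marked n f b. c)"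
      by (subst sum.subset_diff[of "marked n f b"]) (auto simp: marked_def intro!: sum.cong arg_cong2[where f = "(+)"])
    also have "\<dots> = - (real (card (marked n f b)) * a) + real (n - card (marked n f b)) * c"
      by (subst sum_constant, subst sum_constant, subst card_Diff_subset) (auto simp: marked_def)
    also have "\<dots> = r * (cos x * cos \<phi> - sin x * sin \<phi>)"
      unfolding t a_def c_def using r(1) by (simp add: power2_eq_square field_simps)
    also have "\<dots> = r * cos (x + \<phi>)" by (simp add: cos_add)
    finally have sum: "(\<Sum>l<n. (if f {l} < b then - a else c)) = r * cos (x + \<phi>)" .
    have \<Psi>': "(if f (if l < n then {l} else {}) < b then -1 else 1) * \<Psi> f l
       = (-1) ^ j * complex_of_real (if f {l} < b then - a else c)" if "l < n" for l
      using \<Psi>(2)[OF that, of f] that by (simp add: a_def c_def x_def \<phi>_def r_def)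
    have "(\<Sum>l<n. complex_of_real (1 / r) * ((if f (if l < n then {l} else {}) < b then -1 else 1) * \<Psi> f l))
       = (\<Sum>l<n. (-1) ^ j * complex_of_real (1 / r * (if f {l} < b then - a else c)))"
    proof (rule sum.cong[OF refl])
      fix l assume "l \<in> {..<n}"
      then have l: "l < n" by simp
      show "complex_of_real (1 / r) * ((if f (if l < n then {l} else {}) < b then -1 else 1) * \<Psi> f l)
        = (-1) ^ j * complex_of_real (1 / r * (if f {l} < b then - a else c))"
        unfolding \<Psi>'[OF l] by simp
    qed
    also have "\<dots> = (-1) ^ j * complex_of_real (1 / r * (\<Sum>l<n. (if f {l} < b then - a else c)))"
      by (simp only: sum_distrib_left[symmetric] of_real_sum[symmetric])
    also have "\<dots> = (-1) ^ j * complex_of_real (cos (x + \<phi>))" unfolding sum using r by simp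
    finally have mean: "(\<Sum>l<n. complex_of_real (1 / r) * ((if f (if l < n then {l} else {}) < b then -1 else 1) * \<Psi> f l))
       = (-1) ^ j * complex_of_real (cos (x + \<phi>))" .
    have next_x: "(2 * real (Suc j) + 1) * \<phi> = x + 2 * \<phi>" by (simp add: x_def algebra_simps)
    have step: "(if f {v} < b then - a else c) - 2 / r * cos (x + \<phi>)
      = - (if f {v} < b then sin (x + 2 * \<phi>) / (r * sin \<phi>) else cos (x + 2 * \<phi>) / (r * cos \<phi>))"
    proof (cases "f {v} < b")
      case True
      then have "v \<in> marked n f b" using v by (simp add: marked_def)
      then have "card (marked n f b) > 0" by (auto simp: card_gt_0_iff marked_def)
      then have s: "sin \<phi> \<noteq> 0" using t(1) by auto
      have "sin ((x + \<phi>) + \<phi>) - sin ((x + \<phi>) - \<phi>) = 2 * sin \<phi> * cos (x + \<phi>)"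
        unfolding sin_add[of "x + \<phi>"] sin_diff[of "x + \<phi>"] by simp
      moreover have "(x + \<phi>) + \<phi> = x + 2 * \<phi>" "(x + \<phi>) - \<phi> = x" by simp_all
      ultimately have "sin (x + 2 * \<phi>) = sin x + 2 * sin \<phi> * cos (x + \<phi>)" by simp
      then show ?thesis using True s r by (simp add: a_def field_simps)
    next
      case False
      then have "marked n f b \<subset> {..<n}" using v by (auto simp: marked_def)
      then have "card (marked n f b) < n" using psubset_card_mono[of "{..<n}"] by simp
      then have s: "cos \<phi> \<noteq> 0" using t(2) by auto
      have "cos ((x + \<phi>) + \<phi>) + cos ((x + \<phi>) - \<phi>) = 2 * cos \<phi> * cos (x + \<phi>)"
        unfolding cos_add[of "x + \<phi>"] cos_diff[of "x + \<phi>"] by simp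
      moreover have "(x + \<phi>) + \<phi> = x + 2 * \<phi>" "(x + \<phi>) - \<phi> = x" by simp_all
      ultimately have e: "cos (x + 2 * \<phi>) = - cos x + 2 * cos \<phi> * cos (x + \<phi>)" by simp
      show ?thesis using False s r(1) by (simp add: c_def e add_divide_distrib diff_divide_distrib)
    qed
    have "(if v \<in> {..<n} then (if f (if v < n then {v} else {}) < b then -1 else 1) * \<Psi> f v
        - 2 * complex_of_real (1 / r) * (\<Sum>l<n. complex_of_real (1 / r) * ((if f (if l < n then {l} else {}) < b then -1 else 1) * \<Psi> f l))
        else (if f (if v < n then {v} else {}) < b then -1 else 1) * \<Psi> f v)
      = (-1) ^ j * complex_of_real ((if f {v} < b then - a else c) - 2 / r * cos (x + \<phi>))"
      unfolding mean \<Psi>'[OF v] using v by (simp add: algebra_simps)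
    then show "(if v \<in> {..<n} then (if f (if v < n then {v} else {}) < b then -1 else 1) * \<Psi> f v
        - 2 * complex_of_real (1 / sqrt (real n)) * (\<Sum>l<n. complex_of_real (1 / sqrt (real n)) * ((if f (if l < n then {l} else {}) < b then -1 else 1) * \<Psi> f l))
        else (if f (if v < n then {v} else {}) < b then -1 else 1) * \<Psi> f v)
      = (-1) ^ Suc j * complex_of_real (if f {v} < b
        then sin ((2 * real (Suc j) + 1) * grover_angle n f b) / (sqrt (real n) * sin (grover_angle n f b))
        else cos ((2 * real (Suc j) + 1) * grover_angle n f b) / (sqrt (real n) * cos (grover_angle n f b)))"
      unfolding step r_def[symmetric] \<phi>_def[symmetric] next_x by simp
  qed
qed

text \<open>Telescopes by \<open>sin (2 x + 2 \<phi>) - sin (2 x - 2 \<phi>) = 2 cos (2 x) sin (2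
  \<phi>)\<close>; the factor \<open>sin (2 \<phi>)\<close> is kept on the left to avoid a
  division.\<close>

lemma sum_sin_squares:
  "4 * sin (2 * \<phi>) * (\<Sum>j<J. (sin ((2 * real j + 1) * \<phi>))\<^sup>2) = 2 * real J * sin (2 * \<phi>) - sin (4 * real J * \<phi>)"
proof (induction J)
  case (Suc J)
  define x where "x = (2 * real J + 1) * \<phi>"
  have "sin (2 * x + 2 * \<phi>) - sin (2 * x - 2 * \<phi>) = 2 * cos (2 * x) * sin (2 * \<phi>)"
    unfolding sin_add sin_diff by simp
  moreover have "2 * x + 2 * \<phi> = 4 * real (Suc J) * \<phi>" "2 * x - 2 * \<phi> = 4 * real J * \<phi>"
    by (simp_all add: x_def algebra_simps)
  ultimately have "sin (4 * real (Suc J) * \<phi>) = sin (4 * real J * \<phi>) + 2 * cos (2 * x) * sin (2 * \<phi>)" by simp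
  moreover have "4 * sin (2 * \<phi>) * (sin x)\<^sup>2 = 2 * sin (2 * \<phi>) - 2 * cos (2 * x) * sin (2 * \<phi>)"
    unfolding cos_double_sin by (simp add: algebra_simps)
  moreover have "(\<Sum>j<Suc J. (sin ((2 * real j + 1) * \<phi>))\<^sup>2) = (\<Sum>j<J. (sin ((2 * real j + 1) * \<phi>))\<^sup>2) + (sin x)\<^sup>2"
    by (simp add: x_def)
  ultimately show ?case using Suc by (simp only: distrib_left) (simp add: algebra_simps)
qed simp

text \<open>The number \<open>t\<close> of marked vertices is unknown, so the number of iterations
  is averaged over. For \<open>J * sin (2 \<phi>) \<ge> 1\<close> the oscillating term is at most
  half of the main term; this follows from \<open>n \<le> 4 t (n - t)\<close> and the size of
  \<open>J\<close>. If all vertices are marked, \<open>sin (2 \<phi>)\<close> vanishes, but then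
  every square is 1.\<close>

lemma sum_sin_squares_grover:
  assumes J: "J > 0" "n \<le> J\<^sup>2" and M: "marked n f b \<noteq> {}"
  shows "real J / 4 \<le> (\<Sum>j<J. (sin ((2 * real j + 1) * grover_angle n f b))\<^sup>2)"
proof -
  define t where "t = card (marked n f b)"
  define \<phi> where "\<phi> = grover_angle n f b"
  have t: "0 < t" "t \<le> n"
    using M card_marked_le[of n f b] by (auto simp: t_def card_gt_0_iff marked_def)
  then have n: "n > 0" by simp
  show ?thesis
  proof (cases "t = n")
    case True
    have "\<phi> = pi / 2" using n True by (simp add: \<phi>_def grover_angle_def flip: t_def)
    have "(sin ((2 * real j + 1) * \<phi>))\<^sup>2 = 1" for j
    proof -
      have "cos (2 * ((2 * real j + 1) * \<phi>)) = cos (real (2 * j + 1) * pi)"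
        by (simp add: \<open>\<phi> = pi / 2\<close> algebra_simps)
      also have "\<dots> = -1" by (subst cos_npi) simp
      finally show ?thesis unfolding cos_double_sin by simp
    qed
    then show ?thesis by (simp add: \<phi>_def)
  next
    case False
    then have tn: "t < n" using t by simp
    have "sin \<phi> > 0" using t n by (simp add: \<phi>_def grover_angle(1) flip: t_def)
    moreover have "(cos \<phi>)\<^sup>2 > 0" using tn n by (simp add: \<phi>_def grover_angle(3) flip: t_def)
    then have "cos \<phi> > 0" using grover_angle(4)[OF n, of f b] by (auto simp: \<phi>_def order_less_le)
    ultimately have pos: "sin (2 * \<phi>) > 0" by (simp add: sin_double)
    have "real n \<le> 4 * (real t * real (n - t))"
    proof -
      have "real t * real (n - t) \<ge> real n - 1"
      proof -
        have "0 \<le> (real t - 1) * (real (n - t) - 1)" using t tn by (intro mult_nonneg_nonneg) auto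
        then show ?thesis using tn by (simp add: algebra_simps of_nat_diff)
      qed
      moreover have "real n \<ge> 2" using t tn by simp
      ultimately show ?thesis by linarith
    qed
    moreover have "(sin (2 * \<phi>))\<^sup>2 = 4 * (real t * real (n - t)) / (real n)\<^sup>2"
      unfolding sin_double power_mult_distrib
      using grover_angle(2,3)[OF n, of f b] by (simp add: \<phi>_def t_def power2_eq_square)
    ultimately have "real n / (real n)\<^sup>2 \<le> (sin (2 * \<phi>))\<^sup>2" by (simp add: divide_right_mono)
    then have "1 \<le> real n * (sin (2 * \<phi>))\<^sup>2" using n by (simp add: power2_eq_square field_simps)
    also have "\<dots> \<le> (real J)\<^sup>2 * (sin (2 * \<phi>))\<^sup>2"
      using J(2) by (intro mult_right_mono) (simp_all flip: of_nat_power)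
    finally have "1 \<le> (real J * sin (2 * \<phi>))\<^sup>2" by (simp add: power_mult_distrib)
    then have ge: "1 \<le> real J * sin (2 * \<phi>)" using pos by (intro power2_le_imp_le[of 1]) auto
    have "4 * sin (2 * \<phi>) * (\<Sum>j<J. (sin ((2 * real j + 1) * \<phi>))\<^sup>2) \<ge> 2 * real J * sin (2 * \<phi>) - 1"
      unfolding sum_sin_squares using sin_le_one[of "4 * real J * \<phi>"] by linarith
    then have "4 * sin (2 * \<phi>) * (\<Sum>j<J. (sin ((2 * real j + 1) * \<phi>))\<^sup>2) \<ge> 4 * sin (2 * \<phi>) * (real J / 4)"
      using ge by (simp add: mult.commute[of "sin (2 * \<phi>)" "real J"])
    then show ?thesis using pos by (simp add: \<phi>_def)
  qed
qed

text \<open>Equal probabilities on the marked vertices matter as much as the success probability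
  \<open>p\<close>: a found vertex is a uniformly random marked one.\<close>

lemma grover_search:
  assumes n: "n > 0" and J: "J > 0" "n \<le> J\<^sup>2"
  shows "\<exists>D. q_samples n UNIV J D \<and> (\<forall>f. set_pmf (D f) \<subseteq> {..<n}) \<and> (\<forall>f. marked n f b \<noteq> {} \<longrightarrow> (\<exists>p\<ge>1/4. p \<le> 1 \<and>
     (\<forall>v\<in>marked n f b. pmf (D f) v = p / card (marked n f b))))"
proof -
  have "\<exists>D. q_samples n UNIV j D \<and> (\<forall>f. set_pmf (D f) \<subseteq> {..<n}) \<and> (\<forall>f. \<forall>v\<in>marked n f b. pmf (D f) v =
       (sin ((2 * real j + 1) * grover_angle n f b))\<^sup>2 / card (marked n f b))" for j
  proof -
    obtain \<Psi> where \<Psi>: "phase_reachable n {..<n} j \<Psi>" "\<And>f v. v < n \<Longrightarrow>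
     \<Psi> f v = (-1) ^ j * complex_of_real (if f {v} < b
        then sin ((2 * real j + 1) * grover_angle n f b) / (sqrt (real n) * sin (grover_angle n f b))
        else cos ((2 * real j + 1) * grover_angle n f b) / (sqrt (real n) * cos (grover_angle n f b)))"
      using grover_states[OF n, of j b] by blast
    obtain D where D: "q_samples n UNIV j D" "\<And>f l. pmf (D f) l = (cmod (\<Psi> f l))\<^sup>2"
      using q_samples_measure[OF \<Psi>(1)] by blast
    have "pmf (D f) v = (sin ((2 * real j + 1) * grover_angle n f b))\<^sup>2 / card (marked n f b)"
      if "v \<in> marked n f b" for f v
      using that n \<Psi>(2)[of v f] grover_angle(2)[OF n, of f b]
      by (simp add: D(2) marked_def norm_mult norm_power norm_divide power_divide power_mult_distrib)
    moreover have "set_pmf (D f) \<subseteq> {..<n}" for f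
      using phase_reachable_outside[OF \<Psi>(1)] by (force simp: set_pmf_iff D(2))
    ultimately show ?thesis using D(1) by blast
  qed
  then obtain D where D: "\<And>j. q_samples n UNIV j (D j)" "\<And>j f. set_pmf (D j f) \<subseteq> {..<n}" "\<And>j f v. v \<in> marked n f b \<Longrightarrow>
      pmf (D j f) v = (sin ((2 * real j + 1) * grover_angle n f b))\<^sup>2 / card (marked n f b)" by metis
  define D' where "D' f = bind_pmf (pmf_of_set {..<J}) (\<lambda>j. D j f)" for f
  have "q_samples n UNIV (0 + J) D'"
    unfolding D'_def
  proof (rule q_samples_bind)
    show "q_samples n UNIV 0 (\<lambda>f. pmf_of_set {..<J})" using J(1) by (intro q_samples_pmf) (auto simp: lessThan_empty_iff)
    fix j
    show "q_samples n {f \<in> UNIV. j \<in> set_pmf (pmf_of_set {..<J})} J (D j)"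
    proof (cases "j < J")
      case True
      then show ?thesis by (intro q_samples_cong[OF q_samples_mono[OF D(1)[of j], of J]]) auto
    next
      case False
      then have eq: "{f \<in> UNIV. j \<in> set_pmf (pmf_of_set {..<J})} = ({} :: (nat set \<Rightarrow> nat) set)"
        using J(1) by (subst set_pmf_of_set) auto
      show ?thesis unfolding eq by (rule q_samples_cong[OF q_samples_return[of n "{}" J undefined]]) simp
    qed
  qed
  moreover have "\<exists>p\<ge>1/4. p \<le> 1 \<and> (\<forall>v\<in>marked n f b. pmf (D' f) v = p / card (marked n f b))"
    if M: "marked n f b \<noteq> {}" for f
  proof -
    let ?S = "\<Sum>j<J. (sin ((2 * real j + 1) * grover_angle n f b))\<^sup>2"
    have "?S \<le> (\<Sum>j<J. 1)" by (intro sum_mono) (simp add: abs_square_le_1)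
    then have "?S / J \<le> 1" using J(1) by simp
    moreover have "1 / 4 \<le> ?S / J" using sum_sin_squares_grover[OF J M] J(1) by (simp add: field_simps)
    moreover have "pmf (D' f) v = (?S / J) / card (marked n f b)" if "v \<in> marked n f b" for v
      unfolding D'_def using J(1)
      by (subst pmf_bind_pmf_of_set) (auto simp: D(3)[OF that] sum_divide_distrib[symmetric])
    ultimately show ?thesis by blast
  qed
  moreover have "set_pmf (D' f) \<subseteq> {..<n}" for f using D(2) by (auto simp: D'_def)
  ultimately show ?thesis by auto
qed

section \<open>Minimum finding with decreasing thresholds\<close>

lemma expectation_bind_pmf_finite:
  fixes h :: "'b \<Rightarrow> real"
  assumes "finite (set_pmf p)" "\<And>x. x \<in> set_pmf p \<Longrightarrow> finite (set_pmf (q x))"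
  shows "measure_pmf.expectation (bind_pmf p q) h = measure_pmf.expectation p (\<lambda>x. measure_pmf.expectation (q x) h)"
  by (subst pmf_expectation_bind[OF assms(1)]) (use assms in \<open>auto simp: integral_measure_pmf[OF assms(1)]\<close>)

text \<open>On average, a uniformly random marked vertex halves the number of marked vertices.\<close>

lemma sum_card_marked:
  assumes "finite (marked n f b)"
  shows "2 * (\<Sum>v\<in>marked n f b. card (marked n f (f {v}))) \<le> (card (marked n f b))\<^sup>2"
proof -
  define M where "M = marked n f b"
  \<comment> \<open>\<open>L\<close> and its mirror image are disjoint in
    \<open>M \<times> M\<close>, since at most one of two vertices has the smaller value.\<close>
  define L where "L = {(v, u) \<in> M \<times> M. f {u} < f {v}}"
  have "(\<Sum>v\<in>M. card (marked n f (f {v}))) = (\<Sum>v\<in>M. card {u \<in> M. f {u} < f {v}})"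
    by (intro sum.cong refl arg_cong[where f = card]) (auto simp: M_def marked_def)
  also have "\<dots> = card (Sigma M (\<lambda>v. {u \<in> M. f {u} < f {v}}))"
    using assms by (subst card_SigmaI) (auto simp: M_def)
  also have "Sigma M (\<lambda>v. {u \<in> M. f {u} < f {v}}) = L" by (auto simp: L_def)
  finally have *: "(\<Sum>v\<in>M. card (marked n f (f {v}))) = card L" .
  have fin: "finite (M \<times> M)" using assms by (simp add: M_def)
  have "card L + card (prod.swap ` L) = card (L \<union> prod.swap ` L)"
    using finite_subset[OF _ fin, of L] by (intro card_Un_disjoint[symmetric]) (auto simp: L_def)
  also have "\<dots> \<le> card (M \<times> M)" by (intro card_mono fin) (auto simp: L_def)
  finally have "2 * card L \<le> (card M)\<^sup>2"
    by (simp add: card_image card_cartesian_product power2_eq_square)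
  then show ?thesis by (simp add: * flip: M_def)
qed

text \<open>With probability \<open>p\<close> the outcome is a uniform marked vertex and at least
  halves the count on average; otherwise the minimum with \<open>b\<close> prevents growth. This
  gives the factor \<open>1 - p / 2\<close>, at most \<open>7 / 8\<close>.\<close>

lemma expectation_marked_step:
  assumes fin: "finite (set_pmf D)" and p: "1 / 4 \<le> p" "p \<le> 1"
    and D: "\<And>v. v \<in> marked n f b \<Longrightarrow> pmf D v = p / card (marked n f b)" and M: "marked n f b \<noteq> {}"
  shows "measure_pmf.expectation D (\<lambda>v. real (card (marked n f (min b (f {v})))))
    \<le> 7 / 8 * real (card (marked n f b))"
proof -
  define M where "M = marked n f b"
  have finM: "finite M" by (simp add: M_def marked_def)
  define t where "t = real (card M)"
  have t: "t > 0" using M finM by (simp add: t_def M_def card_gt_0_iff)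
  have MS: "M \<subseteq> set_pmf D" using D p t by (auto simp: set_pmf_iff M_def t_def)
  have sumM: "(\<Sum>v\<in>M. pmf D v) = p" using t by (simp add: D M_def[symmetric] t_def D[folded M_def])
  have "(\<Sum>v\<in>set_pmf D. pmf D v) = 1" by (rule sum_pmf_eq_1[OF fin]) simp
  then have rest: "(\<Sum>v\<in>set_pmf D - M. pmf D v) = 1 - p"
    using sum.subset_diff[OF MS fin, of "pmf D"] sumM by simp
  have le: "real (card (marked n f (min b (f {v})))) \<le> t" for v
    unfolding t_def M_def by (intro of_nat_mono card_mono) (auto simp: marked_def)
  have "measure_pmf.expectation D (\<lambda>v. real (card (marked n f (min b (f {v})))))
      = (\<Sum>v\<in>set_pmf D. pmf D v * real (card (marked n f (min b (f {v})))))"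
    by (subst integral_measure_pmf[OF fin]) auto
  also have "\<dots> = (\<Sum>v\<in>set_pmf D - M. pmf D v * real (card (marked n f (min b (f {v})))))
      + (\<Sum>v\<in>M. pmf D v * real (card (marked n f (min b (f {v})))))"
    by (rule sum.subset_diff[OF MS fin])
  also have "(\<Sum>v\<in>set_pmf D - M. pmf D v * real (card (marked n f (min b (f {v}))))) \<le> (\<Sum>v\<in>set_pmf D - M. pmf D v * t)"
    by (intro sum_mono mult_left_mono le) auto
  also have "\<dots> = (1 - p) * t" by (simp add: rest flip: sum_distrib_right)
  also have "(\<Sum>v\<in>M. pmf D v * real (card (marked n f (min b (f {v}))))) = (\<Sum>v\<in>M. p / t * real (card (marked n f (f {v}))))"
    by (intro sum.cong refl) (auto simp: D M_def t_def marked_def min_def)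
  also have "\<dots> = p / t * real (\<Sum>v\<in>M. card (marked n f (f {v})))" by (simp add: sum_distrib_left)
  also have "\<dots> \<le> p / t * (t\<^sup>2 / 2)"
  proof (intro mult_left_mono)
    have "real (2 * (\<Sum>v\<in>M. card (marked n f (f {v})))) \<le> real ((card M)\<^sup>2)"
      using sum_card_marked[of n f b] finM by (simp only: M_def of_nat_le_iff)
    then show "real (\<Sum>v\<in>M. card (marked n f (f {v}))) \<le> t\<^sup>2 / 2" by (simp add: t_def)
  qed (use p t in auto)
  also have "p / t * (t\<^sup>2 / 2) = p * t / 2" using t by (simp add: power2_eq_square)
  finally have "measure_pmf.expectation D (\<lambda>v. real (card (marked n f (min b (f {v}))))) \<le> (1 - p) * t + p * t / 2"
    by simp
  also have "\<dots> = (1 - p / 2) * t" by (simp add: algebra_simps)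
  also have "\<dots> \<le> 7 / 8 * t" using p t by (intro mult_right_mono) auto
  finally show ?thesis by (simp add: t_def M_def)
qed

lemma cut_crossing_self: "f \<in> cut_functions n \<Longrightarrow> cut_crossing f {v} v = f {v}"
  by (erule cut_functionsE) (simp add: crossing_self)

text \<open>The threshold starts at \<open>n\<close> and drops to the degree of a vertex found below
  it. An iteration costs \<open>J\<close> queries for the search and \<open>5 * j\<close> for the
  degree of the outcome. As the threshold respects every lower bound on the degrees that is below
  \<open>n\<close>, it is the minimum degree once no vertex is marked; the expectation bounds the
  probability of the opposite by Markov's inequality.\<close>

lemma q_samples_minimum:
  assumes n: "n > 0" and J: "J > 0" "n \<le> J\<^sup>2" and j: "n \<le> 2 ^ j"
  shows "\<exists>D. q_samples n (cut_functions n) (I * (J + 5 * j)) D \<and> (\<forall>f\<in>cut_functions n.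
     (\<forall>b\<in>set_pmf (D f). \<forall>b'. (\<forall>v<n. b' \<le> f {v}) \<longrightarrow> b' < n \<longrightarrow> b' \<le> b) \<and>
     measure_pmf.expectation (D f) (\<lambda>b. real (card (marked n f b))) \<le> n * (7 / 8) ^ I)"
proof (induction I)
  case 0
  show ?case
    by (rule exI[of _ "\<lambda>f. return_pmf n"]) (auto simp: q_samples_return card_marked_le)
next
  case (Suc I)
  then obtain D where D: "q_samples n (cut_functions n) (I * (J + 5 * j)) D"
    "\<And>f b b'. f \<in> cut_functions n \<Longrightarrow> b \<in> set_pmf (D f) \<Longrightarrow> \<forall>v<n. b' \<le> f {v} \<Longrightarrow> b' < n \<Longrightarrow> b' \<le> b"
    "\<And>f. f \<in> cut_functions n \<Longrightarrow> measure_pmf.expectation (D f) (\<lambda>b. real (card (marked n f b))) \<le> n * (7 / 8) ^ I"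
    by blast
  obtain G where G: "\<And>b. q_samples n UNIV J (G b)" "\<And>b f. set_pmf (G b f) \<subseteq> {..<n}" "\<And>b f. marked n f b \<noteq> {} \<Longrightarrow> \<exists>p\<ge>1/4. p \<le> 1 \<and>
     (\<forall>v\<in>marked n f b. pmf (G b f) v = p / card (marked n f b))"
    using grover_search[OF n J] by metis
  define step where "step b f = map_pmf (\<lambda>v. min b (f {v})) (G b f)" for b f
  have step: "q_samples n (cut_functions n) (J + 5 * j) (step b)" for b
  proof -
    \<comment> \<open>The replacement of \<open>v\<close> by 0 keeps the query legal for values that
      the search never returns.\<close>
    have "q_samples n (cut_functions n) (J + 5 * j) (\<lambda>f. bind_pmf (G b f)
        (\<lambda>v. map_pmf (\<lambda>c. min b (c v)) (return_pmf (cut_crossing f {if v < n then v else 0}))))"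
    proof (rule q_samples_bind)
      show "q_samples n (cut_functions n) J (\<lambda>f. G b f)"
        by (rule q_samples_cong[OF G(1)]) auto
      fix v
      have "q_samples n (cut_functions n) (5 * j) (\<lambda>f. map_pmf (\<lambda>c. min b (c v)) (return_pmf (cut_crossing f {if v < n then v else 0})))"
        using n j by (intro q_samples_map q_samples_crossing) auto
      then show "q_samples n {f \<in> cut_functions n. v \<in> set_pmf (G b f)} (5 * j)
         (\<lambda>f. map_pmf (\<lambda>c. min b (c v)) (return_pmf (cut_crossing f {if v < n then v else 0})))"
        by (rule q_samples_cong) auto
    qed
    then show ?thesis
    proof (rule q_samples_cong, intro conjI)
      fix f assume f: "f \<in> cut_functions n"
      show "bind_pmf (G b f)
        (\<lambda>v. map_pmf (\<lambda>c. min b (c v)) (return_pmf (cut_crossing f {if v < n then v else 0}))) = step b f"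
        unfolding step_def map_pmf_def[of "\<lambda>v. min b (f {v})"]
        by (rule bind_pmf_cong[OF refl]) (use G(2) in \<open>force simp: cut_crossing_self[OF f]\<close>)
    qed
  qed
  have "q_samples n (cut_functions n) (I * (J + 5 * j) + (J + 5 * j)) (\<lambda>f. bind_pmf (D f) (\<lambda>b. step b f))"
    by (rule q_samples_bind[OF D(1)], rule q_samples_cong[OF step]) auto
  then have "q_samples n (cut_functions n) (Suc I * (J + 5 * j)) (\<lambda>f. bind_pmf (D f) (\<lambda>b. step b f))"
    by (simp add: add.commute)
  moreover have "\<forall>b\<in>set_pmf (bind_pmf (D f) (\<lambda>b. step b f)). \<forall>b'. (\<forall>v<n. b' \<le> f {v}) \<longrightarrow> b' < n \<longrightarrow> b' \<le> b"
    if f: "f \<in> cut_functions n" for f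
    using D(2)[OF f] G(2) by (fastforce simp: step_def)
  moreover have "measure_pmf.expectation (bind_pmf (D f) (\<lambda>b. step b f)) (\<lambda>b. real (card (marked n f b))) \<le> n * (7 / 8) ^ Suc I"
    if f: "f \<in> cut_functions n" for f
  proof -
    have finD: "finite (set_pmf (D f))" using q_samples_finite[OF D(1) f] .
    have finG: "finite (set_pmf (G b f))" for b using q_samples_finite[OF G(1)] by blast
    have one: "measure_pmf.expectation (step b f) (\<lambda>b. real (card (marked n f b))) \<le> 7 / 8 * real (card (marked n f b))" for b
    proof (cases "marked n f b = {}")
      case True
      have "marked n f (min b c) = {}" for c using True by (auto simp: marked_def)
      then show ?thesis by (simp add: step_def)
    next
      case False
      then obtain p where p: "1 / 4 \<le> p" "p \<le> 1" "\<And>v. v \<in> marked n f b \<Longrightarrow> pmf (G b f) v = p / card (marked n f b)"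
        using G(3) by blast
      show ?thesis using expectation_marked_step[OF finG p False] by (simp add: step_def)
    qed
    have "measure_pmf.expectation (bind_pmf (D f) (\<lambda>b. step b f)) (\<lambda>b. real (card (marked n f b)))
       = measure_pmf.expectation (D f) (\<lambda>b. measure_pmf.expectation (step b f) (\<lambda>b. real (card (marked n f b))))"
      by (rule expectation_bind_pmf_finite[OF finD]) (simp add: step_def finG)
    also have "\<dots> \<le> measure_pmf.expectation (D f) (\<lambda>b. 7 / 8 * real (card (marked n f b)))"
      using finD one by (intro integral_mono integrable_measure_pmf_finite) auto
    also have "\<dots> \<le> 7 / 8 * (n * (7 / 8) ^ I)" using D(3)[OF f] by simp
    finally show ?thesis by simp
  qed
  ultimately show ?case by blast
qed

section \<open>Random star contractions\<close>

lemma expectation_finite: "finite (set_pmf p) \<Longrightarrow> measure_pmf.expectation p h = (\<Sum>x\<in>set_pmf p. pmf p x * h x)"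
  for h :: "'a \<Rightarrow> real"
  by (subst integral_measure_pmf) auto

lemma expectation_mono_finite:
  fixes g h :: "'a \<Rightarrow> real"
  assumes "finite (set_pmf p)" "\<And>x. x \<in> set_pmf p \<Longrightarrow> g x \<le> h x"
  shows "measure_pmf.expectation p g \<le> measure_pmf.expectation p h"
  unfolding expectation_finite[OF assms(1)] using assms(2) by (intro sum_mono mult_left_mono) auto

lemma finite_set_replicate_pmf: "finite (set_pmf p) \<Longrightarrow> finite (set_pmf (replicate_pmf k p))"
  using finite_lists_length_eq[of "set_pmf p" k] by (simp add: set_replicate_pmf lists_eq_set)

lemma expectation_replicate_Suc:
  fixes h :: "'a list \<Rightarrow> real"
  assumes "finite (set_pmf p)"
  shows "measure_pmf.expectation (replicate_pmf (Suc k) p) h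
    = measure_pmf.expectation p (\<lambda>x. measure_pmf.expectation (replicate_pmf k p) (\<lambda>xs. h (x # xs)))"
  using assms by (simp add: expectation_bind_pmf_finite finite_set_replicate_pmf)

lemma expectation_pair:
  fixes h :: "'a \<times> 'b \<Rightarrow> real"
  assumes "finite (set_pmf p)" "finite (set_pmf q)"
  shows "measure_pmf.expectation (pair_pmf p q) h
    = measure_pmf.expectation p (\<lambda>x. measure_pmf.expectation q (\<lambda>y. h (x, y)))"
  using assms by (simp add: pair_pmf_def expectation_bind_pmf_finite)

lemma expectation_replicate_all:
  assumes "finite (set_pmf p)"
  shows "measure_pmf.expectation (replicate_pmf k p) (\<lambda>xs. of_bool (\<forall>x\<in>set xs. P x) :: real)
    = measure_pmf.expectation p (\<lambda>x. of_bool (P x)) ^ k"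
proof (induction k)
  case (Suc k)
  have "measure_pmf.expectation (replicate_pmf (Suc k) p) (\<lambda>xs. of_bool (\<forall>x\<in>set xs. P x) :: real)
     = measure_pmf.expectation p (\<lambda>x. of_bool (P x) *
         measure_pmf.expectation (replicate_pmf k p) (\<lambda>xs. of_bool (\<forall>x\<in>set xs. P x)))"
    by (subst expectation_replicate_Suc[OF assms]) (simp add: of_bool_conj)
  then show ?case by (simp add: Suc)
qed simp

text \<open>Jensen's inequality from the tangent of \<open>exp\<close> at \<open>- m\<close>:
  pointwise, \<open>exp (- Z x)\<close> is at least
  \<open>exp (- m) * (1 + m - Z x)\<close>.\<close>

lemma expectation_exp_ge:
  fixes Z :: "'a \<Rightarrow> real"
  assumes "finite (set_pmf p)" "measure_pmf.expectation p Z \<le> m"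
  shows "exp (- m) \<le> measure_pmf.expectation p (\<lambda>x. exp (- Z x))"
proof -
  have one: "(\<Sum>x\<in>set_pmf p. pmf p x) = 1" by (rule sum_pmf_eq_1[OF assms(1)]) simp
  have "exp (- m) * 1 \<le> exp (- m) * (1 + m - measure_pmf.expectation p Z)"
    using assms(2) by (intro mult_left_mono) auto
  also have "\<dots> = measure_pmf.expectation p (\<lambda>x. exp (- m) * (1 + (m - Z x)))"
  proof -
    have "measure_pmf.expectation p (\<lambda>x. exp (- m) * (1 + (m - Z x)))
       = (\<Sum>x\<in>set_pmf p. exp (- m) * ((1 + m) * pmf p x - pmf p x * Z x))"
      unfolding expectation_finite[OF assms(1)] by (intro sum.cong refl) (simp add: algebra_simps)
    also have "\<dots> = exp (- m) * ((1 + m) * (\<Sum>x\<in>set_pmf p. pmf p x) - (\<Sum>x\<in>set_pmf p. pmf p x * Z x))"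
      by (simp only: sum_distrib_left[symmetric] sum_subtractf)
    finally show ?thesis by (simp add: one expectation_finite[OF assms(1)])
  qed
  also have "\<dots> \<le> measure_pmf.expectation p (\<lambda>x. exp (- Z x))"
  proof (rule expectation_mono_finite[OF assms(1)])
    fix x
    have "exp (- m) * (1 + (m - Z x)) \<le> exp (- m) * exp (m - Z x)"
      by (intro mult_left_mono exp_ge_add_one_self) auto
    then show "exp (- m) * (1 + (m - Z x)) \<le> exp (- Z x)" by (simp flip: exp_add)
  qed
  finally show ?thesis by simp
qed

text \<open>A round of the contraction is a list of candidate centres together with the set of vertices
  that try to join a centre in this round; a vertex joins the first candidate adjacent to it.\<close>

primrec choice :: "('v \<Rightarrow> 'v \<Rightarrow> bool) \<Rightarrow> 'v \<Rightarrow> ('v list \<times> 'v set) list \<Rightarrow> 'v option" where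
  "choice adj v [] = None"
| "choice adj v (p # ps) = (if v \<in> snd p then find (\<lambda>r. adj r v) (fst p) else choice adj v ps)"

lemma choice_cong:
  assumes "\<And>p r. p \<in> set ps \<Longrightarrow> r \<in> set (fst p) \<Longrightarrow> adj r v \<longleftrightarrow> adj' r v"
  shows "choice adj v ps = choice adj' v ps"
  using assms by (induction ps) (auto intro!: find_cong)

lemma choice_SomeD: "choice adj v ps = Some r \<Longrightarrow> adj r v \<and> (\<exists>p\<in>set ps. r \<in> set (fst p))"
  by (induction ps) (auto simp: find_Some_iff split: if_splits)

definition round_pmf :: "nat \<Rightarrow> nat \<Rightarrow> (nat list \<times> nat set) pmf" where
  "round_pmf n k = pair_pmf (replicate_pmf k (pmf_of_set {..<n})) (pmf_of_set (Pow {..<n}))"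

context
  fixes adj :: "nat \<Rightarrow> nat \<Rightarrow> bool" and S :: "nat set"
begin

definition hits_across :: "nat \<Rightarrow> nat list \<Rightarrow> bool" where
  "hits_across v R \<longleftrightarrow> (case find (\<lambda>r. adj r v) R of None \<Rightarrow> False | Some r \<Rightarrow> (r \<in> S) \<noteq> (v \<in> S))"

definition obeys :: "nat \<Rightarrow> (nat list \<times> nat set) list \<Rightarrow> bool" where
  "obeys v ps \<longleftrightarrow> (case choice adj v ps of None \<Rightarrow> True | Some r \<Rightarrow> (r \<in> S) = (v \<in> S))"

lemma obeys_simps:
  "obeys v []" "obeys v (p # ps) \<longleftrightarrow> (if v \<in> snd p then \<not> hits_across v (fst p) else obeys v ps)"
  by (auto simp: obeys_def hits_across_def split: option.splits)

context
  fixes n :: nat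
  assumes n: "n > 0"
begin

lemma finite_uniform: "finite (set_pmf (pmf_of_set {..<n}))" "finite (set_pmf (pmf_of_set (Pow {..<n})))"
proof -
  have "{..<n} \<noteq> {}" "Pow {..<n} \<noteq> {}" using n by auto
  then show "finite (set_pmf (pmf_of_set {..<n}))" "finite (set_pmf (pmf_of_set (Pow {..<n})))"
    by (simp_all add: set_pmf_of_set)
qed

lemma finite_round: "finite (set_pmf (round_pmf n k))" "finite (set_pmf (replicate_pmf L (round_pmf n k)))"
  unfolding round_pmf_def using finite_uniform by (auto intro!: finite_set_replicate_pmf)

lemma expectation_round:
  fixes h :: "_ \<Rightarrow> real"
  shows "measure_pmf.expectation (round_pmf n k) h = measure_pmf.expectation (replicate_pmf k (pmf_of_set {..<n}))
    (\<lambda>R. measure_pmf.expectation (pmf_of_set (Pow {..<n})) (\<lambda>C. h (R, C)))"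
  unfolding round_pmf_def by (rule expectation_pair[OF finite_set_replicate_pmf[OF finite_uniform(1)] finite_uniform(2)])

lemma expectation_uniform: "measure_pmf.expectation (pmf_of_set {..<n}) h = (\<Sum>x<n. h x) / real n"
  using n by (subst integral_pmf_of_set) (auto simp: lessThan_empty_iff)

lemma expectation_uniform_Pow:
  "measure_pmf.expectation (pmf_of_set (Pow {..<n})) h = (\<Sum>C\<in>Pow {..<n}. h C) / (2 :: real) ^ n"
  by (subst integral_pmf_of_set) (auto simp: card_Pow)

text \<open>A uniform subset of \<open>{..<n}\<close> is one fair coin for each vertex, so products
  over heads and tails factor.\<close>

lemma expectation_uniform_Pow_prod:
  "measure_pmf.expectation (pmf_of_set (Pow {..<n})) (\<lambda>C. (\<Prod>v\<in>C. x v) * (\<Prod>v\<in>{..<n} - C. y v))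
    = (\<Prod>v<n. (x v + y v) / (2 :: real))"
  unfolding expectation_uniform_Pow
  by (subst prod_add[symmetric]) (auto simp: prod_dividef)

lemma degree_le: "card {r. r < n \<and> adj r v} \<le> n"
proof -
  have "{r. r < n \<and> adj r v} \<subseteq> {..<n}" by auto
  from card_mono[OF finite_lessThan this] show ?thesis by simp
qed

text \<open>The first adjacent candidate is a uniform neighbour if there is one. The degree is
  multiplied out, and the induction splits off the first candidate: it decides the matter if
  adjacent, otherwise the remaining list does.\<close>

lemma hits_across_prob:
  "card {r. r < n \<and> adj r v} * measure_pmf.expectation (replicate_pmf k (pmf_of_set {..<n})) (\<lambda>R. of_bool (hits_across v R))
   \<le> card {r. r < n \<and> adj r v \<and> (r \<in> S) \<noteq> (v \<in> S)}"
proof (induction k)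
  case 0
  then show ?case by (simp add: hits_across_def)
next
  case (Suc k)
  define N where "N = {r. r < n \<and> adj r v}"
  define c where "c = real (card {r. r < n \<and> adj r v \<and> (r \<in> S) \<noteq> (v \<in> S)})"
  define P where "P k = measure_pmf.expectation (replicate_pmf k (pmf_of_set {..<n})) (\<lambda>R. of_bool (hits_across v R) :: real)" for k
  have N: "N \<subseteq> {..<n}" by (auto simp: N_def)
  have dn: "card N \<le> n" using card_mono[OF _ N] by simp
  have "P (Suc k) = (\<Sum>x<n. measure_pmf.expectation (replicate_pmf k (pmf_of_set {..<n})) (\<lambda>R. of_bool (hits_across v (x # R)))) / n"
    unfolding P_def by (simp only: expectation_replicate_Suc[OF finite_uniform(1)] expectation_uniform)
  also have "(\<Sum>x<n. measure_pmf.expectation (replicate_pmf k (pmf_of_set {..<n})) (\<lambda>R. of_bool (hits_across v (x # R)) :: real))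
     = (\<Sum>x<n. if x \<in> N then of_bool ((x \<in> S) \<noteq> (v \<in> S)) else P k)"
    by (intro sum.cong refl) (auto simp: hits_across_def N_def P_def)
  also have "\<dots> = (\<Sum>x\<in>{..<n} - N. P k) + (\<Sum>x\<in>N. of_bool ((x \<in> S) \<noteq> (v \<in> S)))"
    by (subst sum.subset_diff[OF N]) auto
  also have "(\<Sum>x\<in>N. of_bool ((x \<in> S) \<noteq> (v \<in> S))) = c"
    unfolding c_def N_def by (subst sum_of_bool_eq) (auto intro!: arg_cong[where f = card])
  also have "(\<Sum>x\<in>{..<n} - N. P k) = (real n - card N) * P k"
    using N dn by (subst sum_constant, subst card_Diff_subset) (auto simp: of_nat_diff intro: finite_subset)
  finally have "card N * P (Suc k) = (card N * c + (real n - card N) * (card N * P k)) / n"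
    by (simp add: field_simps)
  also have "\<dots> \<le> (card N * c + (real n - card N) * c) / n"
    using Suc dn by (intro divide_right_mono add_left_mono mult_left_mono) (auto simp: N_def P_def c_def)
  also have "\<dots> = c" using n by (simp add: algebra_simps)
  finally show ?case by (simp add: N_def P_def c_def)
qed

lemma no_hit_prob:
  "measure_pmf.expectation (replicate_pmf k (pmf_of_set {..<n})) (\<lambda>R. of_bool (find (\<lambda>r. adj r v) R = None))
   = (1 - card {r. r < n \<and> adj r v} / real n) ^ k"
proof -
  have eq: "find (\<lambda>r. adj r v) R = None \<longleftrightarrow> (\<forall>r\<in>set R. \<not> adj r v)" for R
    by (auto simp: find_None_iff)
  have "(\<Sum>r<n. of_bool (\<not> adj r v)) = real n - card {r. r < n \<and> adj r v}"
  proof -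
    have "(\<Sum>r<n. of_bool (\<not> adj r v)) = real (card ({..<n} - {r. r < n \<and> adj r v}))"
      by (subst sum_of_bool_eq) (auto intro!: arg_cong[where f = card])
    also have "\<dots> = real n - card {r. r < n \<and> adj r v}"
      using degree_le by (subst card_Diff_subset) (auto simp: of_nat_diff intro: finite_subset[of _ "{..<n}"])
    finally show ?thesis .
  qed
  then show ?thesis
    unfolding eq expectation_replicate_all[OF finite_uniform(1)] expectation_uniform
    using n by (simp add: diff_divide_distrib)
qed

text \<open>A vertex tries once, in the first round that selects it. It stays without a centre if no
  round selects it or if the candidates of that one round miss its neighbourhood.\<close>

lemma no_choice_prob:
  assumes "v < n"
  shows "measure_pmf.expectation (replicate_pmf L (round_pmf n k)) (\<lambda>ps. of_bool (choice adj v ps = None))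
   \<le> (1 / 2) ^ L + (1 - card {r. r < n \<and> adj r v} / real n) ^ k"
proof (induction L)
  case 0
  have "0 \<le> (1 - card {r. r < n \<and> adj r v} / real n) ^ k"
    using n degree_le[of v] by (intro zero_le_power) (simp add: field_simps)
  then show ?case by simp
next
  case (Suc L)
  define miss where "miss = (1 - card {r. r < n \<and> adj r v} / real n) ^ k"
  define l where "l = measure_pmf.expectation (replicate_pmf L (round_pmf n k)) (\<lambda>ps. of_bool (choice adj v ps = None) :: real)"
  have half: "measure_pmf.expectation (pmf_of_set (Pow {..<n})) (\<lambda>C. if v \<in> C then a else b) = (a + b) / 2" for a b :: real
  proof -
    have "measure_pmf.expectation (pmf_of_set (Pow {..<n})) (\<lambda>C. if v \<in> C then a else b)
      = measure_pmf.expectation (pmf_of_set (Pow {..<n}))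
         (\<lambda>C. (\<Prod>u\<in>C. if u = v then a else 1) * (\<Prod>u\<in>{..<n} - C. if u = v then b else 1))"
      unfolding expectation_uniform_Pow using assms
      by (intro arg_cong2[where f = "(/)"] sum.cong refl) (auto simp: finite_subset[of _ "{..<n}"])
    also have "\<dots> = (\<Prod>u<n. if u = v then (a + b) / 2 else 1)"
      unfolding expectation_uniform_Pow_prod by (intro prod.cong) auto
    finally show ?thesis using assms by simp
  qed
  have "measure_pmf.expectation (replicate_pmf (Suc L) (round_pmf n k)) (\<lambda>ps. of_bool (choice adj v ps = None) :: real)
    = measure_pmf.expectation (replicate_pmf k (pmf_of_set {..<n})) (\<lambda>R.
       measure_pmf.expectation (pmf_of_set (Pow {..<n})) (\<lambda>C. if v \<in> C then of_bool (find (\<lambda>r. adj r v) R = None) else l))"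
    unfolding expectation_replicate_Suc[OF finite_round(1)] expectation_round
    by (auto intro!: Bochner_Integration.integral_cong simp: l_def)
  also have "\<dots> = (miss + l) / 2"
    unfolding half miss_def no_hit_prob[symmetric]
      expectation_finite[OF finite_set_replicate_pmf[OF finite_uniform(1)]]
    using sum_pmf_eq_1[OF finite_set_replicate_pmf[OF finite_uniform(1), of k] subset_refl]
    by (simp add: add_divide_distrib algebra_simps sum.distrib flip: sum_divide_distrib sum_distrib_left sum_distrib_right)
  also have "\<dots> \<le> (1 / 2) ^ Suc L + miss" using Suc by (simp add: l_def miss_def)
  finally show ?case by (simp add: miss_def)
qed

text \<open>Fix the candidates \<open>R\<close> of the first round: selection is then independent
  over the vertices, and the unselected set \<open>U - C\<close> falls under the induction
  hypothesis, whose exponential splits into factors too. The resulting product is at least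
  \<open>exp (- (\<Sum>v\<in>U. z v R))\<close>, and Jensen's inequality averages over
  \<open>R\<close>.\<close>

lemma obeys_prob:
  fixes q :: "nat \<Rightarrow> real"
  assumes "U \<subseteq> {..<n}"
    and q: "\<And>v. v \<in> U \<Longrightarrow> 0 \<le> q v" "\<And>v. v \<in> U \<Longrightarrow> q v \<le> 1 / 2"
    and B: "\<And>v. v \<in> U \<Longrightarrow> measure_pmf.expectation (replicate_pmf k (pmf_of_set {..<n})) (\<lambda>R. of_bool (hits_across v R)) \<le> q v"
  shows "exp (- (4 * ln 2 * (\<Sum>v\<in>U. q v)))
    \<le> measure_pmf.expectation (replicate_pmf L (round_pmf n k)) (\<lambda>ps. of_bool (\<forall>v\<in>U. obeys v ps))"
  using assms
proof (induction L arbitrary: U)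
  case 0
  then have "0 \<le> (\<Sum>v\<in>U. q v)" by (intro sum_nonneg) auto
  then show ?case by (simp add: obeys_simps)
next
  case (Suc L)
  let ?K = "4 * ln (2 :: real)"
  let ?E = "measure_pmf.expectation (replicate_pmf k (pmf_of_set {..<n}))"
  have finU: "finite U" using Suc.prems(1) by (rule finite_subset) auto
  have finR: "finite (set_pmf (replicate_pmf k (pmf_of_set {..<n})))"
    by (rule finite_set_replicate_pmf[OF finite_uniform(1)])
  \<comment> \<open>\<open>- z v R\<close> is a lower bound for the logarithm of the factor of
    \<open>v\<close>. Without a hit the factor is \<open>(1 + w * w) / 2 \<ge> w\<close> with
    \<open>w = exp (- (?K * q v / 2))\<close>; with a hit only the unselected half remains, which
    costs \<open>ln 2\<close>.\<close>
  define z where "z v R = ?K * q v / 2 + of_bool (hits_across v R) * (?K * q v / 2 + ln 2)" for v R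
  have Ez: "?E (z v) \<le> ?K * q v" if v: "v \<in> U" for v
  proof -
    define e :: real where "e = ?E (\<lambda>R. of_bool (hits_across v R))"
    have "?E (z v) = ?K * q v / 2 + e * (?K * q v / 2 + ln 2)"
      unfolding z_def e_def expectation_finite[OF finR] using sum_pmf_eq_1[OF finR subset_refl]
      by (simp add: distrib_left sum.distrib flip: sum_distrib_right mult.assoc)
    also have "\<dots> \<le> ?K * q v / 2 + q v * (?K * q v / 2 + ln 2)"
    proof (intro add_left_mono mult_right_mono)
      show "e \<le> q v" using Suc.prems(4)[OF v] by (simp only: e_def)
    qed (use Suc.prems(2)[OF v] in simp)
    \<comment> \<open>Here \<open>q v \<le> 1 / 2\<close> enters. The constant
      \<open>?K = 4 * ln 2\<close> solves \<open>?K / 2 + ?K / 4 + ln 2 = ?K\<close>.\<close>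
    also have "\<dots> \<le> ?K * q v / 2 + q v * (?K * (1 / 2) / 2 + ln 2)"
      using Suc.prems(2,3)[OF v] by (intro add_left_mono mult_left_mono add_right_mono divide_right_mono) auto
    also have "\<dots> = ?K * q v" by (simp add: algebra_simps)
    finally show ?thesis .
  qed
  have pointwise: "exp (- (\<Sum>v\<in>U. z v R)) \<le> measure_pmf.expectation (pmf_of_set (Pow {..<n})) (\<lambda>C.
      measure_pmf.expectation (replicate_pmf L (round_pmf n k)) (\<lambda>ps. of_bool (\<forall>v\<in>U. obeys v ((R, C) # ps))))" for R
  proof -
    define x where "x v = (if v \<in> U then of_bool (\<not> hits_across v R) else 1 :: real)" for v
    define y where "y v = (if v \<in> U then exp (- (?K * q v)) else 1)" for v
    have "exp (- (\<Sum>v\<in>U. z v R)) = (\<Prod>v\<in>U. exp (- z v R))" by (simp add: exp_sum finU flip: sum_negf)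
    also have "\<dots> \<le> (\<Prod>v\<in>U. (x v + y v) / 2)"
    proof (intro prod_mono conjI)
      fix v assume v: "v \<in> U"
      show "exp (- z v R) \<le> (x v + y v) / 2"
      proof (cases "hits_across v R")
        case True
        have "- z v R = - (?K * q v) - ln 2" using True by (simp add: z_def)
        then have "exp (- z v R) = exp (- (?K * q v)) / exp (ln 2)" by (simp only: exp_diff)
        then show ?thesis using True v by (simp add: x_def y_def)
      next
        case False
        define w where "w = exp (- (?K * q v / 2))"
        have "w * w = exp (- (?K * q v))" by (simp add: w_def flip: exp_add)
        then have "x v + y v = 1 + w * w" using False v by (simp add: x_def y_def)
        moreover have "exp (- z v R) = w" using False by (simp add: z_def w_def)
        moreover have "0 \<le> (1 - w) * (1 - w)" by simp
        ultimately show ?thesis by (simp add: algebra_simps)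
      qed
    qed simp
    also have "\<dots> = (\<Prod>v<n. (x v + y v) / 2)"
      using Suc.prems(1) by (intro prod.mono_neutral_left) (auto simp: x_def y_def)
    also have "\<dots> = measure_pmf.expectation (pmf_of_set (Pow {..<n})) (\<lambda>C. (\<Prod>v\<in>C. x v) * (\<Prod>v\<in>{..<n} - C. y v))"
      by (rule expectation_uniform_Pow_prod[symmetric])
    also have "\<dots> \<le> measure_pmf.expectation (pmf_of_set (Pow {..<n})) (\<lambda>C.
      measure_pmf.expectation (replicate_pmf L (round_pmf n k)) (\<lambda>ps. of_bool (\<forall>v\<in>U. obeys v ((R, C) # ps))))"
    proof (rule expectation_mono_finite[OF finite_uniform(2)])
      fix C assume "C \<in> set_pmf (pmf_of_set (Pow {..<n}))"
      then have C: "C \<subseteq> {..<n}" by (subst (asm) set_pmf_of_set) auto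
      have finC: "finite C" using C by (rule finite_subset) auto
      have "(\<Prod>v\<in>C. x v) = of_bool (\<forall>v\<in>U \<inter> C. \<not> hits_across v R)"
        using finC by (auto simp: x_def prod_zero_iff intro!: prod.neutral)
      moreover have "(\<Prod>v\<in>{..<n} - C. y v) = (\<Prod>v\<in>U - C. exp (- (?K * q v)))"
        using Suc.prems(1) by (intro prod.mono_neutral_cong_right) (auto simp: y_def)
      moreover have "\<dots> = exp (- (?K * (\<Sum>v\<in>U - C. q v)))"
        using finU by (simp add: sum_distrib_left flip: exp_sum sum_negf)
      moreover have "exp (- (?K * (\<Sum>v\<in>U - C. q v)))
         \<le> measure_pmf.expectation (replicate_pmf L (round_pmf n k)) (\<lambda>ps. of_bool (\<forall>v\<in>U - C. obeys v ps))"
        by (rule Suc.IH) (use Suc.prems in auto)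
      ultimately have "(\<Prod>v\<in>C. x v) * (\<Prod>v\<in>{..<n} - C. y v)
         \<le> of_bool (\<forall>v\<in>U \<inter> C. \<not> hits_across v R) *
           measure_pmf.expectation (replicate_pmf L (round_pmf n k)) (\<lambda>ps. of_bool (\<forall>v\<in>U - C. obeys v ps))"
        by (simp add: mult_left_mono)
      also have "\<dots> = measure_pmf.expectation (replicate_pmf L (round_pmf n k)) (\<lambda>ps. of_bool (\<forall>v\<in>U. obeys v ((R, C) # ps)))"
        unfolding integral_mult_right_zero[symmetric]
        by (intro Bochner_Integration.integral_cong refl) (auto simp: obeys_simps)
      finally show "(\<Prod>v\<in>C. x v) * (\<Prod>v\<in>{..<n} - C. y v) \<le>
         measure_pmf.expectation (replicate_pmf L (round_pmf n k)) (\<lambda>ps. of_bool (\<forall>v\<in>U. obeys v ((R, C) # ps)))" .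
    qed
    finally show ?thesis .
  qed
  have "?E (\<lambda>R. \<Sum>v\<in>U. z v R) = (\<Sum>v\<in>U. ?E (z v))"
    unfolding expectation_finite[OF finR] by (simp add: sum_distrib_left sum.swap[of _ U])
  also have "\<dots> \<le> (\<Sum>v\<in>U. ?K * q v)" by (intro sum_mono Ez)
  finally have "?E (\<lambda>R. \<Sum>v\<in>U. z v R) \<le> ?K * (\<Sum>v\<in>U. q v)" by (simp add: sum_distrib_left)
  then have "exp (- (?K * (\<Sum>v\<in>U. q v))) \<le> ?E (\<lambda>R. exp (- (\<Sum>v\<in>U. z v R)))"
    by (rule expectation_exp_ge[OF finR])
  also have "\<dots> \<le> ?E (\<lambda>R. measure_pmf.expectation (pmf_of_set (Pow {..<n})) (\<lambda>C.
      measure_pmf.expectation (replicate_pmf L (round_pmf n k)) (\<lambda>ps. of_bool (\<forall>v\<in>U. obeys v ((R, C) # ps)))))"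
    by (intro expectation_mono_finite[OF finR] pointwise)
  also have "\<dots> = measure_pmf.expectation (replicate_pmf (Suc L) (round_pmf n k)) (\<lambda>ps. of_bool (\<forall>v\<in>U. obeys v ps))"
    unfolding expectation_replicate_Suc[OF finite_round(1)] expectation_round ..
  finally show ?case .
qed

text \<open>The number of vertices without a centre is controlled by Markov's inequality.\<close>

lemma contraction_prob:
  fixes q :: "nat \<Rightarrow> real"
  assumes U: "U \<subseteq> {..<n}" and M: "M > 0"
    and q: "\<And>v. v \<in> U \<Longrightarrow> 0 \<le> q v" "\<And>v. v \<in> U \<Longrightarrow> q v \<le> 1 / 2" "(\<Sum>v\<in>U. q v) \<le> 2"
    and B: "\<And>v. v \<in> U \<Longrightarrow> card {r. r < n \<and> adj r v \<and> (r \<in> S) \<noteq> (v \<in> S)} \<le> q v * card {r. r < n \<and> adj r v}"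
    and d: "\<And>v. v \<in> U \<Longrightarrow> 0 < card {r. r < n \<and> adj r v}"
    and miss: "\<And>v. v \<in> U \<Longrightarrow> (1 - card {r. r < n \<and> adj r v} / real n) ^ k \<le> 1 / real n"
    and L: "real n \<le> 2 ^ L"
  shows "1 / 256 - 2 / real M \<le> measure_pmf.expectation (replicate_pmf L (round_pmf n k))
     (\<lambda>ps. of_bool ((\<forall>v\<in>U. obeys v ps) \<and> card {v \<in> U. choice adj v ps = None} < M))"
proof -
  let ?E = "measure_pmf.expectation (replicate_pmf L (round_pmf n k))"
  have finU: "finite U" using U by (rule finite_subset) auto
  have hits: "measure_pmf.expectation (replicate_pmf k (pmf_of_set {..<n})) (\<lambda>R. of_bool (hits_across v R)) \<le> q v"
    if v: "v \<in> U" for v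
  proof -
    have "card {r. r < n \<and> adj r v} * measure_pmf.expectation (replicate_pmf k (pmf_of_set {..<n})) (\<lambda>R. of_bool (hits_across v R))
      \<le> card {r. r < n \<and> adj r v} * q v"
      using hits_across_prob[of v k] B[OF v] by (simp add: mult.commute)
    then show ?thesis using d[OF v] by simp
  qed
  \<comment> \<open>The \<open>q v\<close> sum up to at most 2, so the exponent is at most
    \<open>8 * ln 2\<close>, and \<open>256 = 2 ^ 8\<close>.\<close>
  have "1 / 256 = exp (- (4 * ln 2 * 2) :: real)"
  proof -
    have "exp (8 * ln 2) = (exp (ln 2) ^ 8 :: real)" using exp_of_nat_mult[of 8 "ln 2 :: real"] by simp
    then show ?thesis by (simp add: exp_minus)
  qed
  also have "\<dots> \<le> exp (- (4 * ln 2 * (\<Sum>v\<in>U. q v)))" using q(3) by simp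
  also have "\<dots> \<le> ?E (\<lambda>ps. of_bool (\<forall>v\<in>U. obeys v ps))"
    by (rule obeys_prob[OF U q(1,2) hits])
  finally have good: "(1 / 256 :: real) \<le> ?E (\<lambda>ps. of_bool (\<forall>v\<in>U. obeys v ps))" .
  have card: "real (card {v \<in> U. choice adj v ps = None}) = (\<Sum>v\<in>U. of_bool (choice adj v ps = None))" for ps
    using finU by (subst sum_of_bool_eq) (auto simp: Collect_conj_eq intro!: arg_cong[where f = card])
  have "?E (\<lambda>ps. real (card {v \<in> U. choice adj v ps = None})) = (\<Sum>v\<in>U. ?E (\<lambda>ps. of_bool (choice adj v ps = None)))"
    unfolding card expectation_finite[OF finite_round(2)] by (simp add: sum_distrib_left sum.swap[of _ U])
  \<comment> \<open>One \<open>1 / n\<close> for never being selected and one for candidates that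
    miss.\<close>
  also have "\<dots> \<le> (\<Sum>v\<in>U. 2 / real n)"
  proof (rule sum_mono)
    fix v assume v: "v \<in> U"
    have "(1 / 2 :: real) ^ L \<le> 1 / real n" using L n by (simp add: power_divide divide_simps)
    then show "?E (\<lambda>ps. of_bool (choice adj v ps = None)) \<le> 2 / real n"
      using no_choice_prob[of v L k] miss[OF v] v U by fastforce
  qed
  also have "\<dots> \<le> 2" using card_mono[OF _ U] n by (simp add: divide_simps)
  finally have left: "?E (\<lambda>ps. real (card {v \<in> U. choice adj v ps = None})) \<le> 2" .
  \<comment> \<open>Subtracting the count divided by \<open>M\<close> removes at least 1 on every
    outcome with \<open>M\<close> or more leftover vertices, which handles the joint event without
    independence.\<close>
  have "1 / 256 - 2 / real M \<le> ?E (\<lambda>ps. of_bool (\<forall>v\<in>U. obeys v ps)) - ?E (\<lambda>ps. real (card {v \<in> U. choice adj v ps = None})) / M"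
    using good left M by (intro diff_mono divide_right_mono) auto
  also have "\<dots> = ?E (\<lambda>ps. of_bool (\<forall>v\<in>U. obeys v ps) - real (card {v \<in> U. choice adj v ps = None}) / M)"
    unfolding expectation_finite[OF finite_round(2)] by (simp add: right_diff_distrib sum_subtractf sum_divide_distrib)
  also have "\<dots> \<le> ?E (\<lambda>ps. of_bool ((\<forall>v\<in>U. obeys v ps) \<and> card {v \<in> U. choice adj v ps = None} < M))"
    by (rule expectation_mono_finite[OF finite_round(2)]) (use M in \<open>auto simp: divide_simps\<close>)
  finally show ?thesis .
qed

end

end

section \<open>The cut algorithm on decision trees\<close>

primrec query_all ::
  "'q list \<Rightarrow> (('q \<Rightarrow> 'a) \<Rightarrow> ('q, 'a, 'r) decision_tree) \<Rightarrow> ('q \<Rightarrow> 'a) \<Rightarrow> ('q, 'a, 'r) decision_tree" where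
  "query_all [] g f = g f"
| "query_all (x # xs) g f = Query x (\<lambda>a. query_all xs g (f(x := a)))"

lemma tree_output_query_all:
  "tree_output c (query_all xs g f) = tree_output c (g (\<lambda>x. if x \<in> set xs then c x else f x))"
proof (induction xs arbitrary: f)
  case (Cons x xs)
  have "(\<lambda>y. if y \<in> set xs then c y else (f(x := c x)) y) = (\<lambda>y. if y \<in> set (x # xs) then c y else f y)" by auto
  then show ?case by (simp add: Cons del: list.set)
qed simp

lemma query_bounded_mono: "query_bounded t k \<Longrightarrow> k \<le> k' \<Longrightarrow> query_bounded t k'"
  by (induction t arbitrary: k k') (auto, metis diff_le_mono rangeI)

lemma query_bounded_query_all: "(\<And>f. query_bounded (g f) k) \<Longrightarrow> query_bounded (query_all xs g f) (length xs + k)"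
  by (induction xs arbitrary: f) auto

lemma admissible_query_all: "set xs \<subseteq> Q \<Longrightarrow> (\<And>f. admissible Q (g f)) \<Longrightarrow> admissible Q (query_all xs g f)"
  by (induction xs arbitrary: f) auto

context
  fixes n \<tau> :: nat and Xs :: "nat set list" and rs :: "(nat list \<times> nat set) list"
begin

text \<open>A vertex is regarded as low if the answers \<open>f X\<close> for the sets \<open>X\<close> of the list \<open>Xs\<close> are compatible with a
  neighbourhood of at most \<open>\<tau>\<close> vertices; its true degree need not be known.\<close>

definition candidate :: "(nat set \<Rightarrow> nat \<Rightarrow> nat) \<Rightarrow> nat \<Rightarrow> nat set \<Rightarrow> bool" where
  "candidate f v N \<longleftrightarrow> N \<subseteq> {..<n} - {v} \<and> card N \<le> \<tau> \<and> (\<forall>X\<in>set Xs. card {u \<in> N. (u \<in> X) \<noteq> (v \<in> X)} = f X v)"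

definition low :: "(nat set \<Rightarrow> nat \<Rightarrow> nat) \<Rightarrow> nat set" where
  "low f = {v. v < n \<and> (\<exists>N. candidate f v N)}"

definition decode :: "(nat set \<Rightarrow> nat \<Rightarrow> nat) \<Rightarrow> nat \<Rightarrow> nat set" where
  "decode f v = (SOME N. candidate f v N)"

definition centres :: "nat set" where
  "centres = (\<Union>p\<in>set rs. set (fst p))"

text \<open>For \<open>r \<noteq> v\<close> the crossing number of \<open>{r}\<close> at
  \<open>v\<close> is the adjacency bit, whereas for \<open>r = v\<close> it is the degree and says
  nothing about adjacency.\<close>

definition joins :: "(nat set \<Rightarrow> nat \<Rightarrow> nat) \<Rightarrow> nat \<Rightarrow> nat \<Rightarrow> bool" where
  "joins f r v \<longleftrightarrow> r \<noteq> v \<and> f {r} v \<noteq> 0"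

definition loose :: "(nat set \<Rightarrow> nat \<Rightarrow> nat) \<Rightarrow> nat set" where
  "loose f = {v \<in> {..<n} - low f. choice (joins f) v rs = None}"

text \<open>Low vertices are not contracted because their neighbourhoods are decoded anyway, and
  centres stay fixed so that the clusters are stars around them.\<close>

definition centre_of :: "(nat set \<Rightarrow> nat \<Rightarrow> nat) \<Rightarrow> nat \<Rightarrow> nat" where
  "centre_of f v = (if v \<in> centres \<or> v \<in> low f then v
     else case choice (joins f) v rs of None \<Rightarrow> v | Some r \<Rightarrow> r)"

definition part :: "(nat set \<Rightarrow> nat \<Rightarrow> nat) \<Rightarrow> nat \<Rightarrow> nat set" where
  "part f r = {v \<in> {..<n}. centre_of f v = r}"

text \<open>The clusters of centres and loose vertices are queried. Any other low vertex is a
  cluster by itself, with crossing numbers given by its decoded neighbourhood, and any other index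
  has an empty cluster.\<close>

definition known_crossing :: "(nat set \<Rightarrow> nat \<Rightarrow> nat) \<Rightarrow> (nat set \<Rightarrow> nat \<Rightarrow> nat) \<Rightarrow> nat \<Rightarrow> nat \<Rightarrow> nat" where
  "known_crossing f g r w = (if r \<in> centres \<union> loose f then g (part f r) w
     else if r \<in> low f then of_bool (w \<in> decode f r) else 0)"

text \<open>The harmless value \<open>n * n\<close> keeps \<open>Min\<close> from being applied to the empty set.\<close>

definition contracted_minimum :: "(nat set \<Rightarrow> nat \<Rightarrow> nat) \<Rightarrow> (nat set \<Rightarrow> nat \<Rightarrow> nat) \<Rightarrow> nat" where
  "contracted_minimum f g = Min (insert (n * n) {\<Sum>w\<in>{..<n} - S. \<Sum>r\<in>S. known_crossing f g r w | S.
     S \<noteq> {} \<and> S \<subset> {..<n} \<and> (\<forall>v\<in>{..<n}. centre_of f v \<in> S \<longleftrightarrow> v \<in> S)})"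

text \<open>The second batch of queries depends on the first through the clusters. Too many loose
  vertices would break the query bound, so such runs give up with a value that is never below the
  edge connectivity.\<close>

definition contraction_tree :: "nat \<Rightarrow> (nat set, nat \<Rightarrow> nat, nat) decision_tree" where
  "contraction_tree M = query_all (Xs @ map (\<lambda>r. {r}) (concat (map fst rs)))
     (\<lambda>f. if card (loose f) < M
        then query_all (map (part f) (sorted_list_of_set (centres \<union> loose f)))
          (\<lambda>g. Output (contracted_minimum f g)) (\<lambda>_ _. 0)
        else Output (n * n)) (\<lambda>_ _. 0)"

text \<open>One term \<open>L * k\<close> counts the singletons of the candidates in the first
  batch, the other their clusters in the second; the loose vertices add fewer than
  \<open>M\<close>.\<close>

lemma contraction_tree_bounded:
  assumes "length Xs \<le> q" "length rs \<le> L" "\<And>p. p \<in> set rs \<Longrightarrow> length (fst p) \<le> k"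
  shows "query_bounded (contraction_tree M) (q + 2 * (L * k) + M)"
proof -
  have "sum_list (map (length \<circ> fst) rs) \<le> sum_list (map (\<lambda>_. k) rs)"
    using assms(3) by (intro sum_list_mono) auto
  also have "\<dots> \<le> L * k" using assms(2) by (simp add: sum_list_triv)
  finally have len: "length (concat (map fst rs)) \<le> L * k" by (simp add: length_concat)
  have "card centres \<le> length (concat (map fst rs))"
    unfolding centres_def using card_length[of "concat (map fst rs)"] by simp
  with len have cen: "card centres \<le> L * k" by simp
  have "query_bounded (contraction_tree M) (length (Xs @ map (\<lambda>r. {r}) (concat (map fst rs))) + (L * k + M))"
    unfolding contraction_tree_def
  proof (rule query_bounded_query_all)
    fix f
    show "query_bounded (if card (loose f) < M then query_all (map (part f) (sorted_list_of_set (centres \<union> loose f)))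
          (\<lambda>g. Output (contracted_minimum f g)) (\<lambda>_ _. 0) else Output (n * n)) (L * k + M)"
    proof (cases "card (loose f) < M")
      case True
      have "length (map (part f) (sorted_list_of_set (centres \<union> loose f))) \<le> L * k + M"
        using card_Un_le[of centres "loose f"] cen True by simp
      moreover have "query_bounded (query_all (map (part f) (sorted_list_of_set (centres \<union> loose f)))
          (\<lambda>g. Output (contracted_minimum f g)) (\<lambda>_ _. 0))
          (length (map (part f) (sorted_list_of_set (centres \<union> loose f))) + 0)"
        by (rule query_bounded_query_all) simp
      ultimately show ?thesis using True query_bounded_mono by simp
    qed simp
  qed
  then show ?thesis by (rule query_bounded_mono) (use assms(1) len in simp)
qed

lemma contraction_tree_admissible:
  assumes "\<And>X. X \<in> set Xs \<Longrightarrow> X \<subseteq> {..<n}" "centres \<subseteq> {..<n}"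
  shows "admissible (Pow {..<n}) (contraction_tree M)"
  unfolding contraction_tree_def
proof (rule admissible_query_all)
  show "set (Xs @ map (\<lambda>r. {r}) (concat (map fst rs))) \<subseteq> Pow {..<n}"
    using assms by (fastforce simp: centres_def)
qed (auto intro!: admissible_query_all simp: part_def)

context
  fixes E :: "nat set set" and f g :: "nat set \<Rightarrow> nat \<Rightarrow> nat"
  assumes G: "simple_graph {..<n} E" and n2: "n \<ge> 2"
    and centres: "centres \<subseteq> {..<n}"
    and decodable: "\<And>v N. v < n \<Longrightarrow> candidate (crossing E) v N \<Longrightarrow> N = nbhd E v"
    and f: "\<And>X. X \<in> set Xs \<Longrightarrow> f X = crossing E X" "\<And>r. r \<in> centres \<Longrightarrow> f {r} = crossing E {r}"
    and g: "\<And>r. r \<in> centres \<union> loose f \<Longrightarrow> g (part f r) = crossing E (part f r)"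
begin

lemma candidate_f: "candidate f v N \<longleftrightarrow> candidate (crossing E) v N"
  using f(1) by (simp add: candidate_def)

lemma low_f: "low f = low (crossing E)"
  by (simp add: low_def candidate_f)

lemma decode_low: "v \<in> low f \<Longrightarrow> decode f v = nbhd E v"
  unfolding low_def decode_def by (metis (mono_tags, lifting) candidate_f decodable mem_Collect_eq someI)

lemma choice_joins: "choice (joins f) v rs = choice (\<lambda>r v. r \<in> nbhd E v) v rs"
proof (rule choice_cong)
  fix p r assume "p \<in> set rs" "r \<in> set (fst p)"
  then have r: "r \<in> centres" by (auto simp: centres_def)
  show "joins f r v \<longleftrightarrow> r \<in> nbhd E v"
    using crossing_singleton[OF G, of r v] nbhd_subset[OF G, of v]
    by (cases "r = v") (auto simp: joins_def f(2)[OF r])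
qed

lemma choice_centre: "choice adj v rs = Some r \<Longrightarrow> r \<in> centres"
  by (drule choice_SomeD) (auto simp: centres_def)

lemma known_crossing_eq:
  assumes "r < n" "w \<noteq> r"
  shows "known_crossing f g r w = crossing E (part f r) w"
proof -
  consider "r \<in> centres \<union> loose f" | "r \<notin> centres \<union> loose f" "r \<in> low f" | "r \<notin> centres \<union> loose f" "r \<notin> low f"
    by blast
  then show ?thesis
  proof cases
    case 1
    then show ?thesis by (simp add: known_crossing_def g)
  next
    case 2
    have "part f r = {r}"
      using 2 assms(1) choice_centre
      by (fastforce simp: part_def centre_of_def loose_def split: option.splits if_splits)
    then show ?thesis
      using 2 assms(2) crossing_singleton[OF G, of r w] nbhd_sym[of r E w]
      by (simp add: known_crossing_def decode_low)
  next
    case 3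
    have "part f r = {}"
      using 3 assms(1) choice_centre
      by (fastforce simp: part_def centre_of_def loose_def split: option.splits if_splits)
    then show ?thesis using 3 by (simp add: known_crossing_def crossing_def cut_edges_def)
  qed
qed

lemma cut_of_known_crossing:
  assumes "S \<subset> {..<n}" "\<And>v. v \<in> {..<n} \<Longrightarrow> centre_of f v \<in> S \<longleftrightarrow> v \<in> S"
  shows "(\<Sum>w\<in>{..<n} - S. \<Sum>r\<in>S. known_crossing f g r w) = card (cut_edges E S)"
proof -
  have "card (cut_edges E S) = (\<Sum>w\<in>{..<n} - S. \<Sum>r\<in>S. crossing E {v \<in> {..<n}. centre_of f v = r} w)"
    by (rule card_cut_edges_parts[OF G]) (use assms in auto)
  also have "\<dots> = (\<Sum>w\<in>{..<n} - S. \<Sum>r\<in>S. known_crossing f g r w)"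
  proof (intro sum.cong refl)
    fix w r assume "w \<in> {..<n} - S" "r \<in> S"
    then have "r < n" "w \<noteq> r" using assms(1) by auto
    then show "crossing E {v \<in> {..<n}. centre_of f v = r} w = known_crossing f g r w"
      by (simp add: known_crossing_eq part_def)
  qed
  finally show ?thesis ..
qed

lemma finite_contracted: "finite {\<Sum>w\<in>{..<n} - S. \<Sum>r\<in>S. known_crossing f g r w | S.
     S \<noteq> {} \<and> S \<subset> {..<n} \<and> (\<forall>v\<in>{..<n}. centre_of f v \<in> S \<longleftrightarrow> v \<in> S)}"
  by (rule finite_subset[of _ "(\<lambda>S. \<Sum>w\<in>{..<n} - S. \<Sum>r\<in>S. known_crossing f g r w) ` Pow {..<n}"]) auto

lemma contracted_minimum_ge: "edge_connectivity {..<n} E \<le> contracted_minimum f g"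
proof -
  have "edge_connectivity {..<n} E \<le> card (nbhd E 0)"
    using n2 by (intro edge_connectivity_le_card_nbhd[OF G]) auto
  also have "\<dots> \<le> card {..<n}" using nbhd_subset[OF G, of 0] by (intro card_mono) auto
  finally have triv: "edge_connectivity {..<n} E \<le> n * n" using n2 by (simp add: le_trans)
  have cuts: "edge_connectivity {..<n} E \<le> (\<Sum>w\<in>{..<n} - S. \<Sum>r\<in>S. known_crossing f g r w)"
    if "S \<noteq> {}" "S \<subset> {..<n}" "\<forall>v\<in>{..<n}. centre_of f v \<in> S \<longleftrightarrow> v \<in> S" for S
  proof -
    have "(\<Sum>w\<in>{..<n} - S. \<Sum>r\<in>S. known_crossing f g r w) = card (cut_edges E S)"
      by (rule cut_of_known_crossing) (use that in blast)+
    then show ?thesis using edge_connectivity_le[OF finite_lessThan that(1,2), of E] by (simp only:)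
  qed
  show ?thesis
    unfolding contracted_minimum_def
  proof (rule Min.boundedI)
    fix a assume "a \<in> insert (n * n) {\<Sum>w\<in>{..<n} - S. \<Sum>r\<in>S. known_crossing f g r w | S.
      S \<noteq> {} \<and> S \<subset> {..<n} \<and> (\<forall>v\<in>{..<n}. centre_of f v \<in> S \<longleftrightarrow> v \<in> S)}"
    then show "edge_connectivity {..<n} E \<le> a" using triv cuts by blast
  qed (use finite_contracted in simp_all)
qed

lemma contracted_minimum_le:
  assumes S: "S \<noteq> {}" "S \<subset> {..<n}" "card (cut_edges E S) = edge_connectivity {..<n} E"
    and obeys: "\<And>v. v \<in> {..<n} - low f \<Longrightarrow> obeys (\<lambda>r v. r \<in> nbhd E v) S v rs"
  shows "contracted_minimum f g \<le> edge_connectivity {..<n} E"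
proof -
  have "centre_of f v \<in> S \<longleftrightarrow> v \<in> S" if v: "v \<in> {..<n}" for v
  proof (cases "v \<in> low f")
    case False
    then show ?thesis
      using obeys[of v] v by (auto simp: centre_of_def obeys_def choice_joins split: option.splits)
  qed (simp add: centre_of_def)
  then have "edge_connectivity {..<n} E \<in> {\<Sum>w\<in>{..<n} - S. \<Sum>r\<in>S. known_crossing f g r w | S.
     S \<noteq> {} \<and> S \<subset> {..<n} \<and> (\<forall>v\<in>{..<n}. centre_of f v \<in> S \<longleftrightarrow> v \<in> S)}"
    using S cut_of_known_crossing[OF S(2)] by (intro CollectI exI[of _ S]) auto
  then show ?thesis
    unfolding contracted_minimum_def using finite_contracted by (intro Min_le) auto
qed

end

text \<open>The first claim makes every error one-sided, which lets independent runs be combined by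
  their minimum. In the second, \<open>obeys\<close> for the vertices that are not low says that
  \<open>S\<close> separates no cluster, and the bound \<open>M\<close> keeps the run from giving
  up.\<close>

lemma contraction_tree_correct:
  assumes G: "simple_graph {..<n} E" and n2: "n \<ge> 2" and centres: "centres \<subseteq> {..<n}"
    and decodable: "\<And>v N. v < n \<Longrightarrow> candidate (crossing E) v N \<Longrightarrow> N = nbhd E v"
  shows "edge_connectivity {..<n} E \<le> tree_output (crossing E) (contraction_tree M)"
    and "S \<noteq> {} \<Longrightarrow> S \<subset> {..<n} \<Longrightarrow> card (cut_edges E S) = edge_connectivity {..<n} E \<Longrightarrow>
      (\<And>v. v \<in> {..<n} - low (crossing E) \<Longrightarrow> obeys (\<lambda>r v. r \<in> nbhd E v) S v rs) \<Longrightarrow>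
      card {v \<in> {..<n} - low (crossing E). choice (\<lambda>r v. r \<in> nbhd E v) v rs = None} < M \<Longrightarrow>
      tree_output (crossing E) (contraction_tree M) \<le> edge_connectivity {..<n} E"
proof -
  define qs where "qs = Xs @ map (\<lambda>r. {r}) (concat (map fst rs))"
  define f where "f X = (if X \<in> set qs then crossing E X else (\<lambda>_. 0))" for X
  define ps where "ps = map (part f) (sorted_list_of_set (centres \<union> loose f))"
  define g where "g X = (if X \<in> set ps then crossing E X else (\<lambda>_. 0))" for X
  have f: "\<And>X. X \<in> set Xs \<Longrightarrow> f X = crossing E X" "\<And>r. r \<in> centres \<Longrightarrow> f {r} = crossing E {r}"
    by (auto simp: f_def qs_def centres_def)
  have "finite (centres \<union> loose f)" using centres by (auto simp: loose_def intro: finite_subset)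
  then have g: "\<And>r. r \<in> centres \<union> loose f \<Longrightarrow> g (part f r) = crossing E (part f r)"
    by (simp add: g_def ps_def)
  have out: "tree_output (crossing E) (contraction_tree M)
     = (if card (loose f) < M then contracted_minimum f g else n * n)"
    unfolding contraction_tree_def qs_def[symmetric]
    by (simp add: tree_output_query_all flip: f_def ps_def g_def)
  have "edge_connectivity {..<n} E \<le> card (nbhd E 0)"
    using n2 by (intro edge_connectivity_le_card_nbhd[OF G]) auto
  also have "\<dots> \<le> card {..<n}" using nbhd_subset[OF G, of 0] by (intro card_mono) auto
  finally have "edge_connectivity {..<n} E \<le> n * n" using n2 by (simp add: le_trans)
  then show "edge_connectivity {..<n} E \<le> tree_output (crossing E) (contraction_tree M)"
    using contracted_minimum_ge[OF G n2 centres decodable f g] by (simp add: out)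
  assume S: "S \<noteq> {}" "S \<subset> {..<n}" "card (cut_edges E S) = edge_connectivity {..<n} E"
    and obeys: "\<And>v. v \<in> {..<n} - low (crossing E) \<Longrightarrow> obeys (\<lambda>r v. r \<in> nbhd E v) S v rs"
    and few: "card {v \<in> {..<n} - low (crossing E). choice (\<lambda>r v. r \<in> nbhd E v) v rs = None} < M"
  have low: "low f = low (crossing E)"
    by (rule low_f[OF G n2 centres decodable f g])
  have joins: "choice (joins f) v rs = choice (\<lambda>r v. r \<in> nbhd E v) v rs" for v
    by (rule choice_joins[OF G n2 centres decodable f g])
  have loose: "loose f = {v \<in> {..<n} - low (crossing E). choice (\<lambda>r v. r \<in> nbhd E v) v rs = None}"
    unfolding loose_def low joins ..
  have "contracted_minimum f g \<le> edge_connectivity {..<n} E"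
    by (rule contracted_minimum_le[OF G n2 centres decodable f g S]) (use obeys low in blast)+
  then show "tree_output (crossing E) (contraction_tree M) \<le> edge_connectivity {..<n} E"
    using few by (simp only: out loose if_True)
qed

end

section \<open>Decoding small neighbourhoods from random crossing numbers\<close>

lemma card_small_subsets:
  assumes "finite V"
  shows "card {N. N \<subseteq> V \<and> card N \<le> \<tau>} \<le> (card V + 1) ^ \<tau>"
proof (induction \<tau>)
  case 0
  have "{N. N \<subseteq> V \<and> card N \<le> 0} = {{}}" using assms by (auto dest: finite_subset)
  then show ?case by simp
next
  case (Suc \<tau>)
  let ?S = "{N. N \<subseteq> V \<and> card N \<le> \<tau>}"
  \<comment> \<open>In each of the \<open>\<tau>\<close> steps one of \<open>card V\<close> elements
    is added or none, hence the base \<open>card V + 1\<close>.\<close>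
  let ?f = "\<lambda>(x, N). case x of None \<Rightarrow> N | Some v \<Rightarrow> insert v N"
  have fin: "finite ?S" using assms by simp
  have "{N. N \<subseteq> V \<and> card N \<le> Suc \<tau>} \<subseteq> ?f ` (insert None (Some ` V) \<times> ?S)"
  proof
    fix N assume N: "N \<in> {N. N \<subseteq> V \<and> card N \<le> Suc \<tau>}"
    then have finN: "finite N" using assms by (auto intro: finite_subset)
    show "N \<in> ?f ` (insert None (Some ` V) \<times> ?S)"
    proof (cases "card N \<le> \<tau>")
      case True
      then show ?thesis using N by (intro image_eqI[of _ _ "(None, N)"]) auto
    next
      case False
      then obtain v where v: "v \<in> N" by fastforce
      then have "card (N - {v}) \<le> \<tau>" using N finN by (auto simp: card_Diff_singleton)
      then show ?thesis using N v by (intro image_eqI[of _ _ "(Some v, N - {v})"]) auto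
    qed
  qed
  then have "card {N. N \<subseteq> V \<and> card N \<le> Suc \<tau>} \<le> card (?f ` (insert None (Some ` V) \<times> ?S))"
    using assms fin by (intro card_mono) auto
  also have "\<dots> \<le> card (insert None (Some ` V) \<times> ?S)" using assms fin by (intro card_image_le) auto
  also have "\<dots> = (card V + 1) * card ?S"
    using assms by (simp add: card_cartesian_product card_image)
  also have "\<dots> \<le> (card V + 1) * (card V + 1) ^ \<tau>" using Suc by (intro mult_left_mono) auto
  finally show ?case by simp
qed

text \<open>Toggling \<open>u\<close> changes only whether \<open>u\<close> is separated from
  \<open>v\<close>, so the count changes by 1 if \<open>u \<in> N\<close> and not at all
  otherwise.\<close>

lemma card_split_toggle:
  fixes X :: "'v set"
  assumes "finite N" "u \<noteq> v"
  defines "X' \<equiv> (if u \<in> X then X - {u} else insert u X)"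
  shows "even (card {w \<in> N. (w \<in> X') \<noteq> (v \<in> X')}) = (even (card {w \<in> N. (w \<in> X) \<noteq> (v \<in> X)}) \<noteq> (u \<in> N))"
proof -
  define D where "D = {w \<in> N. (w \<in> X) \<noteq> (v \<in> X)}"
  have fin: "finite D" using assms(1) by (simp add: D_def)
  consider "u \<notin> N" | "u \<in> N" "u \<in> D" | "u \<in> N" "u \<notin> D" by blast
  then show ?thesis
  proof cases
    case 1
    then have "{w \<in> N. (w \<in> X') \<noteq> (v \<in> X')} = D" using assms(2) by (auto simp: X'_def D_def)
    then show ?thesis using 1 by (simp add: D_def)
  next
    case 2
    then have eq: "{w \<in> N. (w \<in> X') \<noteq> (v \<in> X')} = D - {u}" using assms(2) by (auto simp: X'_def D_def)
    have "card D = Suc (card (D - {u}))" using 2 fin by (metis card.remove)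
    then show ?thesis unfolding eq D_def[symmetric] using 2 by simp
  next
    case 3
    then have eq: "{w \<in> N. (w \<in> X') \<noteq> (v \<in> X')} = insert u D" using assms(2) by (auto simp: X'_def D_def)
    have "card (insert u D) = Suc (card D)" using 3 fin by simp
    then show ?thesis unfolding eq D_def[symmetric] using 3 by simp
  qed
qed

text \<open>Choose \<open>u\<close> in the symmetric difference of \<open>N\<close> and the true
  neighbourhood. Toggling \<open>u\<close> in \<open>X\<close> flips the parity of just one of the
  two numbers, so at most one set of each pair can make them equal.\<close>

lemma wrong_neighbourhood_prob:
  fixes n :: nat
  assumes G: "simple_graph {..<n} E" and N: "N \<subseteq> {..<n} - {v}" "N \<noteq> nbhd E v"
  shows "measure_pmf.expectation (pmf_of_set (Pow {..<n}))
     (\<lambda>X. of_bool (card {u \<in> N. (u \<in> X) \<noteq> (v \<in> X)} = crossing E X v)) \<le> (1 / 2 :: real)"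
proof -
  define P where "P X \<longleftrightarrow> card {u \<in> N. (u \<in> X) \<noteq> (v \<in> X)} = crossing E X v" for X
  obtain u where u: "(u \<in> N) \<noteq> (u \<in> nbhd E v)" using N(2) by blast
  have uV: "u < n" "u \<noteq> v" using u N nbhd_subset[OF G, of v] by auto
  define t where "t X = (if u \<in> X then X - {u} else insert u X)" for X
  have finN: "finite N" using N(1) by (rule finite_subset) auto
  have tP: "\<not> P (t X)" if "P X" for X
  proof
    assume "P (t X)"
    have "even (card {w \<in> N. (w \<in> t X) \<noteq> (v \<in> t X)}) = (even (card {w \<in> N. (w \<in> X) \<noteq> (v \<in> X)}) \<noteq> (u \<in> N))"
      unfolding t_def by (rule card_split_toggle[OF finN uV(2)])
    moreover have "even (crossing E (t X) v) = (even (crossing E X v) \<noteq> (u \<in> nbhd E v))"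
      unfolding t_def crossing_eq_card_nbhd[OF G] by (rule card_split_toggle[OF finite_nbhd[OF G] uV(2)])
    ultimately show False using \<open>P (t X)\<close> \<open>P X\<close> u unfolding P_def by auto
  qed
  define A where "A = {X \<in> Pow {..<n}. P X}"
  have A: "A \<subseteq> Pow {..<n}" by (auto simp: A_def)
  have finA: "finite A" using A by (rule finite_subset) auto
  have "t ` A \<subseteq> Pow {..<n} - A"
  proof (rule image_subsetI)
    fix X assume X: "X \<in> A"
    have "t X \<subseteq> {..<n}" using X uV(1) by (auto simp: A_def t_def split: if_splits)
    moreover have "\<not> P (t X)" using tP X by (simp add: A_def)
    ultimately show "t X \<in> Pow {..<n} - A" by (simp add: A_def)
  qed
  then have "card (t ` A) \<le> card (Pow {..<n} - A)" by (intro card_mono) auto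
  moreover have "inj_on t A" by (rule inj_on_inverseI[of _ t]) (auto simp: t_def)
  ultimately have "card A \<le> card (Pow {..<n} - A)" by (simp add: card_image)
  also have "\<dots> = 2 ^ n - card A" using A finA by (subst card_Diff_subset) (auto simp: card_Pow)
  finally have "2 * card A \<le> 2 ^ n" by simp
  then have "2 * real (card A) \<le> 2 ^ n" by (simp flip: of_nat_le_iff[where ?'a = real])
  moreover have "measure_pmf.expectation (pmf_of_set (Pow {..<n})) (\<lambda>X. of_bool (P X)) = real (card A) / 2 ^ n"
    unfolding A_def by (subst integral_pmf_of_set) (auto simp: card_Pow sum_of_bool_eq intro!: arg_cong[where f = card])
  ultimately have "measure_pmf.expectation (pmf_of_set (Pow {..<n})) (\<lambda>X. of_bool (P X)) \<le> (1 / 2 :: real)"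
    by (simp add: divide_le_eq)
  then show ?thesis unfolding P_def .
qed

definition decodable :: "nat \<Rightarrow> nat \<Rightarrow> nat set set \<Rightarrow> nat set list \<Rightarrow> bool" where
  "decodable n \<tau> E Xs \<longleftrightarrow> (\<forall>v<n. \<forall>N. candidate n \<tau> Xs (crossing E) v N \<longrightarrow> N = nbhd E v)"

text \<open>Union bound over \<open>v\<close> and all wrong sets of at most \<open>\<tau>\<close>
  vertices. For a vertex of degree above \<open>\<tau>\<close> every such set is wrong, so the bound
  also excludes that it is taken for a low one.\<close>

lemma not_decodable_prob:
  assumes G: "simple_graph {..<n} E" and n: "n > 0"
  shows "measure_pmf.expectation (replicate_pmf q (pmf_of_set (Pow {..<n}))) (\<lambda>Xs. of_bool (\<not> decodable n \<tau> E Xs))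
    \<le> real n * (real n + 1) ^ \<tau> / 2 ^ q"
proof -
  define \<N> where "\<N> v = {N. N \<subseteq> {..<n} - {v} \<and> card N \<le> \<tau> \<and> N \<noteq> nbhd E v}" for v
  define P where "P v N X \<longleftrightarrow> card {u \<in> N. (u \<in> X) \<noteq> (v \<in> X)} = crossing E X v" for v N X
  let ?p = "pmf_of_set (Pow {..<n})"
  have finp: "finite (set_pmf ?p)" by (rule finite_uniform(2)[OF n])
  have finr: "finite (set_pmf (replicate_pmf q ?p))" by (rule finite_set_replicate_pmf[OF finp])
  have sub: "\<N> v \<subseteq> {N. N \<subseteq> {..<n} \<and> card N \<le> \<tau>}" for v by (auto simp: \<N>_def)
  have fin: "finite (\<N> v)" for v by (rule finite_subset[OF sub]) simp
  have card: "card (\<N> v) \<le> (n + 1) ^ \<tau>" for v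
    using card_mono[OF _ sub, of v] card_small_subsets[of "{..<n}" \<tau>] by simp
  have bound: "of_bool (\<not> decodable n \<tau> E Xs) \<le> (\<Sum>v<n. \<Sum>N\<in>\<N> v. of_bool (\<forall>X\<in>set Xs. P v N X) :: real)" for Xs
  proof (cases "decodable n \<tau> E Xs")
    case False
    then obtain v N where vN: "v < n" "candidate n \<tau> Xs (crossing E) v N" "N \<noteq> nbhd E v"
      unfolding decodable_def by blast
    then have N: "N \<in> \<N> v" and P: "\<forall>X\<in>set Xs. P v N X" by (auto simp: \<N>_def P_def candidate_def)
    have "1 = (of_bool (\<forall>X\<in>set Xs. P v N X) :: real)" using P by simp
    also have "\<dots> \<le> (\<Sum>N\<in>\<N> v. of_bool (\<forall>X\<in>set Xs. P v N X))" using fin N by (intro member_le_sum) auto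
    also have "\<dots> \<le> (\<Sum>v<n. \<Sum>N\<in>\<N> v. of_bool (\<forall>X\<in>set Xs. P v N X))"
      using vN(1) by (intro member_le_sum[of v "{..<n}" "\<lambda>v. \<Sum>N\<in>\<N> v. of_bool (\<forall>X\<in>set Xs. P v N X)"] sum_nonneg) auto
    finally show ?thesis using False by simp
  qed (auto intro!: sum_nonneg)
  have "measure_pmf.expectation (replicate_pmf q ?p) (\<lambda>Xs. of_bool (\<not> decodable n \<tau> E Xs))
     \<le> measure_pmf.expectation (replicate_pmf q ?p) (\<lambda>Xs. \<Sum>v<n. \<Sum>N\<in>\<N> v. of_bool (\<forall>X\<in>set Xs. P v N X) :: real)"
    by (rule expectation_mono_finite[OF finr bound])
  also have "\<dots> = (\<Sum>v<n. \<Sum>N\<in>\<N> v. measure_pmf.expectation (replicate_pmf q ?p) (\<lambda>Xs. of_bool (\<forall>X\<in>set Xs. P v N X)))"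
    by (simp add: Bochner_Integration.integral_sum integrable_measure_pmf_finite[OF finr])
  also have "\<dots> \<le> (\<Sum>v<n. \<Sum>N\<in>\<N> v. (1 / 2) ^ q)"
  proof (intro sum_mono)
    fix v N assume "N \<in> \<N> v"
    then have "measure_pmf.expectation ?p (\<lambda>X. of_bool (P v N X)) \<le> (1 / 2 :: real)"
      unfolding P_def \<N>_def by (intro wrong_neighbourhood_prob[OF G]) auto
    moreover have "0 \<le> measure_pmf.expectation ?p (\<lambda>X. of_bool (P v N X) :: real)"
      by (intro Bochner_Integration.integral_nonneg) auto
    ultimately show "measure_pmf.expectation (replicate_pmf q ?p) (\<lambda>Xs. of_bool (\<forall>X\<in>set Xs. P v N X)) \<le> (1 / 2 :: real) ^ q"
      unfolding expectation_replicate_all[OF finp] by (intro power_mono)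
  qed
  also have "\<dots> = (\<Sum>v<n. real (card (\<N> v)) * (1 / 2) ^ q)" by simp
  also have "\<dots> \<le> (\<Sum>v<n. (real n + 1) ^ \<tau> * (1 / 2) ^ q)"
  proof (intro sum_mono mult_right_mono)
    fix v show "real (card (\<N> v)) \<le> (real n + 1) ^ \<tau>"
      using of_nat_mono[OF card[of v], where ?'a = real] by (simp add: add.commute)
  qed simp
  also have "\<dots> = real n * (real n + 1) ^ \<tau> / 2 ^ q" by (simp add: power_divide)
  finally show ?thesis .
qed

section \<open>Success probability of one contraction\<close>

definition contraction_pmf :: "nat \<Rightarrow> nat \<Rightarrow> nat \<Rightarrow> nat \<Rightarrow> nat \<Rightarrow> nat \<Rightarrow> (nat set, nat \<Rightarrow> nat, nat) decision_tree pmf" where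
  "contraction_pmf n \<tau> M q L k = map_pmf (\<lambda>(Xs, rs). contraction_tree n \<tau> Xs rs M)
     (pair_pmf (replicate_pmf q (pmf_of_set (Pow {..<n}))) (replicate_pmf L (round_pmf n k)))"

context
  fixes n :: nat
  assumes n: "n \<ge> 2"
begin

lemma n_pos: "n > 0" using n by simp

lemma set_uniform: "set_pmf (pmf_of_set {..<n}) = {..<n}" "set_pmf (pmf_of_set (Pow {..<n})) = Pow {..<n}"
  using n by (subst set_pmf_of_set; auto simp: lessThan_empty_iff)+

lemma set_rounds:
  assumes "rs \<in> set_pmf (replicate_pmf L (round_pmf n k))"
  shows "length rs = L" "\<And>p. p \<in> set rs \<Longrightarrow> length (fst p) = k" "centres rs \<subseteq> {..<n}"
proof -
  have *: "length rs = L" "\<And>p. p \<in> set rs \<Longrightarrow> p \<in> set_pmf (round_pmf n k)"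
    using assms by (auto simp: set_replicate_pmf)
  have p: "set (fst p) \<subseteq> {..<n} \<and> length (fst p) = k" if "p \<in> set rs" for p
    using *(2)[OF that] by (auto simp: round_pmf_def set_replicate_pmf set_uniform lists_eq_set)
  show "length rs = L" "\<And>p. p \<in> set rs \<Longrightarrow> length (fst p) = k" using * p by auto
  show "centres rs \<subseteq> {..<n}" using p unfolding centres_def by blast
qed

lemma contraction_pmf_tree:
  assumes "t \<in> set_pmf (contraction_pmf n \<tau> M q L k)"
  shows "query_bounded t (q + 2 * (L * k) + M)" "admissible (Pow {..<n}) t"
proof -
  obtain Xs rs where t: "t = contraction_tree n \<tau> Xs rs M"
    and Xs: "Xs \<in> set_pmf (replicate_pmf q (pmf_of_set (Pow {..<n})))"
    and rs: "rs \<in> set_pmf (replicate_pmf L (round_pmf n k))"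
    using assms by (auto simp: contraction_pmf_def)
  have "length Xs = q" "\<And>X. X \<in> set Xs \<Longrightarrow> X \<subseteq> {..<n}"
    using Xs by (auto simp: set_replicate_pmf set_uniform)
  then show "query_bounded t (q + 2 * (L * k) + M)" "admissible (Pow {..<n}) t"
    unfolding t using set_rounds[OF rs]
    by (auto intro!: contraction_tree_bounded contraction_tree_admissible)
qed

lemma finite_contraction_pmf: "finite (set_pmf (contraction_pmf n \<tau> M q L k))"
  unfolding contraction_pmf_def
  by (auto intro!: finite_imageI finite_cartesian_product finite_set_replicate_pmf finite_uniform finite_round n_pos)

lemma expectation_contraction:
  fixes h :: "_ \<Rightarrow> real"
  shows "measure_pmf.expectation (contraction_pmf n \<tau> M q L k) h
    = measure_pmf.expectation (replicate_pmf q (pmf_of_set (Pow {..<n}))) (\<lambda>Xs.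
        measure_pmf.expectation (replicate_pmf L (round_pmf n k)) (\<lambda>rs. h (contraction_tree n \<tau> Xs rs M)))"
  unfolding contraction_pmf_def integral_map_pmf
  by (subst expectation_pair) (auto intro!: finite_set_replicate_pmf finite_uniform finite_round n_pos)

context
  fixes E :: "nat set set"
  assumes G: "simple_graph {..<n} E"
begin

lemma decodable_prob:
  "1 - real n * (real n + 1) ^ \<tau> / 2 ^ q
   \<le> measure_pmf.expectation (replicate_pmf q (pmf_of_set (Pow {..<n}))) (\<lambda>Xs. of_bool (decodable n \<tau> E Xs))"
proof -
  let ?p = "replicate_pmf q (pmf_of_set (Pow {..<n}))"
  have fin: "finite (set_pmf ?p)" by (intro finite_set_replicate_pmf finite_uniform n_pos)
  have "measure_pmf.expectation ?p (\<lambda>Xs. of_bool (decodable n \<tau> E Xs) :: real)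
     = measure_pmf.expectation ?p (\<lambda>Xs. 1 - of_bool (\<not> decodable n \<tau> E Xs))"
    by (intro Bochner_Integration.integral_cong) auto
  also have "\<dots> = 1 - measure_pmf.expectation ?p (\<lambda>Xs. of_bool (\<not> decodable n \<tau> E Xs))"
    by (subst Bochner_Integration.integral_diff) (auto intro: integrable_measure_pmf_finite[OF fin])
  finally show ?thesis using not_decodable_prob[OF G n_pos, of q \<tau>] by linarith
qed

lemma contraction_ge_prob:
  "1 - real n * (real n + 1) ^ \<tau> / 2 ^ q \<le> measure_pmf.expectation (contraction_pmf n \<tau> M q L k)
     (\<lambda>t. of_bool (edge_connectivity {..<n} E \<le> tree_output (crossing E) t))"
proof -
  have "measure_pmf.expectation (replicate_pmf q (pmf_of_set (Pow {..<n}))) (\<lambda>Xs. of_bool (decodable n \<tau> E Xs))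
    \<le> measure_pmf.expectation (contraction_pmf n \<tau> M q L k)
     (\<lambda>t. of_bool (edge_connectivity {..<n} E \<le> tree_output (crossing E) t) :: real)"
    unfolding expectation_contraction
  proof (rule expectation_mono_finite)
    fix Xs
    show "(of_bool (decodable n \<tau> E Xs) :: real) \<le> measure_pmf.expectation (replicate_pmf L (round_pmf n k))
       (\<lambda>rs. of_bool (edge_connectivity {..<n} E \<le> tree_output (crossing E) (contraction_tree n \<tau> Xs rs M)))"
    proof (cases "decodable n \<tau> E Xs")
      case True
      have "measure_pmf.expectation (replicate_pmf L (round_pmf n k)) (\<lambda>_. 1 :: real)
        \<le> measure_pmf.expectation (replicate_pmf L (round_pmf n k))
       (\<lambda>rs. of_bool (edge_connectivity {..<n} E \<le> tree_output (crossing E) (contraction_tree n \<tau> Xs rs M)))"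
      proof (rule expectation_mono_finite[OF finite_round(2)[OF n_pos]])
        fix rs assume "rs \<in> set_pmf (replicate_pmf L (round_pmf n k))"
        then show "1 \<le> (of_bool (edge_connectivity {..<n} E \<le> tree_output (crossing E) (contraction_tree n \<tau> Xs rs M)) :: real)"
          using contraction_tree_correct(1)[OF G n set_rounds(3)] True unfolding decodable_def by simp
      qed
      then show ?thesis using True by simp
    qed (auto intro!: Bochner_Integration.integral_nonneg)
  qed (auto intro!: finite_set_replicate_pmf finite_uniform n_pos)
  then show ?thesis using decodable_prob[of \<tau> q] by linarith
qed

text \<open>The sets \<open>Xs\<close> and the rounds are independent: for decodable
  \<open>Xs\<close> the rounds succeed with probability at least \<open>1 / 256 - 2 / M\<close>,
  hence at least \<open>1 / 512\<close>.\<close>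

lemma contraction_eq_prob:
  assumes nontrivial: "\<And>v. v < n \<Longrightarrow> edge_connectivity {..<n} E < card (nbhd E v)"
    and M: "2 / real M \<le> 1 / 512" "M > 0" and miss: "(1 - real \<tau> / real n) ^ k \<le> 1 / real n" "\<tau> \<le> n"
    and L: "real n \<le> 2 ^ L"
  shows "(1 - real n * (real n + 1) ^ \<tau> / 2 ^ q) / 512 \<le> measure_pmf.expectation (contraction_pmf n \<tau> M q L k)
     (\<lambda>t. of_bool (tree_output (crossing E) t = edge_connectivity {..<n} E))"
proof -
  obtain S where S: "S \<noteq> {}" "S \<subset> {..<n}" "card (cut_edges E S) = edge_connectivity {..<n} E"
    using edge_connectivity_attained[of "{..<n}" E] n by auto
  have half: "2 * crossing E S v \<le> card (nbhd E v)" if "v < n" for v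
    using minimum_cut_crossing[OF G _ S] nontrivial that n by simp
  define c where "c v = real (crossing E S v) / card (nbhd E v)" for v
  have pos: "0 < card (nbhd E v)" if "v < n" for v using nontrivial[OF that] by simp
  \<comment> \<open>All degrees are at least the edge connectivity \<open>l\<close>, while the
    crossing numbers of the minimum cut sum up to \<open>2 * l\<close>; for \<open>l = 0\<close>
    there is nothing to cross.\<close>
  have sum_c: "(\<Sum>v<n. c v) \<le> 2"
  proof -
    define l where "l = real (edge_connectivity {..<n} E)"
    have total: "(\<Sum>v<n. real (crossing E S v)) = 2 * l"
      using sum_crossing_all[OF G, of S] S(3) by (simp add: l_def flip: of_nat_sum)
    show ?thesis
    proof (cases "l = 0")
      case True
      then have "\<forall>v\<in>{..<n}. crossing E S v = 0" using total by (simp add: sum_nonneg_eq_0_iff)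
      then show ?thesis by (simp add: c_def)
    next
      case False
      then have "l > 0" by (simp add: l_def)
      have "(\<Sum>v<n. c v) \<le> (\<Sum>v<n. real (crossing E S v) / l)"
        unfolding c_def using nontrivial \<open>l > 0\<close> by (intro sum_mono divide_left_mono) (auto simp: l_def less_imp_le intro!: mult_pos_pos pos)
      also have "\<dots> = 2" using total False by (simp flip: sum_divide_distrib)
      finally show ?thesis .
    qed
  qed
  have nb: "{r. r < n \<and> r \<in> nbhd E v} = nbhd E v" for v using nbhd_subset[OF G, of v] by auto
  have nbS: "{r. r < n \<and> r \<in> nbhd E v \<and> (r \<in> S) \<noteq> (v \<in> S)} = {r \<in> nbhd E v. (r \<in> S) \<noteq> (v \<in> S)}" for v
    using nbhd_subset[OF G, of v] by auto
  have inner: "(1 / 512 :: real) \<le> measure_pmf.expectation (replicate_pmf L (round_pmf n k))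
       (\<lambda>rs. of_bool (tree_output (crossing E) (contraction_tree n \<tau> Xs rs M) = edge_connectivity {..<n} E))"
    if dec: "decodable n \<tau> E Xs" for Xs
  proof -
    define U where "U = {..<n} - low n \<tau> Xs (crossing E)"
    have U: "U \<subseteq> {..<n}" by (auto simp: U_def)
    \<comment> \<open>A true neighbourhood of at most \<open>\<tau>\<close> vertices is always a
      candidate, so vertices that are not low have large degree.\<close>
    have high: "\<tau> < card (nbhd E v)" if "v \<in> U" for v
    proof (rule ccontr)
      assume "\<not> \<tau> < card (nbhd E v)"
      then have "candidate n \<tau> Xs (crossing E) v (nbhd E v)"
        using nbhd_subset[OF G, of v] by (auto simp: candidate_def crossing_eq_card_nbhd[OF G])
      then show False using that by (auto simp: U_def low_def)
    qed
    have "1 / 256 - 2 / real M \<le> measure_pmf.expectation (replicate_pmf L (round_pmf n k))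
       (\<lambda>ps. of_bool ((\<forall>v\<in>U. obeys (\<lambda>r v. r \<in> nbhd E v) S v ps) \<and> card {v \<in> U. choice (\<lambda>r v. r \<in> nbhd E v) v ps = None} < M))"
    proof (rule contraction_prob[OF n_pos U M(2), where q = c])
      fix v assume v: "v \<in> U"
      then have vn: "v < n" using U by auto
      show "0 \<le> c v" by (simp add: c_def)
      have "2 * real (crossing E S v) \<le> real (card (nbhd E v))"
        using of_nat_mono[OF half[OF vn], where ?'a = real] by simp
      then show "c v \<le> 1 / 2" using pos[OF vn] by (simp add: c_def field_simps)
      show "real (card {r. r < n \<and> r \<in> nbhd E v \<and> (r \<in> S) \<noteq> (v \<in> S)}) \<le> c v * real (card {r. r < n \<and> r \<in> nbhd E v})"
        unfolding nb nbS using pos[OF vn] by (simp add: c_def crossing_eq_card_nbhd[OF G])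
      show "0 < card {r. r < n \<and> r \<in> nbhd E v}" unfolding nb using pos[OF vn] .
      have "card (nbhd E v) \<le> card {..<n}" using nbhd_subset[OF G, of v] by (intro card_mono) auto
      then have "(1 - real (card (nbhd E v)) / real n) ^ k \<le> (1 - real \<tau> / real n) ^ k"
        using high[OF v] n by (intro power_mono diff_left_mono divide_right_mono) auto
      then show "(1 - real (card {r. r < n \<and> r \<in> nbhd E v}) / real n) ^ k \<le> 1 / real n"
        unfolding nb using miss(1) by linarith
    next
      have "(\<Sum>v\<in>U. c v) \<le> (\<Sum>v<n. c v)" using U by (intro sum_mono2) (auto simp: c_def)
      then show "(\<Sum>v\<in>U. c v) \<le> 2" using sum_c by linarith
    qed (use L in auto)
    also have "\<dots> \<le> measure_pmf.expectation (replicate_pmf L (round_pmf n k))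
       (\<lambda>rs. of_bool (tree_output (crossing E) (contraction_tree n \<tau> Xs rs M) = edge_connectivity {..<n} E))"
    proof (rule expectation_mono_finite[OF finite_round(2)[OF n_pos]])
      fix rs assume "rs \<in> set_pmf (replicate_pmf L (round_pmf n k))"
      note rs = set_rounds(3)[OF this]
      have dec': "\<And>v N. v < n \<Longrightarrow> candidate n \<tau> Xs (crossing E) v N \<Longrightarrow> N = nbhd E v"
        using dec unfolding decodable_def by blast
      have "tree_output (crossing E) (contraction_tree n \<tau> Xs rs M) = edge_connectivity {..<n} E"
        if "\<forall>v\<in>U. obeys (\<lambda>r v. r \<in> nbhd E v) S v rs" "card {v \<in> U. choice (\<lambda>r v. r \<in> nbhd E v) v rs = None} < M"
        using contraction_tree_correct(1)[OF G n rs dec', where M = M]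
          contraction_tree_correct(2)[OF G n rs dec' S, where M = M] that unfolding U_def by (meson le_antisym)
      then show "of_bool ((\<forall>v\<in>U. obeys (\<lambda>r v. r \<in> nbhd E v) S v rs) \<and> card {v \<in> U. choice (\<lambda>r v. r \<in> nbhd E v) v rs = None} < M)
        \<le> (of_bool (tree_output (crossing E) (contraction_tree n \<tau> Xs rs M) = edge_connectivity {..<n} E) :: real)"
        by auto
    qed
    finally show ?thesis using M(1) by linarith
  qed
  have fin: "finite (set_pmf (replicate_pmf q (pmf_of_set (Pow {..<n}))))"
    by (intro finite_set_replicate_pmf finite_uniform n_pos)
  have "(1 - real n * (real n + 1) ^ \<tau> / 2 ^ q) / 512
    \<le> measure_pmf.expectation (replicate_pmf q (pmf_of_set (Pow {..<n}))) (\<lambda>Xs. of_bool (decodable n \<tau> E Xs)) / 512"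
    using decodable_prob[of \<tau> q] by (intro divide_right_mono) auto
  also have "\<dots> = measure_pmf.expectation (replicate_pmf q (pmf_of_set (Pow {..<n}))) (\<lambda>Xs. of_bool (decodable n \<tau> E Xs) / 512)"
    by simp
  also have "\<dots> \<le> measure_pmf.expectation (contraction_pmf n \<tau> M q L k)
     (\<lambda>t. of_bool (tree_output (crossing E) t = edge_connectivity {..<n} E))"
    unfolding expectation_contraction
  proof (rule expectation_mono_finite[OF fin])
    fix Xs
    show "of_bool (decodable n \<tau> E Xs) / 512 \<le> measure_pmf.expectation (replicate_pmf L (round_pmf n k))
       (\<lambda>rs. of_bool (tree_output (crossing E) (contraction_tree n \<tau> Xs rs M) = edge_connectivity {..<n} E) :: real)"
      using inner[of Xs] by (cases "decodable n \<tau> E Xs") (auto intro!: Bochner_Integration.integral_nonneg)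
  qed
  finally show ?thesis .
qed

end

end

section \<open>Amplification\<close>

primrec then_min :: "nat \<Rightarrow> ('q, 'a, nat) decision_tree \<Rightarrow> ('q, 'a, nat) decision_tree" where
  "then_min b (Output r) = Output (min b r)"
| "then_min b (Query x nx) = Query x (\<lambda>a. then_min b (nx a))"

primrec seq_min :: "('q, 'a, nat) decision_tree \<Rightarrow> ('q, 'a, nat) decision_tree \<Rightarrow> ('q, 'a, nat) decision_tree" where
  "seq_min (Output r) t = then_min r t"
| "seq_min (Query x nx) t = Query x (\<lambda>a. seq_min (nx a) t)"

primrec min_tree :: "nat \<Rightarrow> ('q, 'a, nat) decision_tree list \<Rightarrow> ('q, 'a, nat) decision_tree" where
  "min_tree b [] = Output b"
| "min_tree b (t # ts) = seq_min t (min_tree b ts)"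

lemma tree_output_then_min: "tree_output f (then_min b t) = min b (tree_output f t)"
  by (induction t) auto

lemma tree_output_seq_min: "tree_output f (seq_min t t') = min (tree_output f t) (tree_output f t')"
  by (induction t) (auto simp: tree_output_then_min)

lemma tree_output_min_tree:
  "l \<le> tree_output f (min_tree b ts) \<longleftrightarrow> l \<le> b \<and> (\<forall>t\<in>set ts. l \<le> tree_output f t)"
  "t \<in> set ts \<Longrightarrow> tree_output f (min_tree b ts) \<le> tree_output f t"
  by (induction ts) (auto simp: tree_output_seq_min min.coboundedI2)

lemma query_bounded_then_min: "query_bounded t k \<Longrightarrow> query_bounded (then_min b t) k"
  by (induction t arbitrary: k) auto

lemma query_bounded_seq_min:
  "query_bounded t k \<Longrightarrow> query_bounded t' k' \<Longrightarrow> query_bounded (seq_min t t') (k + k')"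
proof (induction t arbitrary: k)
  case (Output r)
  then show ?case using query_bounded_mono[OF query_bounded_then_min] by fastforce
next
  case (Query x nx)
  then obtain m where "k = Suc m" by (cases k) auto
  then show ?case using Query by simp
qed

lemma query_bounded_min_tree:
  "(\<And>t. t \<in> set ts \<Longrightarrow> query_bounded t k) \<Longrightarrow> query_bounded (min_tree b ts) (length ts * k)"
  by (induction ts) (auto intro: query_bounded_seq_min)

lemma admissible_then_min: "admissible X t \<Longrightarrow> admissible X (then_min b t)"
  by (induction t) auto

lemma admissible_seq_min: "admissible X t \<Longrightarrow> admissible X t' \<Longrightarrow> admissible X (seq_min t t')"
  by (induction t) (auto simp: admissible_then_min)

lemma admissible_min_tree: "(\<And>t. t \<in> set ts \<Longrightarrow> admissible X t) \<Longrightarrow> admissible X (min_tree b ts)"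
  by (induction ts) (auto intro: admissible_seq_min)

lemma expectation_of_bool_bounds:
  "0 \<le> measure_pmf.expectation p (\<lambda>x. of_bool (P x) :: real)"
  "finite (set_pmf p) \<Longrightarrow> measure_pmf.expectation p (\<lambda>x. of_bool (P x) :: real) \<le> 1"
  using expectation_mono_finite[of p "\<lambda>x. of_bool (P x)" "\<lambda>_. 1"]
  by (auto intro!: Bochner_Integration.integral_nonneg)

lemma expectation_not:
  assumes "finite (set_pmf p)"
  shows "measure_pmf.expectation p (\<lambda>x. of_bool (\<not> P x) :: real) = 1 - measure_pmf.expectation p (\<lambda>x. of_bool (P x))"
proof -
  have "measure_pmf.expectation p (\<lambda>x. of_bool (\<not> P x) :: real) = measure_pmf.expectation p (\<lambda>x. 1 - of_bool (P x))"
    by (intro Bochner_Integration.integral_cong) auto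
  also have "\<dots> = 1 - measure_pmf.expectation p (\<lambda>x. of_bool (P x))"
    by (subst Bochner_Integration.integral_diff) (auto intro: integrable_measure_pmf_finite[OF assms])
  finally show ?thesis .
qed

text \<open>Bernoulli's inequality bounds the probability that some run falls below
  \<open>l\<close>; independence of the runs gives \<open>(1 - \<beta>) ^ K\<close> for none being
  equal to \<open>l\<close>. In all other cases the minimum is \<open>l\<close>.\<close>

lemma min_tree_prob:
  assumes fin: "finite (set_pmf p)" and l: "l \<le> b"
    and ge: "1 - \<epsilon> \<le> measure_pmf.expectation p (\<lambda>t. of_bool (l \<le> tree_output f t))" "0 \<le> \<epsilon>" "\<epsilon> \<le> 1"
    and eq: "\<beta> \<le> measure_pmf.expectation p (\<lambda>t. of_bool (tree_output f t = l))"
  shows "1 - real K * \<epsilon> - (1 - \<beta>) ^ K \<le> measure_pmf.expectation (map_pmf (min_tree b) (replicate_pmf K p))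
     (\<lambda>t. of_bool (tree_output f t = l))"
    and "1 - real K * \<epsilon> \<le> measure_pmf.expectation (map_pmf (min_tree b) (replicate_pmf K p))
     (\<lambda>t. of_bool (l \<le> tree_output f t))"
proof -
  let ?E = "measure_pmf.expectation (replicate_pmf K p)"
  have finK: "finite (set_pmf (replicate_pmf K p))" by (rule finite_set_replicate_pmf[OF fin])
  have "1 - real K * \<epsilon> \<le> (1 - \<epsilon>) ^ K" using Bernoulli_inequality[of "- \<epsilon>" K] ge by simp
  also have "\<dots> \<le> ?E (\<lambda>ts. of_bool (\<forall>t\<in>set ts. l \<le> tree_output f t))"
    unfolding expectation_replicate_all[OF fin] using ge by (intro power_mono) auto
  finally have all: "1 - real K * \<epsilon> \<le> ?E (\<lambda>ts. of_bool (\<forall>t\<in>set ts. l \<le> tree_output f t))" .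
  then show "1 - real K * \<epsilon> \<le> measure_pmf.expectation (map_pmf (min_tree b) (replicate_pmf K p))
     (\<lambda>t. of_bool (l \<le> tree_output f t))"
    using l by (simp add: tree_output_min_tree(1))
  have "?E (\<lambda>ts. of_bool (\<forall>t\<in>set ts. tree_output f t \<noteq> l)) \<le> (1 - \<beta>) ^ K"
    unfolding expectation_replicate_all[OF fin] expectation_not[OF fin]
    using eq expectation_of_bool_bounds(2)[OF fin] by (intro power_mono) (auto simp: algebra_simps)
  with all have "1 - real K * \<epsilon> - (1 - \<beta>) ^ K
     \<le> ?E (\<lambda>ts. of_bool (\<forall>t\<in>set ts. l \<le> tree_output f t)) - ?E (\<lambda>ts. of_bool (\<forall>t\<in>set ts. tree_output f t \<noteq> l))"
    by linarith
  also have "\<dots> = ?E (\<lambda>ts. of_bool (\<forall>t\<in>set ts. l \<le> tree_output f t) - of_bool (\<forall>t\<in>set ts. tree_output f t \<noteq> l))"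
    by (subst Bochner_Integration.integral_diff) (auto intro: integrable_measure_pmf_finite[OF finK])
  also have "\<dots> \<le> ?E (\<lambda>ts. of_bool (tree_output f (min_tree b ts) = l))"
  proof (rule expectation_mono_finite[OF finK])
    fix ts
    have "tree_output f (min_tree b ts) = l"
      if 1: "\<forall>t\<in>set ts. l \<le> tree_output f t" and 2: "\<not> (\<forall>t\<in>set ts. tree_output f t \<noteq> l)"
    proof -
      obtain t where "t \<in> set ts" "tree_output f t = l" using 2 by blast
      then have "tree_output f (min_tree b ts) \<le> l" using tree_output_min_tree(2) by fastforce
      moreover have "l \<le> tree_output f (min_tree b ts)" using 1 l by (simp add: tree_output_min_tree(1))
      ultimately show ?thesis by simp
    qed
    then show "of_bool (\<forall>t\<in>set ts. l \<le> tree_output f t) - of_bool (\<forall>t\<in>set ts. tree_output f t \<noteq> l)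
      \<le> (of_bool (tree_output f (min_tree b ts) = l) :: real)" by (auto simp: of_bool_def)
  qed
  finally show "1 - real K * \<epsilon> - (1 - \<beta>) ^ K \<le> measure_pmf.expectation (map_pmf (min_tree b) (replicate_pmf K p))
     (\<lambda>t. of_bool (tree_output f t = l))" by simp
qed

section \<open>Minimum over independent runs\<close>

definition min_degree :: "nat \<Rightarrow> nat set set \<Rightarrow> nat" where
  "min_degree n E = Min ((\<lambda>v. card (nbhd E v)) ` {..<n})"

definition cut_pmf :: "nat \<Rightarrow> nat \<Rightarrow> nat \<Rightarrow> nat \<Rightarrow> nat \<Rightarrow> nat \<Rightarrow> nat \<Rightarrow> (nat set, nat \<Rightarrow> nat, nat) decision_tree pmf" where
  "cut_pmf n \<tau> M q L k K = map_pmf (min_tree (n * n)) (replicate_pmf K (contraction_pmf n \<tau> M q L k))"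

lemma cut_pmf_tree:
  assumes n: "n \<ge> 2" and t: "t \<in> set_pmf (cut_pmf n \<tau> M q L k K)"
  shows "query_bounded t (K * (q + 2 * (L * k) + M))" "admissible (Pow {..<n}) t"
proof -
  obtain ts where ts: "t = min_tree (n * n) ts" "length ts = K" "\<And>t. t \<in> set ts \<Longrightarrow> t \<in> set_pmf (contraction_pmf n \<tau> M q L k)"
    using t by (auto simp: cut_pmf_def set_replicate_pmf lists_eq_set)
  note tree = contraction_pmf_tree[OF n ts(3)]
  show "query_bounded t (K * (q + 2 * (L * k) + M))"
    unfolding ts(1) ts(2)[symmetric] by (rule query_bounded_min_tree[OF tree(1)])
  show "admissible (Pow {..<n}) t" unfolding ts(1) by (rule admissible_min_tree[OF tree(2)])
qed

lemma finite_cut_pmf: "n \<ge> 2 \<Longrightarrow> finite (set_pmf (cut_pmf n \<tau> M q L k K))"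
  unfolding cut_pmf_def by (auto intro!: finite_imageI finite_set_replicate_pmf finite_contraction_pmf)

text \<open>Either the minimum degree equals the edge connectivity, and the runs only have to avoid
  underestimates, or all degrees exceed it and the contraction analysis applies.\<close>

lemma cut_pmf_prob:
  assumes n: "n \<ge> 2" and G: "simple_graph {..<n} E"
    and M: "2 / real M \<le> 1 / 512" "M > 0" and miss: "(1 - real \<tau> / real n) ^ k \<le> 1 / real n" "\<tau> \<le> n"
    and L: "real n \<le> 2 ^ L"
    and \<epsilon>: "real n * (real n + 1) ^ \<tau> / 2 ^ q \<le> \<epsilon>" "\<epsilon> \<le> 1 / 2"
  shows "1 - real K * \<epsilon> - (1 - 1 / 1024) ^ K \<le> measure_pmf.expectation (cut_pmf n \<tau> M q L k K)
     (\<lambda>t. of_bool (min (tree_output (crossing E) t) (min_degree n E) = edge_connectivity {..<n} E))"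
proof -
  let ?l = "edge_connectivity {..<n} E"
  let ?p = "contraction_pmf n \<tau> M q L k"
  have fin: "finite (set_pmf ?p)" by (rule finite_contraction_pmf[OF n])
  have ne: "(\<lambda>v. card (nbhd E v)) ` {..<n} \<noteq> {}" using n by (auto simp: lessThan_empty_iff)
  have le: "?l \<le> card (nbhd E v)" if "v < n" for v
    using that n by (intro edge_connectivity_le_card_nbhd[OF G]) auto
  have "card (nbhd E 0) \<le> card {..<n}" using nbhd_subset[OF G, of 0] by (intro card_mono) auto
  then have triv: "?l \<le> n * n" using le[of 0] n by (simp add: le_trans)
  have deg: "?l \<le> min_degree n E" unfolding min_degree_def using ne le by (subst Min_ge_iff) auto
  have "0 \<le> real n * (real n + 1) ^ \<tau> / 2 ^ q" by simp
  then have e0: "0 \<le> \<epsilon>" using \<epsilon>(1) by linarith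
  have ge: "1 - \<epsilon> \<le> measure_pmf.expectation ?p (\<lambda>t. of_bool (?l \<le> tree_output (crossing E) t))"
    using contraction_ge_prob[OF n G, of \<tau> q M L k] \<epsilon>(1) by linarith
  have fc: "finite (set_pmf (cut_pmf n \<tau> M q L k K))" by (rule finite_cut_pmf[OF n])
  show ?thesis
  proof (cases "min_degree n E = ?l")
    case True
    have "1 - real K * \<epsilon> - (1 - 1 / 1024) ^ K \<le> 1 - real K * \<epsilon>" by simp
    also have "\<dots> \<le> measure_pmf.expectation (cut_pmf n \<tau> M q L k K) (\<lambda>t. of_bool (?l \<le> tree_output (crossing E) t))"
      unfolding cut_pmf_def using \<epsilon>(2) expectation_of_bool_bounds(1)
      by (intro min_tree_prob(2)[OF fin triv ge e0, of 0]) auto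
    also have "\<dots> \<le> measure_pmf.expectation (cut_pmf n \<tau> M q L k K)
     (\<lambda>t. of_bool (min (tree_output (crossing E) t) (min_degree n E) = ?l))"
      using True by (intro expectation_mono_finite[OF fc]) (auto simp: min_def)
    finally show ?thesis .
  next
    case False
    have nontrivial: "?l < card (nbhd E v)" if v: "v < n" for v
    proof -
      have "min_degree n E \<le> card (nbhd E v)" unfolding min_degree_def using v by (intro Min_le) auto
      then show ?thesis using False deg by simp
    qed
    \<comment> \<open>Undecodable sets cost at most half of the success probability
      \<open>1 / 512\<close>.\<close>
    have half: "1 / 1024 \<le> (1 - x) / 512" if "x \<le> 1 / 2" for x :: real using that by simp
    have "1 / 1024 \<le> (1 - real n * (real n + 1) ^ \<tau> / 2 ^ q) / 512" by (rule half[OF order_trans[OF \<epsilon>]])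
    then have eq: "1 / 1024 \<le> measure_pmf.expectation ?p (\<lambda>t. of_bool (tree_output (crossing E) t = ?l) :: real)"
      using contraction_eq_prob[OF n G nontrivial M miss L, of q] by linarith
    have "1 - real K * \<epsilon> - (1 - 1 / 1024) ^ K \<le> measure_pmf.expectation (cut_pmf n \<tau> M q L k K) (\<lambda>t. of_bool (tree_output (crossing E) t = ?l))"
      unfolding cut_pmf_def using \<epsilon>(2) by (intro min_tree_prob(1)[OF fin triv ge e0 _ eq]) auto
    also have "\<dots> \<le> measure_pmf.expectation (cut_pmf n \<tau> M q L k K)
     (\<lambda>t. of_bool (min (tree_output (crossing E) t) (min_degree n E) = ?l))"
      using deg by (intro expectation_mono_finite[OF fc]) (auto simp: min_def)
    finally show ?thesis .
  qed
qed

section \<open>Matrix-vector queries\<close>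

definition indicator_vector :: "nat \<Rightarrow> nat set \<Rightarrow> int Matrix.vec" where
  "indicator_vector n X = Matrix.vec n (\<lambda>i. of_bool (i \<in> X))"

text \<open>The answer \<open>y\<close> counts neighbours in \<open>X\<close>; for \<open>v\<close>
  in \<open>X\<close> the cut edges lead out of \<open>X\<close>, so the count is subtracted from
  the degree in \<open>d\<close>.\<close>

primrec matvec_continuation ::
  "nat \<Rightarrow> int Matrix.vec \<Rightarrow> nat \<Rightarrow> (nat set, nat \<Rightarrow> nat, nat) decision_tree \<Rightarrow> (int Matrix.vec, int Matrix.vec, nat) decision_tree" where
  "matvec_continuation n d b (Output r) = Output (min r b)"
| "matvec_continuation n d b (Query X nx) = Query (indicator_vector n X) (\<lambda>y. matvec_continuation n d b
     (nx (\<lambda>v. if v < n then nat (if v \<in> X then vec_index d v - vec_index y v else vec_index y v) else 0)))"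

text \<open>The first query returns all the degrees.\<close>

definition matvec_tree :: "nat \<Rightarrow> (nat set, nat \<Rightarrow> nat, nat) decision_tree \<Rightarrow> (int Matrix.vec, int Matrix.vec, nat) decision_tree" where
  "matvec_tree n t = Query (indicator_vector n {..<n})
     (\<lambda>d. matvec_continuation n d (Min ((\<lambda>v. nat (vec_index d v)) ` {..<n})) t)"

lemma adjacency_indicator:
  assumes "simple_graph {..<n} E" "v < n"
  shows "vec_index (adjacency_matrix n E *\<^sub>v indicator_vector n X) v = int (card (nbhd E v \<inter> X))"
proof -
  have "vec_index (adjacency_matrix n E *\<^sub>v indicator_vector n X) v
     = (\<Sum>u<n. (if {v, u} \<in> E then 1 else 0) * of_bool (u \<in> X))"
    using assms(2) by (simp add: adjacency_matrix_def indicator_vector_def scalar_prod_def lessThan_atLeast0)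
  also have "\<dots> = (\<Sum>u<n. of_bool (u \<in> nbhd E v \<inter> X))"
    by (intro sum.cong) (auto simp: nbhd_def insert_commute)
  also have "\<dots> = int (card ({..<n} \<inter> {u. u \<in> nbhd E v \<inter> X}))" by (subst sum_of_bool_eq) auto
  also have "{..<n} \<inter> {u. u \<in> nbhd E v \<inter> X} = nbhd E v \<inter> X" using nbhd_subset[OF assms(1), of v] by auto
  finally show ?thesis .
qed

lemma matvec_crossing:
  assumes G: "simple_graph {..<n} E"
  shows "(\<lambda>v. if v < n then nat (if v \<in> X then vec_index (adjacency_matrix n E *\<^sub>v indicator_vector n {..<n}) v
      - vec_index (adjacency_matrix n E *\<^sub>v indicator_vector n X) v
      else vec_index (adjacency_matrix n E *\<^sub>v indicator_vector n X) v) else 0) = crossing E X"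
proof
  fix v
  have fin: "finite (nbhd E v)" by (rule finite_nbhd[OF G])
  have V: "nbhd E v \<inter> {..<n} = nbhd E v" using nbhd_subset[OF G, of v] by auto
  have "card (nbhd E v) = card (nbhd E v \<inter> X) + card (nbhd E v - X)"
    by (metis Int_Diff_Un Int_Diff_disjoint card_Un_disjoint fin finite_Diff finite_Int)
  moreover have "{u \<in> nbhd E v. (u \<in> X) \<noteq> (v \<in> X)} = (if v \<in> X then nbhd E v - X else nbhd E v \<inter> X)" by auto
  ultimately show "(if v < n then nat (if v \<in> X then vec_index (adjacency_matrix n E *\<^sub>v indicator_vector n {..<n}) v
      - vec_index (adjacency_matrix n E *\<^sub>v indicator_vector n X) v
      else vec_index (adjacency_matrix n E *\<^sub>v indicator_vector n X) v) else 0) = crossing E X v"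
    using crossing_outside[OF G, of v X] by (auto simp: adjacency_indicator[OF G] V crossing_eq_card_nbhd[OF G])
qed

lemma matvec_tree_output:
  assumes G: "simple_graph {..<n} E"
  shows "tree_output (\<lambda>x. adjacency_matrix n E *\<^sub>v x) (matvec_tree n t) = min (tree_output (crossing E) t) (min_degree n E)"
proof -
  define d where "d = adjacency_matrix n E *\<^sub>v indicator_vector n {..<n}"
  have "nat (vec_index d v) = card (nbhd E v)" if "v < n" for v
  proof -
    have "nbhd E v \<inter> {..<n} = nbhd E v" using nbhd_subset[OF G, of v] by auto
    then show ?thesis using that by (simp add: d_def adjacency_indicator[OF G])
  qed
  then have b: "Min ((\<lambda>v. nat (vec_index d v)) ` {..<n}) = min_degree n E"
    unfolding min_degree_def by (intro arg_cong[where f = Min] image_cong) auto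
  have "tree_output (\<lambda>x. adjacency_matrix n E *\<^sub>v x) (matvec_continuation n d b t) = min (tree_output (crossing E) t) b" for b
    by (induction t) (simp_all add: d_def matvec_crossing[OF G])
  then show ?thesis by (simp add: matvec_tree_def b flip: d_def)
qed

lemma tree_queries_le: "query_bounded t k \<Longrightarrow> tree_queries f t \<le> k"
proof (induction t arbitrary: k)
  case (Query x nx)
  then obtain m where "k = Suc m" by (cases k) auto
  then show ?case using Query by simp
qed simp

lemma matvec_tree_bounded: "query_bounded t k \<Longrightarrow> query_bounded (matvec_tree n t) (Suc k)"
proof -
  have "query_bounded t k \<Longrightarrow> query_bounded (matvec_continuation n d b t) k" for d b
    by (induction t arbitrary: k) auto
  then show "query_bounded t k \<Longrightarrow> query_bounded (matvec_tree n t) (Suc k)" by (simp add: matvec_tree_def)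
qed

lemma matvec_tree_admissible: "admissible (zero_one_vecs n) (matvec_tree n t)"
proof -
  have "admissible (zero_one_vecs n) (matvec_continuation n d b t)" for d b
    by (induction t) (auto simp: zero_one_vecs_def indicator_vector_def)
  then show ?thesis by (auto simp: matvec_tree_def zero_one_vecs_def indicator_vector_def)
qed

lemma pmf_eq_expectation: "finite (set_pmf p) \<Longrightarrow> pmf p v = measure_pmf.expectation p (\<lambda>x. of_bool (x = v))"
  by (cases "v \<in> set_pmf p") (auto simp: expectation_finite set_pmf_iff of_bool_def if_distrib cong: if_cong)

section \<open>Rounded square roots and logarithms\<close>

definition sqrt_ceiling :: "nat \<Rightarrow> nat" where
  "sqrt_ceiling n = nat \<lceil>sqrt (real n)\<rceil>"

lemma sqrt_ceiling:
  assumes "n \<ge> 1"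
  shows "sqrt_ceiling n \<ge> 1" "n \<le> (sqrt_ceiling n)\<^sup>2" "sqrt_ceiling n \<le> n" "real (sqrt_ceiling n) \<le> 2 * sqrt (real n)"
proof -
  have s1: "sqrt (real n) \<ge> 1" using assms by simp
  have ge: "sqrt (real n) \<le> real (sqrt_ceiling n)" unfolding sqrt_ceiling_def using s1 by linarith
  have le: "real (sqrt_ceiling n) < sqrt (real n) + 1" unfolding sqrt_ceiling_def using s1 by linarith
  show "sqrt_ceiling n \<ge> 1" using ge s1 by linarith
  show "real (sqrt_ceiling n) \<le> 2 * sqrt (real n)" using le s1 by linarith
  have "real n = (sqrt (real n))\<^sup>2" by simp
  also have "\<dots> \<le> (real (sqrt_ceiling n))\<^sup>2" using ge s1 by (intro power_mono) auto
  finally show "n \<le> (sqrt_ceiling n)\<^sup>2" by (simp flip: of_nat_power)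
  have "sqrt (real n) \<le> real n" using assms s1 by (simp add: real_le_lsqrt power2_eq_square)
  then show "sqrt_ceiling n \<le> n" unfolding sqrt_ceiling_def by linarith
qed

lemma floorlog_two:
  assumes "n \<ge> 2"
  shows "floorlog 2 n \<ge> 1" "n < 2 ^ floorlog 2 n" "real (floorlog 2 n) \<le> 3 * ln (real n)"
proof -
  have b: "2 ^ (floorlog 2 n - 1) \<le> n" "n < 2 ^ floorlog 2 n" using floorlog_bounds[of n 2] assms by auto
  show "n < 2 ^ floorlog 2 n" by fact
  show one: "floorlog 2 n \<ge> 1" using b(2) assms by (cases "floorlog 2 n") auto
  have "ln (2 ^ (floorlog 2 n - 1) :: real) \<le> ln (real n)"
    using of_nat_mono[OF b(1), where ?'a = real] assms by (subst ln_le_cancel_iff) auto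
  then have "(real (floorlog 2 n) - 1) * ln 2 \<le> ln (real n)" using one by (simp add: ln_realpow of_nat_diff)
  moreover have "ln 2 \<le> ln (real n)" using assms by simp
  ultimately have "real (floorlog 2 n) * ln 2 \<le> 2 * ln (real n)" by (simp add: algebra_simps)
  \<comment> \<open>With \<open>ln 2 \<ge> 2 / 3\<close> the factor 2 of the previous bound becomes
    3.\<close>
  moreover have "real (floorlog 2 n) * (2 / 3) \<le> real (floorlog 2 n) * ln 2"
    using ln2_ge_two_thirds by (intro mult_left_mono) auto
  ultimately show "real (floorlog 2 n) \<le> 3 * ln (real n)" by linarith
qed

lemma soft_O_sqrtI:
  assumes "\<And>n. n \<ge> 2 \<Longrightarrow> f n \<le> C * sqrt_ceiling n * floorlog 2 n ^ p"
  shows "(\<lambda>n. real (f n)) \<in> soft_O (\<lambda>n. sqrt (real n))"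
proof -
  have "norm (real (f n)) \<le> (real C * 2 * 3 ^ p) * norm (sqrt (real n) * ln (real n) ^ p)" if n: "n \<ge> 2" for n
  proof -
    have "real (f n) \<le> real C * real (sqrt_ceiling n) * real (floorlog 2 n) ^ p"
      using of_nat_mono[OF assms[OF n], where ?'a = real] by simp
    also have "\<dots> \<le> real C * (2 * sqrt (real n)) * (3 * ln (real n)) ^ p"
      using sqrt_ceiling(4)[of n] floorlog_two(3)[OF n] n by (intro mult_mono power_mono mult_left_mono) auto
    finally show ?thesis using n by (simp add: power_mult_distrib mult_ac)
  qed
  then have "(\<lambda>n. real (f n)) \<in> O(\<lambda>n. sqrt (real n) * ln (real n) ^ p)"
    by (intro bigoI[where c = "real C * 2 * 3 ^ p"] eventually_sequentiallyI[of 2])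
  then show ?thesis unfolding soft_O_def by blast
qed

section \<open>Choice of the parameters\<close>

text \<open>Parameters for error probability \<open>n ^ (- c)\<close>: with \<open>s\<close> about \<open>sqrt n\<close> and \<open>l\<close> about \<open>log 2 n\<close>,
  the low degrees are those up to \<open>s\<close>, and each of the \<open>l\<close> rounds has \<open>s * l\<close> candidates.\<close>

definition decode_queries :: "nat \<Rightarrow> nat \<Rightarrow> nat" where
  "decode_queries c n = floorlog 2 n * (sqrt_ceiling n + 1) + (12 + c + floorlog 2 n + (c + 2) * floorlog 2 n)"

text \<open>With \<open>l = floorlog 2 n\<close> and this exponent, \<open>1 - 1 / 1024\<close> is
  raised to at most \<open>exp (- (c + 2) * l)\<close>, which is at most
  \<open>1 / n ^ (c + 2)\<close>.\<close>

definition repetitions :: "nat \<Rightarrow> nat \<Rightarrow> nat" where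
  "repetitions c n = 1024 * (c + 2) * floorlog 2 n"

text \<open>The factor 8 turns the power of \<open>7 / 8\<close> into at most
  \<open>exp (- (c + 3) * l)\<close> with \<open>l = floorlog 2 n\<close>; one power of
  \<open>n\<close> is spent on the initial number of marked vertices.\<close>

definition search_steps :: "nat \<Rightarrow> nat \<Rightarrow> nat" where
  "search_steps c n = 8 * (c + 3) * floorlog 2 n"

definition cut_algorithm :: "nat \<Rightarrow> nat \<Rightarrow> (nat set, nat \<Rightarrow> nat, nat) decision_tree pmf" where
  "cut_algorithm c n = cut_pmf n (sqrt_ceiling n) 1024 (decode_queries c n) (floorlog 2 n)
     (sqrt_ceiling n * floorlog 2 n) (repetitions c n)"

definition cut_queries :: "nat \<Rightarrow> nat \<Rightarrow> nat" where
  "cut_queries c n = repetitions c n *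
     (decode_queries c n + 2 * (floorlog 2 n * (sqrt_ceiling n * floorlog 2 n)) + 1024)"

text \<open>Combines \<open>exp 1 \<ge> 2\<close> with \<open>2 ^ floorlog 2 n > n\<close>.\<close>

lemma exp_floorlog_le:
  assumes "n \<ge> 2"
  shows "exp (- (real k * real (floorlog 2 n))) \<le> 1 / real n ^ k"
proof -
  have "exp (- real (floorlog 2 n)) \<le> 1 / 2 ^ floorlog 2 n"
  proof -
    have "(2 :: real) ^ floorlog 2 n \<le> exp 1 ^ floorlog 2 n" using exp_ge_add_one_self[of 1] by (intro power_mono) auto
    then show ?thesis by (simp add: exp_minus inverse_eq_divide divide_simps flip: exp_of_nat_mult)
  qed
  also have "\<dots> \<le> 1 / real n"
  proof -
    have "real n \<le> 2 ^ floorlog 2 n" using of_nat_mono[OF less_imp_le[OF floorlog_two(2)[OF assms]], where ?'a = real] by simp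
    then show ?thesis using assms by (intro divide_left_mono) auto
  qed
  finally have "exp (- real (floorlog 2 n)) ^ k \<le> (1 / real n) ^ k" by (intro power_mono) auto
  then show ?thesis by (simp add: power_divide flip: exp_of_nat_mult)
qed

lemma power_one_minus_le: "0 \<le> x \<Longrightarrow> x \<le> 1 \<Longrightarrow> (1 - x) ^ k \<le> exp (- (real k * x))"
proof -
  assume "0 \<le> x" "x \<le> 1"
  then have "(1 - x) ^ k \<le> exp (- x) ^ k" using exp_ge_add_one_self[of "- x"] by (intro power_mono) auto
  then show ?thesis by (simp flip: exp_of_nat_mult)
qed

lemma cut_queries_le: "n \<ge> 2 \<Longrightarrow> cut_queries c n \<le> (1024 * (c + 2) * (2 * c + 1050)) * sqrt_ceiling n * floorlog 2 n ^ 3"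
proof -
  assume n: "n \<ge> 2"
  obtain s l where s: "sqrt_ceiling n = Suc s" and l: "floorlog 2 n = Suc l"
    using sqrt_ceiling(1)[of n] floorlog_two(1)[OF n] n by (metis One_nat_def Suc_le_D le_trans one_le_numeral)
  have "decode_queries c n + 2 * (floorlog 2 n * (sqrt_ceiling n * floorlog 2 n)) + 1024
    \<le> (2 * c + 1050) * (Suc s * (Suc l * Suc l))"
    unfolding decode_queries_def s l by (simp add: algebra_simps)
  then have "cut_queries c n \<le> (1024 * (c + 2) * Suc l) * ((2 * c + 1050) * (Suc s * (Suc l * Suc l)))"
    unfolding cut_queries_def repetitions_def l by (rule mult_left_mono) simp
  also have "\<dots> = (1024 * (c + 2) * (2 * c + 1050)) * Suc s * Suc l ^ 3"
    by (simp only: power3_eq_cube mult_ac)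
  finally show ?thesis unfolding s l .
qed

lemma cut_algorithm_tree:
  assumes "n \<ge> 2" "t \<in> set_pmf (cut_algorithm c n)"
  shows "query_bounded t (cut_queries c n)" "admissible (Pow {..<n}) t"
  using cut_pmf_tree[OF assms(1) assms(2)[unfolded cut_algorithm_def]] unfolding cut_queries_def by auto

lemma cut_algorithm_prob:
  assumes n: "n \<ge> 2" and G: "simple_graph {..<n} E"
  shows "1 - 2 / real n ^ (c + 2) \<le> measure_pmf.expectation (cut_algorithm c n)
     (\<lambda>t. of_bool (min (tree_output (crossing E) t) (min_degree n E) = edge_connectivity {..<n} E))"
proof -
  define s where "s = sqrt_ceiling n"
  define l where "l = floorlog 2 n"
  have s: "n \<le> s\<^sup>2" "s \<le> n" using sqrt_ceiling[of n] n by (auto simp: s_def)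
  have nl: "real n + 1 \<le> 2 ^ l"
    using of_nat_mono[OF Suc_leI[OF floorlog_two(2)[OF n]], where ?'a = real] by (simp add: l_def)
  then have nl': "real n \<le> 2 ^ l" by linarith
  \<comment> \<open>The first summand of \<open>decode_queries\<close> cancels
    \<open>n * (n + 1) ^ s\<close>. Of the rest, \<open>12 + c + l\<close> bits pay for the
    repetitions, since \<open>1024 * (c + 2) * l \<le> 2 ^ (12 + c + l)\<close>, and
    \<open>(c + 2) * l\<close> bits give the error bound.\<close>
  define \<epsilon> where "\<epsilon> = (1 / 2 :: real) ^ (12 + c + l + (c + 2) * l)"
  have \<epsilon>: "real n * (real n + 1) ^ s / 2 ^ decode_queries c n \<le> \<epsilon>"
  proof -
    have "real n * (real n + 1) ^ s \<le> 2 ^ l * (2 ^ l) ^ s"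
      using nl nl' by (intro mult_mono power_mono) auto
    also have "\<dots> = 2 ^ (l * (s + 1))" by (simp add: power_add power_mult distrib_left)
    finally have "real n * (real n + 1) ^ s / 2 ^ decode_queries c n \<le> 2 ^ (l * (s + 1)) / 2 ^ decode_queries c n"
      by (intro divide_right_mono) auto
    also have "\<dots> = \<epsilon>"
    proof -
      have "2 ^ a / 2 ^ (a + b) = ((1 / 2) ^ b :: real)" for a b by (simp add: power_add power_divide)
      then show ?thesis unfolding decode_queries_def \<epsilon>_def s_def l_def by (simp only:)
    qed
    finally show ?thesis .
  qed
  have pow: "(1 / 2) ^ ((c + 2) * l) \<le> 1 / real n ^ (c + 2)"
  proof -
    have "real n ^ (c + 2) \<le> (2 ^ l) ^ (c + 2)" using nl' by (intro power_mono) auto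
    then have "1 / (2 ^ l) ^ (c + 2) \<le> 1 / real n ^ (c + 2)" using n by (intro divide_left_mono) auto
    moreover have "(1 / 2 :: real) ^ ((c + 2) * l) = 1 / (2 ^ l) ^ (c + 2)"
      by (simp only: mult.commute[of "c + 2" l] power_mult power_one_over)
    ultimately show ?thesis by (simp only:)
  qed
  have K\<epsilon>: "real (repetitions c n) * \<epsilon> \<le> 1 / real n ^ (c + 2)"
  proof -
    have "l < 2 ^ l" "c + 2 < 2 ^ (c + 2)" by (rule less_exp)+
    then have "1024 * (c + 2) * l \<le> 2 ^ 10 * 2 ^ (c + 2) * 2 ^ l" by (intro mult_mono) auto
    then have "real (repetitions c n) \<le> real (2 ^ 10 * 2 ^ (c + 2) * 2 ^ l)"
      unfolding repetitions_def l_def[symmetric] by (rule of_nat_mono)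
    also have "\<dots> = 2 ^ (12 + c + l)" by (simp add: power_add)
    finally have "real (repetitions c n) * \<epsilon> \<le> 2 ^ (12 + c + l) * \<epsilon>" by (intro mult_right_mono) (auto simp: \<epsilon>_def)
    also have "\<dots> = (1 / 2) ^ ((c + 2) * l)"
    proof -
      have "2 ^ a * (1 / 2) ^ (a + b) = ((1 / 2) ^ b :: real)" for a b by (simp add: power_add power_divide)
      then show ?thesis unfolding \<epsilon>_def by (simp only:)
    qed
    finally show ?thesis using pow by linarith
  qed
  have half: "\<epsilon> \<le> 1 / 2"
    unfolding \<epsilon>_def using power_decreasing[of 1 "12 + c + l + (c + 2) * l" "1 / 2 :: real"] by simp
  have fail: "(1 - 1 / 1024) ^ repetitions c n \<le> 1 / real n ^ (c + 2)"
  proof -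
    have "(1 - 1 / 1024) ^ repetitions c n \<le> exp (- (real (repetitions c n) * (1 / 1024)))"
      by (rule power_one_minus_le) auto
    also have "real (repetitions c n) * (1 / 1024) = real (c + 2) * real (floorlog 2 n)" by (simp add: repetitions_def)
    finally show ?thesis using exp_floorlog_le[OF n, of "c + 2"] by linarith
  qed
  \<comment> \<open>\<open>s * l\<close> candidates against a neighbourhood density of
    \<open>s / n\<close> give the exponent \<open>s * s * l / n \<ge> l\<close>.\<close>
  have miss: "(1 - real s / real n) ^ (s * l) \<le> 1 / real n"
  proof -
    have "(1 - real s / real n) ^ (s * l) \<le> exp (- (real (s * l) * (real s / real n)))"
      using s n by (intro power_one_minus_le) auto
    also have "\<dots> \<le> exp (- (real 1 * real l))"
    proof -
      have "real n \<le> real s * real s" using s(1) by (metis of_nat_le_iff of_nat_mult power2_eq_square)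
      then have "real l * real n \<le> real l * (real s * real s)" by (rule mult_left_mono) simp
      then have "real l \<le> real (s * l) * (real s / real n)" using n by (simp add: field_simps)
      then show ?thesis by simp
    qed
    also have "\<dots> \<le> 1 / real n" using exp_floorlog_le[OF n, of 1] by (simp add: l_def)
    finally show ?thesis .
  qed
  have "1 - real (repetitions c n) * \<epsilon> - (1 - 1 / 1024) ^ repetitions c n \<le> measure_pmf.expectation (cut_algorithm c n)
     (\<lambda>t. of_bool (min (tree_output (crossing E) t) (min_degree n E) = edge_connectivity {..<n} E))"
    unfolding cut_algorithm_def s_def[symmetric] l_def[symmetric]
  proof (rule cut_pmf_prob[OF n G _ _ miss s(2) _ \<epsilon> half])
    show "real n \<le> 2 ^ l" by (rule nl')
  qed auto
  then show ?thesis using K\<epsilon> fail by (simp add: add_divide_distrib)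
qed

text \<open>The spare factor \<open>n * n \<ge> 4\<close> absorbs the two or three error terms; this
  is why the parameters aim at \<open>c + 2\<close>.\<close>

lemma two_over_power_le: "n \<ge> 2 \<Longrightarrow> k \<le> 4 \<Longrightarrow> k / real n ^ (c + 2) \<le> 1 / real n ^ c" for k :: real
proof -
  assume n: "n \<ge> 2" and k: "k \<le> 4"
  have "2 * 2 \<le> real n * real n" using n by (intro mult_mono) auto
  then have "k \<le> real n * real n" using k by linarith
  then have "k / (real n * real n * real n ^ c) \<le> (real n * real n) / (real n * real n * real n ^ c)"
    by (intro divide_right_mono) auto
  also have "\<dots> = 1 / real n ^ c" using n by simp
  finally show ?thesis by (simp add: power_add power2_eq_square mult_ac)
qed

section \<open>The randomized and the quantum algorithm\<close>

lemma matvec_algorithm: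
  fixes c :: nat
  assumes n: "n \<ge> 2"
  defines "D \<equiv> map_pmf (matvec_tree n) (cut_algorithm c n)"
  shows "t \<in> set_pmf D \<Longrightarrow> admissible (zero_one_vecs n) t"
    and "t \<in> set_pmf D \<Longrightarrow> tree_queries g t \<le> Suc (cut_queries c n)"
    and "simple_graph {..<n} E \<Longrightarrow> 1 - 1 / real n ^ c \<le> measure_pmf.prob D
       {t. tree_output (\<lambda>x. adjacency_matrix n E *\<^sub>v x) t = edge_connectivity {..<n} E}"
proof -
  show "t \<in> set_pmf D \<Longrightarrow> admissible (zero_one_vecs n) t"
    by (auto simp: D_def matvec_tree_admissible)
  show "t \<in> set_pmf D \<Longrightarrow> tree_queries g t \<le> Suc (cut_queries c n)"
    unfolding D_def using cut_algorithm_tree(1)[OF n] by (auto intro!: tree_queries_le matvec_tree_bounded)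
  assume G: "simple_graph {..<n} E"
  have "measure_pmf.prob D {t. tree_output (\<lambda>x. adjacency_matrix n E *\<^sub>v x) t = edge_connectivity {..<n} E}
     = measure_pmf.expectation D (indicator {t. tree_output (\<lambda>x. adjacency_matrix n E *\<^sub>v x) t = edge_connectivity {..<n} E})"
    by simp
  also have "\<dots> = measure_pmf.expectation (cut_algorithm c n)
     (\<lambda>t. of_bool (min (tree_output (crossing E) t) (min_degree n E) = edge_connectivity {..<n} E))"
    unfolding D_def integral_map_pmf
    by (intro Bochner_Integration.integral_cong) (auto simp: indicator_def matvec_tree_output[OF G])
  finally show "1 - 1 / real n ^ c \<le> measure_pmf.prob D
       {t. tree_output (\<lambda>x. adjacency_matrix n E *\<^sub>v x) t = edge_connectivity {..<n} E}"
    using cut_algorithm_prob[OF n G, of c] two_over_power_le[OF n, of 2 c] by linarith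
qed

lemma min_degree_cut_function:
  assumes n: "n \<ge> 2" and G: "simple_graph {..<n} E"
  defines "f \<equiv> \<lambda>S. card (cut_edges E S)"
  shows "min_degree n E < n" "v < n \<Longrightarrow> min_degree n E \<le> f {v}" "marked n f b = {} \<Longrightarrow> b \<le> min_degree n E"
proof -
  have f: "f {v} = card (nbhd E v)" for v by (simp add: f_def card_nbhd[OF G])
  have ne: "(\<lambda>v. card (nbhd E v)) ` {..<n} \<noteq> {}" using n by (auto simp: lessThan_empty_iff)
  show le: "min_degree n E \<le> f {v}" if "v < n" for v
    unfolding f min_degree_def using that by (intro Min_le) auto
  have "card (nbhd E 0) \<le> card ({..<n} - {0})" using nbhd_subset[OF G, of 0] by (intro card_mono) auto
  then show "min_degree n E < n" using le[of 0] n by (simp add: f)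
  show "b \<le> min_degree n E" if "marked n f b = {}"
  proof -
    have "\<forall>v<n. b \<le> card (nbhd E v)"
    proof (intro allI impI, rule ccontr)
      fix v assume "v < n" "\<not> b \<le> card (nbhd E v)"
      then have "v \<in> marked n f b" by (simp add: marked_def f)
      then show False using that by simp
    qed
    then show ?thesis unfolding min_degree_def using ne by (subst Min_ge_iff) auto
  qed
qed

lemma cut_function_less:
  assumes "n \<ge> 1" "f \<in> cut_functions n"
  shows "f S < 2 ^ cut_bits n"
  using assms(2)
proof (rule cut_functionsE)
  fix E assume E: "simple_graph {..<n} E" "f = (\<lambda>S. card (cut_edges E S))"
  have "2 * card (cut_edges E S) = (\<Sum>v<n. crossing E S v)" using sum_crossing_all[OF E(1)] by simp
  also have "\<dots> \<le> (\<Sum>v<n. n)"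
    using crossing_less[OF E(1)] by (intro sum_mono less_imp_le) (metis card_lessThan)
  finally have "f S \<le> n * n" by (simp add: E(2))
  also have "n * n < 2 ^ cut_bits n"
    unfolding cut_bits_def using floorlog_bounds[of "n * n" 2] assms(1) by simp
  finally show ?thesis .
qed

text \<open>The factor 2 is the pair of oracle calls behind a phase query, and a vector of crossing
  numbers costs 5 phase queries for each bit position.\<close>

definition quantum_queries :: "nat \<Rightarrow> nat \<Rightarrow> nat" where
  "quantum_queries c n = 2 * (5 * floorlog 2 n * cut_queries c n
     + search_steps c n * (sqrt_ceiling n + 5 * floorlog 2 n))"

lemma quantum_queries_le:
  "n \<ge> 2 \<Longrightarrow> quantum_queries c n \<le> (10240 * (c + 2) * (2 * c + 1050) + 96 * (c + 3)) * sqrt_ceiling n * floorlog 2 n ^ 4"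
proof -
  assume n: "n \<ge> 2"
  obtain s l where s: "sqrt_ceiling n = Suc s" and l: "floorlog 2 n = Suc l"
    using sqrt_ceiling(1)[of n] floorlog_two(1)[OF n] n by (metis One_nat_def Suc_le_D le_trans one_le_numeral)
  have "2 * (5 * floorlog 2 n * cut_queries c n)
     \<le> 2 * (5 * floorlog 2 n * ((1024 * (c + 2) * (2 * c + 1050)) * sqrt_ceiling n * floorlog 2 n ^ 3))"
    using cut_queries_le[OF n] by (intro mult_left_mono) auto
  also have "\<dots> = 10240 * (c + 2) * (2 * c + 1050) * sqrt_ceiling n * floorlog 2 n ^ 4"
  proof -
    have "floorlog 2 n ^ 4 = floorlog 2 n * floorlog 2 n ^ 3" by (simp add: eval_nat_numeral)
    then show ?thesis by simp
  qed
  finally have 1: "2 * (5 * floorlog 2 n * cut_queries c n) \<le> 10240 * (c + 2) * (2 * c + 1050) * sqrt_ceiling n * floorlog 2 n ^ 4" .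
  have "Suc s + 5 * Suc l \<le> 6 * (Suc s * Suc l)" by (simp add: algebra_simps)
  also have "\<dots> \<le> 6 * (Suc s * Suc l ^ 3)"
    by (intro mult_left_mono) (auto simp: power3_eq_cube)
  finally have "2 * (search_steps c n * (sqrt_ceiling n + 5 * floorlog 2 n))
     \<le> 2 * (8 * (c + 3) * Suc l * (6 * (Suc s * Suc l ^ 3)))"
    unfolding search_steps_def s l by (intro mult_left_mono) auto
  also have "\<dots> = 96 * (c + 3) * sqrt_ceiling n * floorlog 2 n ^ 4"
  proof -
    have "Suc l ^ 4 = Suc l * Suc l ^ 3" by (simp add: eval_nat_numeral)
    moreover have "2 * (8 * a * x * (6 * (y * z))) = 96 * a * y * (x * z)" for a x y z :: nat by simp
    ultimately show ?thesis unfolding s l by (simp only:)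
  qed
  finally have "2 * (search_steps c n * (sqrt_ceiling n + 5 * floorlog 2 n)) \<le> 96 * (c + 3) * sqrt_ceiling n * floorlog 2 n ^ 4" .
  with 1 show ?thesis unfolding quantum_queries_def by (simp add: distrib_left distrib_right)
qed

lemma quantum_algorithm:
  assumes n: "n \<ge> 2"
  shows "\<exists>Q. num_queries Q = quantum_queries c n \<and> valid_quantum_algorithm n (cut_bits n) Q \<and>
     (\<forall>E. simple_graph {..<n} E \<longrightarrow> 1 - 1 / real n ^ c \<le>
        quantum_output_prob n (cut_bits n) Q (\<lambda>S. card (cut_edges E S)) (edge_connectivity {..<n} E))"
proof -
  have l: "n \<le> 2 ^ floorlog 2 n" using floorlog_two(2)[OF n] by simp
  have s: "sqrt_ceiling n > 0" "n \<le> (sqrt_ceiling n)\<^sup>2" using sqrt_ceiling[of n] n by auto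
  have fin: "finite (set_pmf (cut_algorithm c n))" unfolding cut_algorithm_def by (rule finite_cut_pmf[OF n])
  define D1 where "D1 f = map_pmf (tree_output (cut_crossing f)) (cut_algorithm c n)" for f
  have D1: "q_samples n (cut_functions n) (5 * floorlog 2 n * cut_queries c n) D1"
    unfolding D1_def using cut_algorithm_tree[OF n] l fin by (intro q_samples_random_tree) auto
  obtain D2 where D2: "q_samples n (cut_functions n) (search_steps c n * (sqrt_ceiling n + 5 * floorlog 2 n)) D2"
    "\<And>f b b'. f \<in> cut_functions n \<Longrightarrow> b \<in> set_pmf (D2 f) \<Longrightarrow> \<forall>v<n. b' \<le> f {v} \<Longrightarrow> b' < n \<Longrightarrow> b' \<le> b"
    "\<And>f. f \<in> cut_functions n \<Longrightarrow> measure_pmf.expectation (D2 f) (\<lambda>b. real (card (marked n f b))) \<le> n * (7 / 8) ^ search_steps c n"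
    using q_samples_minimum[of n "sqrt_ceiling n" "floorlog 2 n" "search_steps c n"] n s l by auto
  define D where "D f = bind_pmf (D1 f) (\<lambda>r. map_pmf (min r) (D2 f))" for f
  have "q_samples n (cut_functions n) (5 * floorlog 2 n * cut_queries c n
     + search_steps c n * (sqrt_ceiling n + 5 * floorlog 2 n)) D"
    unfolding D_def
  proof (rule q_samples_bind[OF D1])
    fix r
    show "q_samples n {f \<in> cut_functions n. r \<in> set_pmf (D1 f)} (search_steps c n * (sqrt_ceiling n + 5 * floorlog 2 n))
       (\<lambda>f. map_pmf (min r) (D2 f))"
      by (rule q_samples_cong[OF q_samples_map[OF D2(1)]]) auto
  qed
  then have "\<exists>Q. valid_quantum_algorithm n (cut_bits n) Q \<and> num_queries Q = quantum_queries c n \<and>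
     (\<forall>f\<in>cut_functions n. \<forall>v. quantum_output_prob n (cut_bits n) Q f v = pmf (D f) v)"
    unfolding quantum_queries_def
  proof (rule quantum_algorithm_of_samples[where m = "cut_bits n"])
    show "\<And>f S. f \<in> cut_functions n \<Longrightarrow> S \<subseteq> {..<n} \<Longrightarrow> f S < 2 ^ cut_bits n"
      using cut_function_less n by simp
  qed blast
  then obtain Q where Q: "valid_quantum_algorithm n (cut_bits n) Q" "num_queries Q = quantum_queries c n"
    "\<And>f v. f \<in> cut_functions n \<Longrightarrow> quantum_output_prob n (cut_bits n) Q f v = pmf (D f) v"
    by blast
  have prob: "1 - 1 / real n ^ c \<le> pmf (D (\<lambda>S. card (cut_edges E S))) (edge_connectivity {..<n} E)"
    if G: "simple_graph {..<n} E" for E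
  proof -
    define f where "f = (\<lambda>S. card (cut_edges E S))"
    define e where "e = edge_connectivity {..<n} E"
    have f: "f \<in> cut_functions n" using G by (auto simp: cut_functions_def f_def)
    have deg: "min_degree n E < n" "\<forall>v<n. min_degree n E \<le> f {v}" "marked n f b = {} \<Longrightarrow> b \<le> min_degree n E" for b
      using min_degree_cut_function[OF n G] by (simp_all add: f_def)
    have cross: "cut_crossing f = crossing E" using cut_crossing_eq[OF G] by (auto simp: f_def)
    have fin2: "finite (set_pmf (D2 f))" by (rule q_samples_finite[OF D2(1) f])
    have fin1: "finite (set_pmf (D1 f))" by (rule q_samples_finite[OF D1 f])
    let ?m = "measure_pmf.expectation (D2 f) (\<lambda>b. real (card (marked n f b)))"
    \<comment> \<open>If a vertex is still below \<open>b\<close>, the count is at least 1 and the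
      left side is not positive; otherwise \<open>b\<close> is the minimum degree. This is Markov's
      inequality taken pointwise.\<close>
    have inner: "of_bool (min r (min_degree n E) = e) - ?m \<le> measure_pmf.expectation (D2 f) (\<lambda>b. of_bool (min r b = e))" for r
    proof -
      have "of_bool (min r (min_degree n E) = e) - ?m
        = measure_pmf.expectation (D2 f) (\<lambda>b. of_bool (min r (min_degree n E) = e) - real (card (marked n f b)))"
        by (subst Bochner_Integration.integral_diff) (auto intro: integrable_measure_pmf_finite[OF fin2])
      also have "\<dots> \<le> measure_pmf.expectation (D2 f) (\<lambda>b. of_bool (min r b = e))"
      proof (rule expectation_mono_finite[OF fin2])
        fix b assume b: "b \<in> set_pmf (D2 f)"
        show "of_bool (min r (min_degree n E) = e) - real (card (marked n f b)) \<le> of_bool (min r b = e)"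
        proof (cases "marked n f b = {}")
          case True
          then have "b = min_degree n E" using deg D2(2)[OF f b, of "min_degree n E"] by (simp add: le_antisym)
          then show ?thesis by simp
        next
          case False
          then have "1 \<le> card (marked n f b)" by (simp add: Suc_le_eq card_gt_0_iff marked_def)
          then have "1 \<le> real (card (marked n f b))" by simp
          then show ?thesis by (auto simp: of_bool_def)
        qed
      qed
      finally show ?thesis .
    qed
    have m: "?m \<le> 1 / real n ^ (c + 2)"
    proof -
      have "(7 / 8 :: real) ^ search_steps c n \<le> exp (- (real (search_steps c n) * (1 / 8)))"
        using power_one_minus_le[of "1 / 8" "search_steps c n"] by simp
      also have "real (search_steps c n) * (1 / 8) = real (c + 3) * real (floorlog 2 n)" by (simp add: search_steps_def)
      finally have "(7 / 8 :: real) ^ search_steps c n \<le> 1 / real n ^ (c + 3)"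
        using exp_floorlog_le[OF n, of "c + 3"] by linarith
      then have "real n * (7 / 8) ^ search_steps c n \<le> real n * (1 / real n ^ (c + 3))" by (rule mult_left_mono) simp
      also have "\<dots> = 1 / real n ^ (c + 2)" using n by (simp add: eval_nat_numeral)
      finally show ?thesis using D2(3)[OF f] by linarith
    qed
    have "1 - 2 / real n ^ (c + 2) - 1 / real n ^ (c + 2)
      \<le> measure_pmf.expectation (D1 f) (\<lambda>r. of_bool (min r (min_degree n E) = e)) - ?m"
    proof -
      have "1 - 2 / real n ^ (c + 2) \<le> measure_pmf.expectation (D1 f) (\<lambda>r. of_bool (min r (min_degree n E) = e))"
        using cut_algorithm_prob[OF n G, of c] by (simp only: D1_def cross e_def integral_map_pmf)
      then show ?thesis using m by linarith
    qed
    also have "\<dots> = measure_pmf.expectation (D1 f) (\<lambda>r. of_bool (min r (min_degree n E) = e) - ?m)"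
      by (subst Bochner_Integration.integral_diff) (auto intro: integrable_measure_pmf_finite[OF fin1])
    also have "\<dots> \<le> measure_pmf.expectation (D1 f) (\<lambda>r. measure_pmf.expectation (D2 f) (\<lambda>b. of_bool (min r b = e)))"
      by (intro expectation_mono_finite[OF fin1] inner)
    also have "\<dots> = measure_pmf.expectation (D f) (\<lambda>x. of_bool (x = e))"
      unfolding D_def using fin1 fin2 by (subst expectation_bind_pmf_finite) auto
    also have "\<dots> = pmf (D f) e"
      by (rule pmf_eq_expectation[symmetric]) (use fin1 fin2 in \<open>auto simp: D_def\<close>)
    finally show ?thesis using two_over_power_le[OF n, of 3 c] by (simp add: f_def e_def diff_divide_distrib)
  qed
  show ?thesis
  proof (intro exI[of _ Q] conjI allI impI Q(1,2))
    fix E assume G: "simple_graph {..<n} E"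
    then have "(\<lambda>S. card (cut_edges E S)) \<in> cut_functions n" by (auto simp: cut_functions_def)
    then show "1 - 1 / real n ^ c \<le> quantum_output_prob n (cut_bits n) Q (\<lambda>S. card (cut_edges E S)) (edge_connectivity {..<n} E)"
      using prob[OF G] by (simp add: Q(3))
  qed
qed

theorem theorem1p3:
  shows
    "(\<forall>c::nat. \<exists>Q :: nat \<Rightarrow> quantum_algorithm.
        (\<lambda>n. real (num_queries (Q n))) \<in> soft_O (\<lambda>n. sqrt (real n)) \<and>
        (\<forall>n\<ge>2.
           valid_quantum_algorithm n (cut_bits n) (Q n) \<and>
           (\<forall>E. simple_graph {..<n} E \<longrightarrow>
              quantum_output_prob n (cut_bits n) (Q n) (\<lambda>S. card (cut_edges E S))
                (edge_connectivity {..<n} E) \<ge> 1 - 1 / real n ^ c)))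
     \<and>
     (\<forall>c::nat. \<exists>(D :: nat \<Rightarrow> (int Matrix.vec, int Matrix.vec, nat) decision_tree pmf) (T :: nat \<Rightarrow> nat).
        (\<lambda>n. real (T n)) \<in> soft_O (\<lambda>n. sqrt (real n)) \<and>
        (\<forall>n\<ge>2.
           (\<forall>t \<in> set_pmf (D n). admissible (zero_one_vecs n) t) \<and>
           (\<forall>E. simple_graph {..<n} E \<longrightarrow>
              (\<forall>t \<in> set_pmf (D n). tree_queries (\<lambda>x. adjacency_matrix n E *\<^sub>v x) t \<le> T n) \<and>
              measure_pmf.prob (D n)
                {t. tree_output (\<lambda>x. adjacency_matrix n E *\<^sub>v x) t = edge_connectivity {..<n} E}
                \<ge> 1 - 1 / real n ^ c)))"
proof (intro conjI allI)
  fix c :: nat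
  obtain Q where Q: "\<And>n. n \<ge> 2 \<Longrightarrow> num_queries (Q n) = quantum_queries c n"
    "\<And>n. n \<ge> 2 \<Longrightarrow> valid_quantum_algorithm n (cut_bits n) (Q n)"
    "\<And>n E. n \<ge> 2 \<Longrightarrow> simple_graph {..<n} E \<Longrightarrow> 1 - 1 / real n ^ c \<le>
        quantum_output_prob n (cut_bits n) (Q n) (\<lambda>S. card (cut_edges E S)) (edge_connectivity {..<n} E)"
    using quantum_algorithm[of _ c] by metis
  have "(\<lambda>n. real (num_queries (Q n))) \<in> soft_O (\<lambda>n. sqrt (real n))"
  proof (rule soft_O_sqrtI)
    fix n :: nat assume n: "n \<ge> 2"
    show "num_queries (Q n) \<le> (10240 * (c + 2) * (2 * c + 1050) + 96 * (c + 3)) * sqrt_ceiling n * floorlog 2 n ^ 4"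
      unfolding Q(1)[OF n] by (rule quantum_queries_le[OF n])
  qed
  then show "\<exists>Q :: nat \<Rightarrow> quantum_algorithm.
        (\<lambda>n. real (num_queries (Q n))) \<in> soft_O (\<lambda>n. sqrt (real n)) \<and>
        (\<forall>n\<ge>2.
           valid_quantum_algorithm n (cut_bits n) (Q n) \<and>
           (\<forall>E. simple_graph {..<n} E \<longrightarrow>
              quantum_output_prob n (cut_bits n) (Q n) (\<lambda>S. card (cut_edges E S))
                (edge_connectivity {..<n} E) \<ge> 1 - 1 / real n ^ c))"
    using Q by blast
next
  fix c :: nat
  let ?D = "\<lambda>n. map_pmf (matvec_tree n) (cut_algorithm c n)"
  let ?T = "\<lambda>n. Suc (cut_queries c n)"
  have "(\<lambda>n. real (?T n)) \<in> soft_O (\<lambda>n. sqrt (real n))"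
  proof (rule soft_O_sqrtI)
    fix n :: nat assume n: "n \<ge> 2"
    have add_one: "Suc x \<le> (a + 1) * p" if "x \<le> a * p" "1 \<le> p" for x a p :: nat using that by simp
    have "1 \<le> sqrt_ceiling n * floorlog 2 n ^ 3"
      using sqrt_ceiling(1)[of n] floorlog_two(1)[OF n] n by (simp add: Suc_le_eq)
    then show "?T n \<le> (1024 * (c + 2) * (2 * c + 1050) + 1) * sqrt_ceiling n * floorlog 2 n ^ 3"
      using add_one[of "cut_queries c n" "1024 * (c + 2) * (2 * c + 1050)" "sqrt_ceiling n * floorlog 2 n ^ 3"]
        cut_queries_le[OF n, of c] by (simp only: mult.assoc)
  qed
  then show "\<exists>(D :: nat \<Rightarrow> (int Matrix.vec, int Matrix.vec, nat) decision_tree pmf) (T :: nat \<Rightarrow> nat).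
        (\<lambda>n. real (T n)) \<in> soft_O (\<lambda>n. sqrt (real n)) \<and>
        (\<forall>n\<ge>2.
           (\<forall>t \<in> set_pmf (D n). admissible (zero_one_vecs n) t) \<and>
           (\<forall>E. simple_graph {..<n} E \<longrightarrow>
              (\<forall>t \<in> set_pmf (D n). tree_queries (\<lambda>x. adjacency_matrix n E *\<^sub>v x) t \<le> T n) \<and>
              measure_pmf.prob (D n)
                {t. tree_output (\<lambda>x. adjacency_matrix n E *\<^sub>v x) t = edge_connectivity {..<n} E}
                \<ge> 1 - 1 / real n ^ c))"
    using matvec_algorithm[of _ _ c] by (intro exI[of _ ?D] exI[of _ ?T] conjI allI impI ballI)
qed

end
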